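(* For any stopping time $\tau\in\mathcal T$ let $\tau^{\mathcal P}(\tau):=\inf\{u\ge\tau : (L^1_u-F^1_u)\wedge(L^2_u-F^2_u)>0\}$. Suppose $\vartheta\in\mathcal T$ satisfies $\vartheta=\tau^{\mathcal P}(\vartheta)$ a.s. For $i\in\{1,2\}$ and $j\in\{1,2\}\setminus\{i\}$ define $G^\vartheta_i(t)=\mathbf 1_{\{t\ge\vartheta\}}$ and, for any $t\in[\vartheta,\infty)$, $$\alpha^\vartheta_i(t)=\begin{cases}1 & \text{if } t=\tau^{\mathcal P}(t),\ L^j_t=F^j_t\ \text{and}\ \bigl(L^i_t>F^i_t\ \text{or}\ F^j_t=M^j_t\bigr),\\[4pt] \mathbf 1_{\{L^1_t>F^1_t\}}\mathbf 1_{\{L^2_t>F^2_t\}}\dfrac{L^j_t-F^j_t}{L^j_t-M^j_t} & \text{else}\end{cases}$$ (and $\alpha^\vartheta_i=0$ on $[0,\vartheta)$). Then $(G^\vartheta_1,\alpha^\vartheta_1)$, $(G^\vartheta_2,\alpha^\vartheta_2)$ are an equilibrium in the subgame at $\vartheta$. The resulting payoffs are $$V_i^\vartheta(G_i^\vartheta,\alpha^\vartheta_i,G_j^\vartheta,\alpha^\vartheta_j)=F^i_\vartheta\,\mathbf 1_{\{L^j_\vartheta>F^j_\vartheta\}}+L^i_\vartheta\,\mathbf 1_{\{L^j_\vartheta=F^j_\vartheta\}}.$$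
   Context: **Timing game.** $(\Omega,\mathcal F,(\mathcal F_t)_{t\ge0},P)$ is a filtered probability space satisfying the usual conditions (right-continuous, complete); $\mathcal T$ is the set of all stopping times (values in $[0,\infty]$). For $i=1,2$, $L^i,F^i,M^i$ are adapted, a.s. right-continuous real processes of class (D) (a measurable process $X$ is of class (D) if $\{X_\tau:\tau\in\mathcal T,\ \tau<\infty\text{ a.s.}\}$ is uniformly integrable); $M^i$ has an extension $M^i_\infty$ with $E|M^i_\infty|<\infty$; $F^i_\infty:=M^i_\infty$; and $F^i_t\ge M^i_t$ a.s. for all $t\in\mathbb R_+$. ($L^i$, $F^i$, $M^i$: payoff of $i$ from stopping first, from the opponent stopping first, from simultaneous stopping.) Where the symbol $L^i_\infty$ formally occurs, it is read as $L^i_\infty:=M^i_\infty$. **Extended mixed strategies in a subgame.** Let $\vartheta\in\mathcal T$. An extended mixed strategy for player $i$ in the subgame starting at $\vartheta$ ($\vartheta$-strategy) is a pair of $[0,1]$-valued processes $(G^\vartheta_i,\alpha^\vartheta_i)$ such that: (i) $G^\vartheta_i$ is adapted, and a.s. right-continuous and non-decreasing with $G^\vartheta_i(s)=0$ for all $s<\vartheta$; (ii) $\alpha^\vartheta_i$ is progressively measurable and a.s. right-continuous at every time at which its value is in $(0,1)$; (iii) a.s., for all $t\ge0$, $\alpha^\vartheta_i(t)>0\Rightarrow G^\vartheta_i(t)=1$. Always set $G^\vartheta_i(0-)=0$, $G^\vartheta_i(\infty)=1$, $\alpha^\vartheta_i(\infty)=1$. $\Delta G(t)=G(t)-G(t-)$.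 **Outcome probabilities.** On $[0,1]^2\setminus\{(0,0)\}$ let $\mu_L(x,y)=\frac{x(1-y)}{x+y-xy}$, $\mu_M(x,y)=\frac{xy}{x+y-xy}$. Given $\vartheta$-strategies of both players, let $\hat\tau^\vartheta_k=\inf\{t\ge\vartheta:\alpha^\vartheta_k(t)>0\}$ ($k=1,2$) and $\hat\tau=\hat\tau^\vartheta=\inf\{t\ge\vartheta:\alpha^\vartheta_1(t)+\alpha^\vartheta_2(t)>0\}$. With superscript $\vartheta$ suppressed on the right-hand sides and $i\ne j$ in $\{1,2\}$, define $\lambda^\vartheta_{L,1},\lambda^\vartheta_{L,2},\lambda^\vartheta_M$ by: - If $\hat\tau<\hat\tau_j$: $\lambda^\vartheta_{L,i}=(1-G_i(\hat\tau-))(1-G_j(\hat\tau))$, $\lambda^\vartheta_M=(1-G_i(\hat\tau-))\alpha_i(\hat\tau)\Delta G_j(\hat\tau)$. - If $\hat\tau<\hat\tau_i$: $\lambda^\vartheta_{L,i}=(1-G_j(\hat\tau-))(1-\alpha_j(\hat\tau))\Delta G_i(\hat\tau)$, $\lambda^\vartheta_M=(1-G_j(\hat\tau-))\alpha_j(\hat\tau)\Delta G_i(\hat\tau)$. - If $\hat\tau=\hat\tau_1=\hat\tau_2$ and ($\alpha_1(\hat\tau)\vee\alpha_2(\hat\tau)=1$ or $\alpha_1(\hat\tau)\wedge\alpha_2(\hat\tau)>0$): $\lambda^\vartheta_{L,i}=(1-G_i(\hat\tau-))(1-G_j(\hat\tau-))\mu_L(\alpha_i(\hat\tau),\alpha_j(\hat\tau))$,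 $\lambda^\vartheta_M=(1-G_i(\hat\tau-))(1-G_j(\hat\tau-))\mu_M(\alpha_1(\hat\tau),\alpha_2(\hat\tau))$. - If $\hat\tau=\hat\tau_1=\hat\tau_2$, $\alpha_1(\hat\tau)\vee\alpha_2(\hat\tau)<1$ and $\alpha_1(\hat\tau)\wedge\alpha_2(\hat\tau)=0$: $\lambda^\vartheta_{L,i}=(1-G_i(\hat\tau-))(1-G_j(\hat\tau-))(1-\alpha_j(\hat\tau))\bigl(\alpha_i(\hat\tau)+(1-\alpha_i(\hat\tau))\tfrac12\{\liminf\mu_L(\alpha_i(t),\alpha_j(t))+\limsup\mu_L(\alpha_i(t),\alpha_j(t))\}\bigr)$, where $\liminf$ and $\limsup$ are taken as $t\searrow\hat\tau$ along $t$ with $\alpha_i(t)+\alpha_j(t)>0$; and $\lambda^\vartheta_M=(1-G_i(\hat\tau-))(1-G_j(\hat\tau-))-\lambda^\vartheta_{L,i}-\lambda^\vartheta_{L,j}$. **Payoffs.** The payoff of player $i$ in the subgame at $\vartheta$ is $$V^\vartheta_i(G^\vartheta_i,\alpha^\vartheta_i,G^\vartheta_j,\alpha^\vartheta_j)=E\Bigl[\int_{[0,\hat\tau)}(1-G^\vartheta_j(s))L^i_s\,dG^\vartheta_i(s)+\int_{[0,\hat\tau)}(1-G^\vartheta_i(s))F^i_s\,dG^\vartheta_j(s)+\sum_{s\in[0,\hat\tau)}\Delta G^\vartheta_i(s)\Delta G^\vartheta_j(s)M^i_s+\lambda^\vartheta_{L,i}L^i_{\hat\tau}+\lambda^\vartheta_{L,j}F^i_{\hat\tau}+\lambda^\vartheta_MM^i_{\hat\tau}\Bigm|\mathcal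 F_\vartheta\Bigr]$$ (integrals include a possible jump of the integrator at $0$). **Equilibrium in the subgame at $\vartheta$.** A pair of $\vartheta$-strategies such that for $i\neq j$ in $\{1,2\}$ and every $\vartheta$-strategy $(G^\vartheta_a,\alpha^\vartheta_a)$: $V_i^\vartheta(G_i^\vartheta,\alpha^\vartheta_i,G_j^\vartheta,\alpha^\vartheta_j)\ge V_i^\vartheta(G_a^\vartheta,\alpha^\vartheta_a,G_j^\vartheta,\alpha^\vartheta_j)$ a.s. *)

theory Defs
  imports "HOL-Probability.Probability"
begin

section \<open>Stochastic processes in continuous time\<close>

text \<open>
  The time axis is the type \<^typ>\<open>ennreal\<close>, that is \<open>[0,\<infinity>]\<close>, so that stopping times, the
  \<open>\<sigma>\<close>-algebras at stopping times and values of processes at time \<open>\<infinity>\<close> need no separate treatment.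
  Path properties are required on \<open>[0,\<infinity>)\<close> only.  The \<open>\<sigma>\<close>-algebra \<open>\<F> \<infinity>\<close> is any \<open>\<sigma>\<close>-algebra between
  the union of the \<open>\<F> t\<close>, \<open>t < \<infinity>\<close>, and the one of \<open>P\<close>; both usual conventions are instances.
\<close>

type_synonym 'a process = "ennreal \<Rightarrow> 'a \<Rightarrow> real"

locale usual_filtration =
  prob_space P + complete_measure P + filtration "space P" \<F>
  for P :: "'a measure" and \<F> :: "ennreal \<Rightarrow> 'a measure" +
  assumes sub_P: "sets (\<F> \<infinity>) \<subseteq> sets P"
    and null_sets: "null_sets P \<subseteq> sets (\<F> 0)"
    and right_continuous: "\<And>t. t < \<infinity> \<Longrightarrow> sets (\<F> t) = (\<Inter>s\<in>{t<..}. sets (\<F> s))"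

definition adapted :: "(ennreal \<Rightarrow> 'a measure) \<Rightarrow> 'a process \<Rightarrow> bool" where
  "adapted \<F> X \<longleftrightarrow> (\<forall>t. X t \<in> borel_measurable (\<F> t))"

definition measurable_process :: "'a measure \<Rightarrow> 'a process \<Rightarrow> bool" where
  "measurable_process P X \<longleftrightarrow>
     (\<lambda>(t, \<omega>). X t \<omega>) \<in> borel_measurable (restrict_space borel {..<\<infinity>} \<Otimes>\<^sub>M P)"

definition progressively_measurable :: "(ennreal \<Rightarrow> 'a measure) \<Rightarrow> 'a process \<Rightarrow> bool" where
  "progressively_measurable \<F> X \<longleftrightarrow>
     (\<forall>t<\<infinity>. (\<lambda>(s, \<omega>). X s \<omega>) \<in> borel_measurable (restrict_space borel {..t} \<Otimes>\<^sub>M \<F> t))"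

definition right_cont_at :: "(ennreal \<Rightarrow> real) \<Rightarrow> ennreal \<Rightarrow> bool" where
  "right_cont_at x t \<longleftrightarrow> (x \<longlongrightarrow> x t) (at_right t)"

definition AE_right_continuous :: "'a measure \<Rightarrow> 'a process \<Rightarrow> bool" where
  "AE_right_continuous P X \<longleftrightarrow> (AE \<omega> in P. \<forall>t<\<infinity>. right_cont_at (\<lambda>s. X s \<omega>) t)"

definition uniformly_integrable :: "'a measure \<Rightarrow> ('a \<Rightarrow> real) set \<Rightarrow> bool" where
  "uniformly_integrable P S \<longleftrightarrow> S \<subseteq> borel_measurable P \<and>
     (\<forall>\<epsilon>>0. \<exists>c. \<forall>f\<in>S. (\<integral>\<^sup>+\<omega>. ennreal \<bar>f \<omega>\<bar> * indicator {\<omega>. c < \<bar>f \<omega>\<bar>} \<omega> \<partial>P) \<le> ennreal \<epsilon>)"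

definition class_D :: "'a measure \<Rightarrow> (ennreal \<Rightarrow> 'a measure) \<Rightarrow> 'a process \<Rightarrow> bool" where
  "class_D P \<F> X \<longleftrightarrow> measurable_process P X \<and>
     uniformly_integrable P
       {\<lambda>\<omega>. X (\<tau> \<omega>) \<omega> | \<tau>. stopping_time \<F> \<tau> \<and> (AE \<omega> in P. \<tau> \<omega> < \<infinity>)}"


section \<open>The timing game\<close>

datatype player = Player1 | Player2

fun opponent :: "player \<Rightarrow> player" where
  "opponent Player1 = Player2"
| "opponent Player2 = Player1"

locale timing_game = usual_filtration P \<F>
  for P :: "'a measure" and \<F> :: "ennreal \<Rightarrow> 'a measure" +
  fixes L F M :: "player \<Rightarrow> 'a process"
  assumes adapted: "adapted \<F> (L i)" "adapted \<F> (F i)" "adapted \<F> (M i)"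
    and right_cont: "AE_right_continuous P (L i)" "AE_right_continuous P (F i)"
      "AE_right_continuous P (M i)"
    and class_D: "class_D P \<F> (L i)" "class_D P \<F> (F i)" "class_D P \<F> (M i)"
    and M_infinity: "integrable P (M i \<infinity>)"
    and F_infinity: "F i \<infinity> = M i \<infinity>"
    and L_infinity: "L i \<infinity> = M i \<infinity>"
    and F_ge_M: "\<And>t. t < \<infinity> \<Longrightarrow> AE \<omega> in P. F i t \<omega> \<ge> M i t \<omega>"


section \<open>Extended mixed strategies\<close>

text \<open>
  Processes are understood up to indistinguishability: the range \<open>[0,1]\<close> is required almost surely,
  like the other path properties.
\<close>

definition ext_mixed_strategy ::
    "'a measure \<Rightarrow> (ennreal \<Rightarrow> 'a measure) \<Rightarrow> ('a \<Rightarrow> ennreal) \<Rightarrow> 'a process \<Rightarrow> 'a process \<Rightarrow> bool" where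
  "ext_mixed_strategy P \<F> \<theta> G \<alpha> \<longleftrightarrow>
     (AE \<omega> in P. \<forall>t. G t \<omega> \<in> {0..1} \<and> \<alpha> t \<omega> \<in> {0..1}) \<and>
     adapted \<F> G \<and> AE_right_continuous P G \<and>
     (AE \<omega> in P. mono_on {..<\<infinity>} (\<lambda>t. G t \<omega>) \<and> (\<forall>s<\<theta> \<omega>. G s \<omega> = 0)) \<and>
     progressively_measurable \<F> \<alpha> \<and>
     (AE \<omega> in P. \<forall>t<\<infinity>. \<alpha> t \<omega> \<in> {0<..<1} \<longrightarrow> right_cont_at (\<lambda>s. \<alpha> s \<omega>) t) \<and>
     (AE \<omega> in P. \<forall>t<\<infinity>. \<alpha> t \<omega> > 0 \<longrightarrow> G t \<omega> = 1) \<and>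
     (\<forall>\<omega>\<in>space P. G \<infinity> \<omega> = 1 \<and> \<alpha> \<infinity> \<omega> = 1)"


section \<open>Outcome probabilities\<close>

text \<open>
  These are pathwise notions: \<open>g\<close> and \<open>a\<close> are paths of the two components of a strategy and
  \<open>v\<close> is the starting time of the subgame.
\<close>

definition left_limit :: "(ennreal \<Rightarrow> real) \<Rightarrow> ennreal \<Rightarrow> real" where
  "left_limit g t = (if t = 0 then 0 else Lim (at_left t) g)"

definition jump :: "(ennreal \<Rightarrow> real) \<Rightarrow> ennreal \<Rightarrow> real" where
  "jump g t = g t - left_limit g t"

definition mu_L :: "real \<Rightarrow> real \<Rightarrow> real" where
  "mu_L x y = x * (1 - y) / (x + y - x * y)"

definition mu_M :: "real \<Rightarrow> real \<Rightarrow> real" where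
  "mu_M x y = x * y / (x + y - x * y)"

definition first_pos :: "ennreal \<Rightarrow> (ennreal \<Rightarrow> real) \<Rightarrow> ennreal" where
  "first_pos v a = Inf {t. v \<le> t \<and> a t > 0}"

definition tau_hat :: "ennreal \<Rightarrow> (ennreal \<Rightarrow> real) \<Rightarrow> (ennreal \<Rightarrow> real) \<Rightarrow> ennreal" where
  "tau_hat v a b = first_pos v (\<lambda>t. a t + b t)"

text \<open>The average of the lower and upper limit of \<open>\<mu>\<^sub>L\<close> from the right at \<open>t\<close>, along times at
  which \<open>\<mu>\<^sub>L\<close> is defined; the values of \<open>\<mu>\<^sub>L\<close> lie in \<open>[0,1]\<close>.\<close>

definition mu_L_limit :: "ennreal \<Rightarrow> (ennreal \<Rightarrow> real) \<Rightarrow> (ennreal \<Rightarrow> real) \<Rightarrow> real" where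
  "mu_L_limit t ai aj =
     (let \<Phi> = at t within {s. t < s \<and> ai s + aj s > 0}; m = (\<lambda>s. ereal (mu_L (ai s) (aj s)))
      in 1/2 * (real_of_ereal (Liminf \<Phi> m) + real_of_ereal (Limsup \<Phi> m)))"

text \<open>Once \<open>\<tau> < first_pos v aj\<close> and \<open>\<tau> < first_pos v ai\<close> are excluded, all three times coincide.\<close>

definition lambda_L ::
    "ennreal \<Rightarrow> (ennreal \<Rightarrow> real) \<Rightarrow> (ennreal \<Rightarrow> real) \<Rightarrow> (ennreal \<Rightarrow> real) \<Rightarrow> (ennreal \<Rightarrow> real) \<Rightarrow> real" where
  "lambda_L v gi ai gj aj =
     (let \<tau> = tau_hat v ai aj in
      if \<tau> < first_pos v aj then (1 - left_limit gi \<tau>) * (1 - gj \<tau>)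
      else if \<tau> < first_pos v ai then (1 - left_limit gj \<tau>) * (1 - aj \<tau>) * jump gi \<tau>
      else if max (ai \<tau>) (aj \<tau>) = 1 \<or> min (ai \<tau>) (aj \<tau>) > 0 then
        (1 - left_limit gi \<tau>) * (1 - left_limit gj \<tau>) * mu_L (ai \<tau>) (aj \<tau>)
      else
        (1 - left_limit gi \<tau>) * (1 - left_limit gj \<tau>) * (1 - aj \<tau>) *
        (ai \<tau> + (1 - ai \<tau>) * mu_L_limit \<tau> ai aj))"

definition lambda_M ::
    "ennreal \<Rightarrow> (ennreal \<Rightarrow> real) \<Rightarrow> (ennreal \<Rightarrow> real) \<Rightarrow> (ennreal \<Rightarrow> real) \<Rightarrow> (ennreal \<Rightarrow> real) \<Rightarrow> real" where
  "lambda_M v gi ai gj aj =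
     (let \<tau> = tau_hat v ai aj in
      if \<tau> < first_pos v aj then (1 - left_limit gi \<tau>) * ai \<tau> * jump gj \<tau>
      else if \<tau> < first_pos v ai then (1 - left_limit gj \<tau>) * aj \<tau> * jump gi \<tau>
      else if max (ai \<tau>) (aj \<tau>) = 1 \<or> min (ai \<tau>) (aj \<tau>) > 0 then
        (1 - left_limit gi \<tau>) * (1 - left_limit gj \<tau>) * mu_M (ai \<tau>) (aj \<tau>)
      else
        (1 - left_limit gi \<tau>) * (1 - left_limit gj \<tau>)
        - lambda_L v gi ai gj aj - lambda_L v gj aj gi ai)"


section \<open>Payoffs and equilibrium\<close>

text \<open>Extending the path by \<open>0\<close> to negative times makes a jump at \<open>0\<close> an atom of the measure.\<close>

definition stieltjes_measure :: "(ennreal \<Rightarrow> real) \<Rightarrow> real measure" where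
  "stieltjes_measure g = interval_measure (\<lambda>x. if x < 0 then 0 else g (ennreal x))"

definition stieltjes_integral :: "ennreal \<Rightarrow> (ennreal \<Rightarrow> real) \<Rightarrow> (ennreal \<Rightarrow> real) \<Rightarrow> real" where
  "stieltjes_integral \<tau> f g =
     (LINT x : {x. 0 \<le> x \<and> ennreal x < \<tau>} | stieltjes_measure g. f (ennreal x))"

definition path_payoff ::
    "ennreal \<Rightarrow> (ennreal \<Rightarrow> real) \<Rightarrow> (ennreal \<Rightarrow> real) \<Rightarrow> (ennreal \<Rightarrow> real) \<Rightarrow>
     (ennreal \<Rightarrow> real) \<Rightarrow> (ennreal \<Rightarrow> real) \<Rightarrow> (ennreal \<Rightarrow> real) \<Rightarrow> (ennreal \<Rightarrow> real) \<Rightarrow> real" where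
  "path_payoff v l f m gi ai gj aj =
     (let \<tau> = tau_hat v ai aj in
        stieltjes_integral \<tau> (\<lambda>s. (1 - gj s) * l s) gi
      + stieltjes_integral \<tau> (\<lambda>s. (1 - gi s) * f s) gj
      + (\<Sum>\<^sub>\<infinity>s\<in>{..<\<tau>}. jump gi s * jump gj s * m s)
      + lambda_L v gi ai gj aj * l \<tau>
      + lambda_L v gj aj gi ai * f \<tau>
      + lambda_M v gi ai gj aj * m \<tau>)"

definition payoff ::
    "'a measure \<Rightarrow> (ennreal \<Rightarrow> 'a measure) \<Rightarrow> (player \<Rightarrow> 'a process) \<Rightarrow> (player \<Rightarrow> 'a process) \<Rightarrow>
     (player \<Rightarrow> 'a process) \<Rightarrow> ('a \<Rightarrow> ennreal) \<Rightarrow> player \<Rightarrow>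
     'a process \<Rightarrow> 'a process \<Rightarrow> 'a process \<Rightarrow> 'a process \<Rightarrow> 'a \<Rightarrow> real" where
  "payoff P \<F> L F M \<theta> i Gi \<alpha>i Gj \<alpha>j =
     real_cond_exp P (filtration.pre_sigma (space P) \<F> \<theta>)
       (\<lambda>\<omega>. path_payoff (\<theta> \<omega>) (\<lambda>t. L i t \<omega>) (\<lambda>t. F i t \<omega>) (\<lambda>t. M i t \<omega>)
              (\<lambda>t. Gi t \<omega>) (\<lambda>t. \<alpha>i t \<omega>) (\<lambda>t. Gj t \<omega>) (\<lambda>t. \<alpha>j t \<omega>))"

definition subgame_equilibrium ::
    "'a measure \<Rightarrow> (ennreal \<Rightarrow> 'a measure) \<Rightarrow> (player \<Rightarrow> 'a process) \<Rightarrow> (player \<Rightarrow> 'a process) \<Rightarrow>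
     (player \<Rightarrow> 'a process) \<Rightarrow> ('a \<Rightarrow> ennreal) \<Rightarrow>
     (player \<Rightarrow> 'a process) \<Rightarrow> (player \<Rightarrow> 'a process) \<Rightarrow> bool" where
  "subgame_equilibrium P \<F> L F M \<theta> G \<alpha> \<longleftrightarrow>
     (\<forall>i. ext_mixed_strategy P \<F> \<theta> (G i) (\<alpha> i)) \<and>
     (\<forall>i j Ga \<alpha>a. i \<noteq> j \<longrightarrow> ext_mixed_strategy P \<F> \<theta> Ga \<alpha>a \<longrightarrow>
        (AE \<omega> in P. payoff P \<F> L F M \<theta> i (G i) (\<alpha> i) (G j) (\<alpha> j) \<omega>
                  \<ge> payoff P \<F> L F M \<theta> i Ga \<alpha>a (G j) (\<alpha> j) \<omega>))"


section \<open>Preemption\<close>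

definition preemption_time ::
    "(player \<Rightarrow> 'a process) \<Rightarrow> (player \<Rightarrow> 'a process) \<Rightarrow> ('a \<Rightarrow> ennreal) \<Rightarrow> 'a \<Rightarrow> ennreal" where
  "preemption_time L F \<tau> \<omega> =
     Inf {u. \<tau> \<omega> \<le> u \<and>
             min (L Player1 u \<omega> - F Player1 u \<omega>) (L Player2 u \<omega> - F Player2 u \<omega>) > 0}"

definition preemption_G :: "('a \<Rightarrow> ennreal) \<Rightarrow> player \<Rightarrow> 'a process" where
  "preemption_G \<theta> i t \<omega> = of_bool (\<theta> \<omega> \<le> t)"

definition preemption_alpha ::
    "(player \<Rightarrow> 'a process) \<Rightarrow> (player \<Rightarrow> 'a process) \<Rightarrow> (player \<Rightarrow> 'a process) \<Rightarrow>
     ('a \<Rightarrow> ennreal) \<Rightarrow> player \<Rightarrow> 'a process" where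
  "preemption_alpha L F M \<theta> i t \<omega> =
     (let j = opponent i in
      if t = \<infinity> then 1
      else if t < \<theta> \<omega> then 0
      else if t = preemption_time L F (\<lambda>_. t) \<omega> \<and> L j t \<omega> = F j t \<omega> \<and>
              (L i t \<omega> > F i t \<omega> \<or> F j t \<omega> = M j t \<omega>) then 1
      else of_bool (L Player1 t \<omega> > F Player1 t \<omega>) * of_bool (L Player2 t \<omega> > F Player2 t \<omega>) *
           ((L j t \<omega> - F j t \<omega>) / (L j t \<omega> - M j t \<omega>)))"

end

theory Submission
  imports Defs
begin

text \<open>
  Everything is decided at the instant \<open>\<theta>\<close>.  Since \<open>\<theta>\<close> is its own preemption time, the region where
  both players strictly prefer leading to following is occupied at \<open>\<theta>\<close> or accumulates there from the
  right, and by right-continuity \<open>L \<ge> F \<ge> M\<close> holds at \<open>\<theta>\<close> for both players.  The opponent \<open>j\<close> puts all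
  mass of \<open>G\<close> on \<open>\<theta>\<close> and has positive intensity throughout that region, so whatever player \<open>i\<close> does, the
  game ends at \<open>\<theta>\<close> and the payoff of \<open>i\<close> is a convex combination of \<open>L\<close>, \<open>F\<close> and \<open>M\<close> at \<open>\<theta>\<close>
  (\<open>path_payoff_eq_weights\<close>).  Three cases remain.

  \<^item> If both advantages are strict, the intensity of \<open>j\<close> solves \<open>(1 - \<alpha>) L + \<alpha> M = F\<close>: attempting to stop is
    worth exactly as much as being preempted, and every strategy of \<open>i\<close> yields \<open>F\<close>
    (\<open>weighted_payoff_preempting\<close>).
  \<^item> If \<open>j\<close> is indifferent (\<open>L = F\<close> for \<open>j\<close>), the claimed value is \<open>L\<close>, the largest of the three payoffs.
  \<^item> If only \<open>j\<close> has a strict advantage, then \<open>L = F\<close> for \<open>i\<close>, and the claimed value \<open>F\<close> is the largest of the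
    three payoffs.  Here \<open>j\<close> attacks with intensity \<open>1\<close> and \<open>i\<close> with intensity \<open>0\<close>.

  This bounds deviations (\<open>deviation_payoff_le\<close>), and playing the prescribed intensities attains the bound
  (\<open>equilibrium_payoff_eq\<close>).  The delicate situation is the one in which both players are indifferent at
  \<open>\<theta>\<close> and \<open>F > M\<close> for both: both intensities vanish at \<open>\<theta>\<close>, and the outcome is defined through lower and
  upper limits of \<open>\<mu>\<^sub>L\<close>.  There the probability \<open>\<mu>\<^sub>M\<close> of simultaneous stopping tends to \<open>0\<close>, which makes
  the two averaged limits add up to \<open>1\<close>.

  The rest is measurability.  The conditional expectation of a function that is not measurable says nothing about
  the function, so the payoff of an \<^emph>\<open>arbitrary\<close> deviation has to be shown measurable.  The intensity of
  a deviation is only progressively measurable, while the outcome depends on whether it is positive arbitrarily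
  soon after \<open>\<theta>\<close> and on a lower limit along uncountably many times.  Such events are projections of measurable
  subsets of the product of the time axis and \<open>\<Omega>\<close>; they are measurable because the underlying measure is complete
  (\<open>measurable_projection\<close>, proved here with the Suslin operation).  The payoffs at \<open>\<theta>\<close> are
  integrable by class (D) and known at \<open>\<theta>\<close> by progressive measurability, so the pathwise statements pass to
  conditional expectations.
\<close>

section \<open>The Suslin operation and measurable projection\<close>

text \<open>
  A family of sets indexed by finite sequences, written as a function of infinite sequences \<open>f\<close> whose
  value at level \<open>n\<close> depends on the first \<open>n\<close> entries of \<open>f\<close> alone.  This avoids handling finite lists.
\<close>

definition suslin_scheme :: "'x set set \<Rightarrow> (nat \<Rightarrow> (nat \<Rightarrow> nat) \<Rightarrow> 'x set) \<Rightarrow> bool" where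
  "suslin_scheme K B \<longleftrightarrow>
     (\<forall>n f. B n f \<in> K) \<and> (\<forall>n f g. (\<forall>i<n. f i = g i) \<longrightarrow> B n f = B n g)"

text \<open>
  The result of the Suslin operation applied to the sets in \<open>K\<close>.
\<close>

definition suslin :: "'x set set \<Rightarrow> 'x set set" where
  "suslin K = {S. \<exists>B. suslin_scheme K B \<and> S = (\<Union>f. \<Inter>n. B n f)}"

lemma suslin_schemeI:
  assumes "\<And>n f. B n f \<in> K" and "\<And>n f g. \<forall>i<n. f i = g i \<Longrightarrow> B n f = B n g"
  shows "suslin_scheme K B"
  unfolding suslin_scheme_def using assms by blast

lemma suslin_scheme_mem: "suslin_scheme K B \<Longrightarrow> B n f \<in> K"
  unfolding suslin_scheme_def by blast

lemma suslin_scheme_prefix: "suslin_scheme K B \<Longrightarrow> \<forall>i<n. f i = g i \<Longrightarrow> B n f = B n g"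
  unfolding suslin_scheme_def by blast

lemma suslinI: "suslin_scheme K B \<Longrightarrow> S = (\<Union>f. \<Inter>n. B n f) \<Longrightarrow> S \<in> suslin K"
  unfolding suslin_def by blast

lemma suslinE:
  assumes "S \<in> suslin K"
  obtains B where "suslin_scheme K B" and "S = (\<Union>f. \<Inter>n. B n f)"
  using assms unfolding suslin_def by blast

lemma suslin_base: "E \<in> K \<Longrightarrow> E \<in> suslin K"
  by (rule suslinI[where B = "\<lambda>_ _. E"]) (simp_all add: suslin_scheme_def)

lemma suslin_choose:
  assumes "\<And>k::nat. E k \<in> suslin K"
  shows "\<exists>B. \<forall>k. suslin_scheme K (B k) \<and> E k = (\<Union>f. \<Inter>n. B k n f)"
  using assms by (intro choice) (simp add: suslin_def)

text \<open>
  A point of the intersection comes with one sequence for each \<open>k\<close>; these are merged into a single one by the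
  pairing function.  The level of the merged scheme is the code of a pair \<open>(k, n)\<close>, and all entries that level
  \<open>n\<close> of the \<open>k\<close>-th scheme may use have smaller codes.
\<close>

lemma suslin_INT:
  assumes E: "\<And>k::nat. E k \<in> suslin K"
  shows "(\<Inter>k. E k) \<in> suslin K"
proof -
  obtain B where B: "\<forall>k. suslin_scheme K (B k) \<and> E k = (\<Union>f. \<Inter>n. B k n f)"
    using suslin_choose[of E, OF E] ..
  have scheme: "suslin_scheme K (B k)" and E_eq: "E k = (\<Union>f. \<Inter>n. B k n f)" for k
    using B by blast+
  define D where "D m f = (case prod_decode m of (k, n) \<Rightarrow> B k n (\<lambda>i. f (prod_encode (k, i))))" for m f
  show ?thesis
  proof (rule suslinI[where B = D, OF suslin_schemeI])
    show "D n f \<in> K" for n f by (auto simp: D_def suslin_scheme_mem[OF scheme] split: prod.split)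
  next
    fix m and f g :: "nat \<Rightarrow> nat" assume eq: "\<forall>i<m. f i = g i"
    obtain k n where m: "prod_decode m = (k, n)" by fastforce
    then have m': "m = prod_encode (k, n)" by (metis prod_decode_inverse)
    have "prod_encode (k, i) < m" if "i < n" for i
    proof -
      have "triangle (k + i) < triangle (Suc (k + i))" by simp
      also have "\<dots> \<le> triangle (k + n)"
        unfolding triangle_def using that by (intro div_le_mono mult_le_mono) auto
      finally show ?thesis by (simp add: m' prod_encode_def)
    qed
    then show "D m f = D m g" using eq by (auto simp: D_def m intro!: suslin_scheme_prefix[OF scheme])
  next
    show "(\<Inter>k. E k) = (\<Union>f. \<Inter>m. D m f)"
    proof (intro set_eqI iffI)
      fix x assume "x \<in> (\<Inter>k. E k)"
      then have "\<forall>k. \<exists>f. \<forall>n. x \<in> B k n f" by (auto simp: E_eq)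
      then obtain F where F: "\<And>k n. x \<in> B k n (F k)" by metis
      define f where "f j = (case prod_decode j of (k, i) \<Rightarrow> F k i)" for j
      have "x \<in> D m f" for m
        using F by (auto simp: D_def f_def split: prod.split)
      then show "x \<in> (\<Union>f. \<Inter>m. D m f)" by blast
    next
      fix x assume "x \<in> (\<Union>f. \<Inter>m. D m f)"
      then obtain f where f: "\<And>m. x \<in> D m f" by blast
      have "x \<in> B k n (\<lambda>i. f (prod_encode (k, i)))" for k n
        using f[of "prod_encode (k, n)"] by (simp add: D_def)
      then show "x \<in> (\<Inter>k. E k)" by (auto simp: E_eq)
    qed
  qed
qed

text \<open>
  The first entry of the sequence tells which of the sets is meant.  It is unknown at level \<open>0\<close>, hence the need
  for a member \<open>X\<close> of \<open>K\<close> that contains all others.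
\<close>

lemma suslin_UN:
  assumes E: "\<And>k::nat. E k \<in> suslin K" and X: "X \<in> K" "\<And>A. A \<in> K \<Longrightarrow> A \<subseteq> X"
  shows "(\<Union>k. E k) \<in> suslin K"
proof -
  obtain B where B: "\<forall>k. suslin_scheme K (B k) \<and> E k = (\<Union>f. \<Inter>n. B k n f)"
    using suslin_choose[of E, OF E] ..
  have scheme: "suslin_scheme K (B k)" and E_eq: "E k = (\<Union>f. \<Inter>n. B k n f)" for k
    using B by blast+
  define D where "D m f = (case m of 0 \<Rightarrow> X | Suc n \<Rightarrow> B (f 0) n (\<lambda>i. f (Suc i)))" for m f
  show ?thesis
  proof (rule suslinI[where B = D, OF suslin_schemeI])
    show "D n f \<in> K" for n f by (auto simp: D_def X suslin_scheme_mem[OF scheme] split: nat.split)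
  next
    fix m and f g :: "nat \<Rightarrow> nat" assume eq: "\<forall>i<m. f i = g i"
    show "D m f = D m g"
    proof (cases m)
      case (Suc n)
      then have "f 0 = g 0" and "B (f 0) n (\<lambda>i. f (Suc i)) = B (f 0) n (\<lambda>i. g (Suc i))"
        using eq by (auto intro!: suslin_scheme_prefix[OF scheme])
      then show ?thesis using Suc by (simp add: D_def)
    qed (simp add: D_def)
  next
    show "(\<Union>k. E k) = (\<Union>f. \<Inter>m. D m f)"
    proof (intro set_eqI iffI)
      fix x assume "x \<in> (\<Union>k. E k)"
      then obtain k f where f: "\<And>n. x \<in> B k n f" by (auto simp: E_eq)
      have "x \<in> D m (case_nat k f)" for m
        using f X(2)[OF suslin_scheme_mem[OF scheme, of k 0 f]] by (auto simp: D_def split: nat.split)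
      then show "x \<in> (\<Union>f. \<Inter>m. D m f)" by blast
    next
      fix x assume "x \<in> (\<Union>f. \<Inter>m. D m f)"
      then obtain f where f: "\<And>m. x \<in> D m f" by blast
      have "x \<in> B (f 0) n (\<lambda>i. f (Suc i))" for n
        using f[of "Suc n"] by (simp add: D_def)
      then show "x \<in> (\<Union>k. E k)" by (auto simp: E_eq)
    qed
  qed
qed

text \<open>
  Suslin sets are not closed under complement, but the sets that are Suslin together with their complement are.
  This is how Borel sets are shown to be Suslin without transfinite recursion.
\<close>

lemma sigma_algebra_bi_suslin:
  assumes "X \<in> K" "{} \<in> K" "\<And>A. A \<in> K \<Longrightarrow> A \<subseteq> X"
  shows "sigma_algebra X {E \<in> suslin K. X - E \<in> suslin K}"
  unfolding sigma_algebra_iff2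
proof (intro conjI ballI allI impI)
  have *: "E \<subseteq> X" if E: "E \<in> suslin K" for E
  proof -
    obtain B where "suslin_scheme K B" "E = (\<Union>f. \<Inter>n. B n f)"
      using E by (rule suslinE)
    then show ?thesis using assms(3)[OF suslin_scheme_mem] by blast
  qed
  then show "{E \<in> suslin K. X - E \<in> suslin K} \<subseteq> Pow X" by auto
  show "{} \<in> {E \<in> suslin K. X - E \<in> suslin K}"
    using assms by (auto intro: suslin_base)
  show "X - s \<in> {E \<in> suslin K. X - E \<in> suslin K}" if "s \<in> {E \<in> suslin K. X - E \<in> suslin K}" for s
    using that * by (auto simp: double_diff)
  show "\<Union> (range A) \<in> {E \<in> suslin K. X - E \<in> suslin K}"
    if "range A \<subseteq> {E \<in> suslin K. X - E \<in> suslin K}" for A :: "nat \<Rightarrow> _"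
  proof -
    have "(\<Inter>k. X - A k) \<in> suslin K"
      by (rule suslin_INT) (use that in auto)
    moreover have "(\<Union>k. A k) \<in> suslin K"
      by (rule suslin_UN[OF _ assms(1,3)]) (use that in auto)
    moreover have "X - (\<Union>k. A k) = (\<Inter>k. X - A k)" by auto
    ultimately show ?thesis by (simp only: mem_Collect_eq)
  qed
qed

text \<open>
  Dependent choice for properties of finite prefixes: used for the bounds in the inner approximation of Suslin
  sets and for the branch in Koenig's lemma.
\<close>

lemma sequence_from_prefixes:
  fixes P :: "nat \<Rightarrow> (nat \<Rightarrow> 'b) \<Rightarrow> bool"
  assumes "P 0 s0" and step: "\<And>k s. P k s \<Longrightarrow> \<exists>a. P (Suc k) (s(k := a))"
    and cong: "\<And>k s t. (\<And>i. i < k \<Longrightarrow> s i = t i) \<Longrightarrow> P k s \<Longrightarrow> P k t"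
  shows "\<exists>f. \<forall>k. P k f"
proof -
  have "\<exists>h. \<forall>n. P n (h n) \<and> (\<exists>a. h (Suc n) = (h n)(n := a))"
    using assms(1) step by (intro dependent_nat_choice) blast+
  then obtain h where h: "\<And>n. P n (h n)" "\<And>n. \<exists>a. h (Suc n) = (h n)(n := a)"
    by blast
  have "h k i = h (Suc i) i" if "i < k" for k i
    using that
  proof (induction k)
    case (Suc k)
    obtain a where "h (Suc k) = (h k)(k := a)" using h(2) by blast
    then show ?case using Suc by (cases "i = k") auto
  qed simp
  then have "P k (\<lambda>i. h (Suc i) i)" for k
    by (rule cong[OF _ h(1)])
  then show ?thesis by blast
qed

text \<open>
  Koenig's lemma for a tree with finitely many successors at each node: by the pigeonhole principle some
  branch is followed arbitrarily far by the given sequences.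
\<close>

lemma koenig_bounded_branches:
  fixes F :: "nat \<Rightarrow> nat \<Rightarrow> nat"
  assumes "\<And>k i. F k i \<le> h i"
  shows "\<exists>f. \<forall>k. infinite {m. \<forall>i<k. F m i = f i}"
proof (rule sequence_from_prefixes)
  show "infinite {m. \<forall>i<0. F m i = undefined i}" by simp
next
  fix k s assume inf: "infinite {m. \<forall>i<k. F m i = s i}" (is "infinite ?A")
  have "finite ((\<lambda>m. F m k) ` ?A)"
    by (rule finite_subset[of _ "{..h k}"]) (use assms in auto)
  from pigeonhole_infinite[OF inf this] obtain m0 where
    inf': "infinite {m \<in> ?A. F m k = F m0 k}" by blast
  have eq: "{m \<in> ?A. F m k = F m0 k} = {m. \<forall>i<Suc k. F m i = (s(k := F m0 k)) i}"
    by (auto simp: less_Suc_eq)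
  show "\<exists>a. infinite {m. \<forall>i<Suc k. F m i = (s(k := a)) i}"
    using inf' unfolding eq by (rule exI)
next
  fix k and s t :: "nat \<Rightarrow> nat"
  assume "\<And>i. i < k \<Longrightarrow> s i = t i" "infinite {m. \<forall>i<k. F m i = s i}"
  then show "infinite {m. \<forall>i<k. F m i = t i}" by (auto cong: conj_cong)
qed

text \<open>
  The heart of the capacity argument.  The outer measure is continuous along increasing sequences, so bounding
  the entries of the sequences one after the other, with sufficiently large bounds \<open>h\<close>, keeps it above \<open>c\<close>.  Cutting
  the scheme at level \<open>k\<close> then leaves finitely many sets, and the measurable sets \<open>T k\<close> decrease to a
  set that lies in \<open>S\<close> by Koenig's lemma.
\<close>

lemma suslin_inner_approximation:
  assumes "finite_measure M" and S: "S \<in> suslin (sets M)" and c: "c < outer_measure_of M S"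
  shows "\<exists>T\<in>sets M. T \<subseteq> S \<and> c \<le> emeasure M T"
proof -
  interpret finite_measure M by fact
  obtain B where scheme: "suslin_scheme (sets M) B" and S_eq: "S = (\<Union>f. \<Inter>n. B n f)"
    using S by (rule suslinE)
  note B[measurable] = suslin_scheme_mem[OF scheme] and pre = suslin_scheme_prefix[OF scheme]
  define R where "R k h = {x. \<exists>f. (\<forall>i<k. f i \<le> h i) \<and> (\<forall>n. x \<in> B n f)}" for k and h :: "nat \<Rightarrow> nat"
  have R_cong: "R k h = R k h'" if "\<And>i. i < k \<Longrightarrow> h i = h' i" for k h h'
    using that unfolding R_def by auto
  have R_space: "R k h \<subseteq> space M" for k h
    using sets.sets_into_space[OF B] unfolding R_def by blast
  have "\<exists>h. \<forall>k. c < outer_measure_of M (R k h)"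
  proof (rule sequence_from_prefixes)
    show "c < outer_measure_of M (R 0 undefined)"
      using c by (simp add: R_def S_eq) (simp add: UNION_eq Inter_eq)
  next
    fix k h assume "c < outer_measure_of M (R k h)"
    also have "R k h = (\<Union>m. R (Suc k) (h(k := m)))"
    proof safe
      fix x assume "x \<in> R k h"
      then obtain f where f: "\<forall>i<k. f i \<le> h i" "\<forall>n. x \<in> B n f" by (auto simp: R_def)
      then have "x \<in> R (Suc k) (h(k := f k))" unfolding R_def by (auto simp: less_Suc_eq)
      then show "x \<in> (\<Union>m. R (Suc k) (h(k := m)))" by blast
    next
      fix x m assume "x \<in> R (Suc k) (h(k := m))"
      then obtain f where f: "\<forall>i<Suc k. f i \<le> (h(k := m)) i" "\<forall>n. x \<in> B n f"
        by (auto simp: R_def)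
      have "\<forall>i<k. f i \<le> h i"
        using f(1) by (metis fun_upd_apply less_Suc_eq nat_neq_iff)
      with f(2) show "x \<in> R k h" by (auto simp: R_def)
    qed
    also have "outer_measure_of M \<dots> = (SUP m. outer_measure_of M (R (Suc k) (h(k := m))))"
    proof (rule SUP_outer_measure_of_incseq[symmetric])
      show "incseq (\<lambda>m. R (Suc k) (h(k := m)))"
      proof (rule incseq_SucI, rule subsetI)
        fix m x assume "x \<in> R (Suc k) (h(k := m))"
        then obtain f where f: "\<forall>i<Suc k. f i \<le> (h(k := m)) i" "\<forall>n. x \<in> B n f"
          by (auto simp: R_def)
        have "(h(k := m)) i \<le> (h(k := Suc m)) i" for i by simp
        then have "\<forall>i<Suc k. f i \<le> (h(k := Suc m)) i"
          using f(1) le_trans by blast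
        with f(2) show "x \<in> R (Suc k) (h(k := Suc m))" unfolding R_def by blast
      qed
    qed (rule R_space)
    finally show "\<exists>a. c < outer_measure_of M (R (Suc k) (h(k := a)))"
      by (auto simp: less_SUP_iff)
  next
    show "c < outer_measure_of M (R k t)"
      if "\<And>i. i < k \<Longrightarrow> s i = t i" "c < outer_measure_of M (R k s)" for k s t
      using that R_cong by metis
  qed
  then obtain h where h: "\<And>k. c < outer_measure_of M (R k h)" by blast
  \<comment> \<open>Only finitely many prefixes of length \<open>k\<close> respect the bounds \<open>h\<close>.\<close>
  define T where "T k = (\<Union>f\<in>(\<Pi>\<^sub>E i\<in>{..<k}. {..h i}). \<Inter>n\<in>{..k}. B n f)" for k
  have [measurable]: "T k \<in> sets M" for k
    unfolding T_def by (intro sets.finite_UN finite_PiE sets.finite_INT) auto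
  have T_iff: "x \<in> T k \<longleftrightarrow> (\<exists>f. (\<forall>i<k. f i \<le> h i) \<and> (\<forall>n\<le>k. x \<in> B n f))" for x k
  proof
    assume "\<exists>f. (\<forall>i<k. f i \<le> h i) \<and> (\<forall>n\<le>k. x \<in> B n f)"
    then obtain f where f: "\<forall>i<k. f i \<le> h i" "\<forall>n\<le>k. x \<in> B n f" by blast
    have "x \<in> B n (restrict f {..<k})" if "n \<le> k" for n
      using f(2) that pre[of n f "restrict f {..<k}"] by auto
    moreover have "restrict f {..<k} \<in> (\<Pi>\<^sub>E i\<in>{..<k}. {..h i})" using f by auto
    ultimately show "x \<in> T k"
      unfolding T_def by (intro UN_I[of "restrict f {..<k}"] INT_I) simp_all
  next
    assume "x \<in> T k"
    then obtain f where f: "f \<in> (\<Pi>\<^sub>E i\<in>{..<k}. {..h i})" "\<forall>n\<le>k. x \<in> B n f"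
      by (auto simp: T_def)
    then have "\<forall>i<k. f i \<le> h i" by (auto dest: PiE_mem)
    with f(2) show "\<exists>f. (\<forall>i<k. f i \<le> h i) \<and> (\<forall>n\<le>k. x \<in> B n f)" by blast
  qed
  have "decseq T"
  proof (rule decseq_SucI, rule subsetI)
    fix k x assume "x \<in> T (Suc k)"
    then obtain f where "\<forall>i<Suc k. f i \<le> h i" "\<forall>n\<le>Suc k. x \<in> B n f"
      unfolding T_iff by blast
    then show "x \<in> T k" unfolding T_iff by (intro exI[of _ f]) simp
  qed
  have "(\<Inter>k. T k) \<subseteq> S"
  proof
    fix x assume "x \<in> (\<Inter>k. T k)"
    then have "\<forall>k. \<exists>f. (\<forall>i<k. f i \<le> h i) \<and> (\<forall>n\<le>k. x \<in> B n f)" by (auto simp: T_iff)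
    then obtain F where F: "\<And>k i. i < k \<Longrightarrow> F k i \<le> h i" "\<And>k n. n \<le> k \<Longrightarrow> x \<in> B n (F k)" by metis
    define F' where "F' k i = (if i < k then F k i else 0)" for k i
    have "F' k i \<le> h i" for k i using F(1) by (auto simp: F'_def)
    from koenig_bounded_branches[of F', OF this] obtain f
      where f: "\<And>k. infinite {m. \<forall>i<k. F' m i = f i}" by blast
    have "x \<in> B n f" for n
    proof -
      obtain m where m: "m \<ge> n" "\<forall>i<n. F' m i = f i"
        using f[of n] unfolding infinite_nat_iff_unbounded_le by blast
      have "B n (F m) = B n f" using m by (intro pre) (auto simp: F'_def)
      then show ?thesis using F(2)[OF m(1)] by simp
    qed
    then show "x \<in> S" by (auto simp: S_eq)
  qed
  moreover have "c \<le> emeasure M (\<Inter>k. T k)"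
  proof -
    have "c \<le> emeasure M (T k)" for k
    proof -
      have "outer_measure_of M (R k h) \<le> outer_measure_of M (T k)"
      proof (rule outer_measure_of_mono, rule subsetI)
        fix x assume "x \<in> R k h"
        then obtain f where "\<forall>i<k. f i \<le> h i" "\<forall>n. x \<in> B n f" by (auto simp: R_def)
        then show "x \<in> T k" unfolding T_iff by (intro exI[of _ f]) simp
      qed
      then show ?thesis using h[of k] by simp
    qed
    then have "c \<le> (INF k. emeasure M (T k))" by (rule INF_greatest)
    also have "\<dots> = emeasure M (\<Inter>k. T k)"
      using \<open>decseq T\<close> by (intro INF_emeasure_decseq) auto
    finally show ?thesis .
  qed
  ultimately show ?thesis by (intro bexI[of _ "\<Inter>k. T k"]) auto
qed

text \<open>
  A Suslin set has a measurable envelope and measurable subsets of almost the same measure; completeness of the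
  measure does the rest.
\<close>

lemma suslin_sets_complete_measure:
  assumes "finite_measure M" "complete_measure M" and S: "S \<in> suslin (sets M)"
  shows "S \<in> sets M"
proof -
  interpret finite_measure M by fact
  interpret complete_measure M by fact
  have "S \<subseteq> space M"
    using S sets.sets_into_space[OF suslin_scheme_mem] by (elim suslinE) blast
  from outer_measure_of_attain[OF this] obtain E
    where E: "E \<in> sets M" "S \<subseteq> E" "outer_measure_of M S = emeasure M E" by auto
  have "\<exists>T\<in>fmeasurable M. \<exists>U\<in>fmeasurable M. T \<subseteq> S \<and> S \<subseteq> U \<and> \<bar>measure M T - measure M U\<bar> < e"
    if e: "e > 0" for e
  proof (cases "measure M E = 0")
    case True
    then show ?thesis using E e by (intro bexI[of _ "{}"] bexI[of _ E]) (auto simp: fmeasurable_eq_sets)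
  next
    case False
    then have "ennreal (measure M E - e / 2) < ennreal (measure M E)"
      using e by (intro ennreal_lessI) (auto simp: zero_less_measure_iff order.strict_iff_order)
    then have "ennreal (measure M E - e / 2) < outer_measure_of M S"
      by (simp add: E emeasure_eq_measure)
    from suslin_inner_approximation[OF assms(1) S this] obtain T
      where T: "T \<in> sets M" "T \<subseteq> S" "ennreal (measure M E - e / 2) \<le> emeasure M T" by blast
    then have "measure M E - e / 2 \<le> measure M T"
      by (simp add: emeasure_eq_measure)
    moreover have "measure M T \<le> measure M E"
      using T E by (intro finite_measure_mono) auto
    ultimately show ?thesis
      using T E e by (intro bexI[of _ T] bexI[of _ E]) (auto simp: fmeasurable_eq_sets)
  qed
  then have "S \<in> fmeasurable M" unfolding fmeasurable_inner_outer by (intro allI impI)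
  then show ?thesis by (rule fmeasurableD)
qed

text \<open>
  Complements of rectangles with a closed side in time are countable unions of such rectangles, so
  these rectangles belong to the \<open>\<sigma>\<close>-algebra of sets that are Suslin together with their complement.
\<close>

lemma sets_borel_times_suslin:
  assumes E: "E \<in> sets ((borel :: ennreal measure) \<Otimes>\<^sub>M M)"
  shows "E \<in> suslin {C \<times> B | C B. closed C \<and> B \<in> sets M}" (is "_ \<in> suslin ?K")
proof -
  let ?X = "(UNIV :: ennreal set) \<times> space M"
  let ?S = "{E \<in> suslin ?K. ?X - E \<in> suslin ?K}"
  have XK: "?X \<in> ?K" "{} \<in> ?K" and sub: "\<And>A. A \<in> ?K \<Longrightarrow> A \<subseteq> ?X"
    using sets.sets_into_space by (auto intro: closed_UNIV)
  interpret S: sigma_algebra ?X ?S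
    using XK sub by (rule sigma_algebra_bi_suslin)
  have time: "a \<times> space M \<in> ?S" if "a \<in> sets borel" for a
  proof -
    have "a \<in> sigma_sets UNIV (range greaterThan)"
      using that by (simp add: borel_Ioi)
    then show ?thesis
    proof induction
      case (Basic a)
      then obtain x where a: "a = {x<..}" by auto
      obtain D :: "ennreal set" where D: "countable D"
        "\<And>X. open X \<Longrightarrow> X \<noteq> {} \<Longrightarrow> \<exists>d\<in>D. d \<in> X"
        using countable_dense_setE by auto
      have "D \<noteq> {}" using D(2)[of UNIV] by auto
      define C where "C n = (if x < from_nat_into D n then {from_nat_into D n..} else {})" for n
      have "closed (C n)" for n by (auto simp: C_def)
      moreover have "a \<times> space M = (\<Union>n. C n \<times> space M)"
      proof -
        have "\<exists>n. y \<in> C n" if "x < y" for y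
        proof -
          have "{x<..<y} \<noteq> {}" using dense[OF that] by auto
          then obtain d where "d \<in> D" "d \<in> {x<..<y}" using D(2)[of "{x<..<y}"] by auto
          moreover then obtain n where "d = from_nat_into D n"
            using from_nat_into_surj[OF D(1)] by metis
          ultimately show ?thesis by (intro exI[of _ n]) (auto simp: C_def)
        qed
        then show ?thesis unfolding a by (auto simp: C_def split: if_splits)
      qed
      ultimately have "a \<times> space M \<in> suslin ?K"
        by (simp only:) (rule suslin_UN[OF _ XK(1) sub], rule suslin_base, auto)
      moreover have "?X - a \<times> space M = {..x} \<times> space M"
        by (auto simp: a)
      moreover have "{..x} \<times> space M \<in> suslin ?K"
        by (rule suslin_base, rule CollectI, rule exI[of _ "{..x}"], rule exI[of _ "space M"]) auto
      ultimately show ?case by simp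
    next
      case Empty
      then show ?case using S.empty_sets by simp
    next
      case (Compl a)
      have "(UNIV - a) \<times> space M = ?X - a \<times> space M" by auto
      then show ?case using S.compl_sets[OF Compl.IH] by metis
    next
      case (Union a)
      have "(\<Union>i. a i) \<times> space M = (\<Union>i. a i \<times> space M)" by auto
      then show ?case using S.countable_UN[of "\<lambda>i. a i \<times> space M" UNIV] Union.IH by auto
    qed
  qed
  have "a \<times> b \<in> ?S" if "a \<in> sets borel" "b \<in> sets M" for a b
  proof -
    have "UNIV \<times> b \<in> suslin ?K" using that by (intro suslin_base) auto
    moreover have "?X - UNIV \<times> b = UNIV \<times> (space M - b)" by auto
    moreover have "UNIV \<times> (space M - b) \<in> suslin ?K" using that by (intro suslin_base) auto
    ultimately have "UNIV \<times> b \<in> ?S" by simp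
    from S.Int[OF time[OF that(1)] this] show ?thesis
      using sets.sets_into_space[OF that(2)] by (simp add: Times_Int_Times Int_absorb1)
  qed
  then have "sigma_sets ?X {a \<times> b | a b. a \<in> sets borel \<and> b \<in> sets M} \<subseteq> ?S"
    by (intro S.sigma_sets_subset) auto
  then show ?thesis using E by (auto simp: sets_pair_measure)
qed

text \<open>
  The time axis \<open>[0,\<infinity>]\<close> is compact: closed sets of times have a common element as soon as finitely many of them
  always do.  Hence the existence of a time can be tested level by level, and the projection is again
  the result of a Suslin operation.
\<close>

lemma suslin_closed_times_projection:
  assumes E: "E \<in> suslin {C \<times> B | C B. closed (C :: ennreal set) \<and> B \<in> sets M}"
  shows "snd ` E \<in> suslin (sets M)"
proof -
  obtain R where scheme: "suslin_scheme {C \<times> B | C B. closed (C :: ennreal set) \<and> B \<in> sets M} R"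
    and E_eq: "E = (\<Union>f. \<Inter>n. R n f)"
    using E by (rule suslinE)
  note R = suslin_scheme_mem[OF scheme] and pre = suslin_scheme_prefix[OF scheme]
  have "\<forall>A\<in>{C \<times> B | C B. closed (C :: ennreal set) \<and> B \<in> sets M}.
      \<exists>p. closed (fst p) \<and> snd p \<in> sets M \<and> A = fst p \<times> snd p"
    by force
  from bchoice[OF this] obtain p where p: "\<forall>A\<in>{C \<times> B | C B. closed (C :: ennreal set) \<and> B \<in> sets M}.
      closed (fst (p A)) \<and> snd (p A) \<in> sets M \<and> A = fst (p A) \<times> snd (p A)" ..
  define c where "c A = fst (p A)" for A
  define b where "b A = snd (p A)" for A
  have cb: "closed (c (R n f))" "b (R n f) \<in> sets M" "R n f = c (R n f) \<times> b (R n f)" for n f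
    using p[rule_format, OF R[of n f]] by (simp_all add: b_def c_def)
  define B where "B n f = (if (\<Inter>k\<le>n. c (R k f)) \<noteq> {} then b (R n f) else {})" for n f
  show ?thesis
  proof (rule suslinI[where B = B, OF suslin_schemeI])
    show "B n f \<in> sets M" for n f using cb by (auto simp: B_def)
  next
    fix n and f g :: "nat \<Rightarrow> nat" assume "\<forall>i<n. f i = g i"
    then have "R k f = R k g" if "k \<le> n" for k using that by (intro pre) auto
    then show "B n f = B n g" by (simp add: B_def)
  next
    have "\<omega> \<in> snd ` E \<longleftrightarrow> (\<exists>f. \<forall>n. \<omega> \<in> B n f)" for \<omega>
    proof -
      have "(\<exists>t. \<forall>n. (t, \<omega>) \<in> R n f) \<longleftrightarrow> (\<forall>n. \<omega> \<in> B n f)" for f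
      proof safe
        fix t n assume t: "\<forall>n. (t, \<omega>) \<in> R n f"
        then have "t \<in> c (R n f)" "\<omega> \<in> b (R n f)" for n
          using cb(3)[of n f] by (metis mem_Sigma_iff)+
        then show "\<omega> \<in> B n f" by (auto simp: B_def)
      next
        assume B: "\<forall>n. \<omega> \<in> B n f"
        then have ne: "(\<Inter>k\<le>n. c (R k f)) \<noteq> {}" and b: "\<omega> \<in> b (R n f)" for n
          unfolding B_def by (metis empty_iff)+
        have "UNIV \<inter> (\<Inter>n\<in>UNIV. c (R n f)) \<noteq> {}"
        proof (rule compact_imp_fip_image[OF compact_UNIV])
          fix I :: "nat set" assume I: "finite I"
          then obtain n where "I \<subseteq> {..n}" using finite_nat_iff_bounded_le by blast
          then show "UNIV \<inter> (\<Inter>n\<in>I. c (R n f)) \<noteq> {}" using ne[of n] by auto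
        qed (use cb in auto)
        then obtain t where "\<And>n. t \<in> c (R n f)" by auto
        with b show "\<exists>t. \<forall>n. (t, \<omega>) \<in> R n f" using cb(3) by (metis mem_Sigma_iff)
      qed
      moreover have "\<omega> \<in> snd ` E \<longleftrightarrow> (\<exists>f t. \<forall>n. (t, \<omega>) \<in> R n f)"
        unfolding E_eq by force
      ultimately show ?thesis by simp
    qed
    then show "snd ` E = (\<Union>f. \<Inter>n. B n f)"
      by (intro set_eqI) (simp only: UN_iff INT_iff bex_UNIV ball_UNIV)
  qed
qed

text \<open>
  The measurable projection theorem, with the compact time axis \<open>[0,\<infinity>]\<close> as the projected factor.
\<close>

lemma measurable_projection:
  assumes "finite_measure M" "complete_measure M" and "E \<in> sets ((borel :: ennreal measure) \<Otimes>\<^sub>M M)"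
  shows "snd ` E \<in> sets M"
  by (rule suslin_sets_complete_measure[OF assms(1,2) suslin_closed_times_projection[OF sets_borel_times_suslin[OF assms(3)]]])

section \<open>One-sided limits on the time axis\<close>

lemma eventually_at_right_ennreal:
  fixes t :: ennreal
  assumes "t < \<infinity>"
  shows "eventually P (at_right t) \<longleftrightarrow> (\<exists>b>t. \<forall>y>t. y < b \<longrightarrow> P y)"
  using assms by (rule eventually_at_right)

lemma at_right_ennreal_nontrivial:
  fixes t :: ennreal
  assumes "t < \<infinity>"
  shows "at_right t \<noteq> bot"
  unfolding trivial_limit_def eventually_at_right_ennreal[OF assms] using dense by blast

lemma eventually_at_right_less_ennreal:
  fixes t b :: ennreal
  assumes "t < b"
  shows "eventually (\<lambda>s. t < s \<and> s < b) (at_right t)"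
proof -
  have "t < \<infinity>" using assms less_top order_less_le_trans by fastforce
  then show ?thesis using assms by (auto simp: eventually_at_right_ennreal)
qed

text \<open>
  Being at the infimum of the later times with a property is a condition at \<open>t\<close> and immediately after \<open>t\<close>.
\<close>

lemma Inf_from_eq_iff:
  fixes t :: ennreal
  assumes t: "t < \<infinity>"
  shows "t = Inf {u. t \<le> u \<and> B u} \<longleftrightarrow> B t \<or> (\<exists>\<^sub>F u in at_right t. B u)"
proof -
  have le: "t \<le> Inf {u. t \<le> u \<and> B u}" by (rule Inf_greatest) simp
  have "Inf {u. t \<le> u \<and> B u} \<le> t \<longleftrightarrow> B t \<or> (\<forall>b>t. \<exists>u>t. u < b \<and> B u)"
  proof
    assume inf: "Inf {u. t \<le> u \<and> B u} \<le> t"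
    show "B t \<or> (\<forall>b>t. \<exists>u>t. u < b \<and> B u)"
    proof (cases "B t")
      case False
      have "\<exists>u>t. u < b \<and> B u" if "t < b" for b
      proof -
        have "Inf {u. t \<le> u \<and> B u} < b" using inf that by simp
        then obtain u where "t \<le> u" "B u" "u < b" by (auto simp: Inf_less_iff)
        then show ?thesis using False by (intro exI[of _ u]) (auto simp: order.strict_iff_order)
      qed
      then show ?thesis by blast
    qed simp
  next
    assume "B t \<or> (\<forall>b>t. \<exists>u>t. u < b \<and> B u)"
    then show "Inf {u. t \<le> u \<and> B u} \<le> t"
    proof
      assume "B t" then show ?thesis by (intro Inf_lower) simp
    next
      assume *: "\<forall>b>t. \<exists>u>t. u < b \<and> B u"
      show ?thesis
      proof (rule dense_ge)
        fix b assume "t < b"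
        then obtain u where "t < u" "u < b" "B u" using * by blast
        then show "Inf {u. t \<le> u \<and> B u} \<le> b" by (intro Inf_lower2[of u]) auto
      qed
    qed
  qed
  moreover have "(\<exists>\<^sub>F u in at_right t. B u) \<longleftrightarrow> (\<forall>b>t. \<exists>u>t. u < b \<and> B u)"
    unfolding frequently_def eventually_at_right_ennreal[OF t] by auto
  ultimately show ?thesis using le by auto
qed

section \<open>Averages of lower and upper limits\<close>

text \<open>
  The average through which the outcome is defined when, at the decisive instant, one intensity vanishes and the
  other is below \<open>1\<close>; here along an arbitrary filter.
\<close>

definition average_limit :: "'b filter \<Rightarrow> ('b \<Rightarrow> real) \<Rightarrow> real" where
  "average_limit \<Phi> f =
     1/2 * (real_of_ereal (Liminf \<Phi> (\<lambda>x. ereal (f x))) + real_of_ereal (Limsup \<Phi> (\<lambda>x. ereal (f x))))"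

lemma Liminf_Limsup_bounded_real:
  fixes f :: "'b \<Rightarrow> real"
  assumes "\<Phi> \<noteq> bot" and "eventually (\<lambda>x. a \<le> f x \<and> f x \<le> b) \<Phi>"
  obtains l u where "Liminf \<Phi> (\<lambda>x. ereal (f x)) = ereal l" and "Limsup \<Phi> (\<lambda>x. ereal (f x)) = ereal u"
    and "a \<le> l" and "l \<le> u" and "u \<le> b"
proof -
  have 1: "ereal a \<le> Liminf \<Phi> (\<lambda>x. ereal (f x))"
    using assms(2) by (intro Liminf_bounded) (auto elim: eventually_mono)
  have 2: "Limsup \<Phi> (\<lambda>x. ereal (f x)) \<le> ereal b"
    using assms(2) by (intro Limsup_bounded) (auto elim: eventually_mono)
  have 3: "Liminf \<Phi> (\<lambda>x. ereal (f x)) \<le> Limsup \<Phi> (\<lambda>x. ereal (f x))"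
    using assms(1) by (rule Liminf_le_Limsup)
  obtain l where l: "Liminf \<Phi> (\<lambda>x. ereal (f x)) = ereal l"
    using 1 2 3 by (cases "Liminf \<Phi> (\<lambda>x. ereal (f x))") auto
  obtain u where u: "Limsup \<Phi> (\<lambda>x. ereal (f x)) = ereal u"
    using 1 2 3 by (cases "Limsup \<Phi> (\<lambda>x. ereal (f x))") auto
  show thesis using 1 2 3 by (intro that[OF l u]) (simp_all add: l u)
qed

lemma average_limit_bounds:
  assumes "\<Phi> \<noteq> bot" and "eventually (\<lambda>x. a \<le> f x \<and> f x \<le> b) \<Phi>"
  shows "a \<le> average_limit \<Phi> f" and "average_limit \<Phi> f \<le> b"
  using Liminf_Limsup_bounded_real[OF assms] by (force simp: average_limit_def)+

lemma average_limit_mono: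
  assumes "\<Phi> \<noteq> bot" and f: "eventually (\<lambda>x. a \<le> f x \<and> f x \<le> b) \<Phi>"
    and g: "eventually (\<lambda>x. c \<le> g x \<and> g x \<le> d) \<Phi>"
    and le: "\<And>e. e > 0 \<Longrightarrow> eventually (\<lambda>x. f x \<le> g x + e) \<Phi>"
  shows "average_limit \<Phi> f \<le> average_limit \<Phi> g"
proof -
  have "Liminf \<Phi> (\<lambda>x. ereal (f x)) \<le> Liminf \<Phi> (\<lambda>x. ereal (g x)) + ereal e" if "e > 0" for e
  proof -
    have "Liminf \<Phi> (\<lambda>x. ereal (f x)) \<le> Liminf \<Phi> (\<lambda>x. ereal (g x) + ereal e)"
      by (intro Liminf_mono) (use le[OF that] in simp)
    then show ?thesis using assms(1) by (subst (asm) Liminf_add_ereal_right) auto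
  qed
  then have 1: "Liminf \<Phi> (\<lambda>x. ereal (f x)) \<le> Liminf \<Phi> (\<lambda>x. ereal (g x))" by (rule ereal_le_epsilon2)
  have "Limsup \<Phi> (\<lambda>x. ereal (f x)) \<le> Limsup \<Phi> (\<lambda>x. ereal (g x)) + ereal e" if "e > 0" for e
  proof -
    have "Limsup \<Phi> (\<lambda>x. ereal (f x)) \<le> Limsup \<Phi> (\<lambda>x. ereal (g x) + ereal e)"
      by (intro Limsup_mono) (use le[OF that] in simp)
    then show ?thesis using assms(1) by (subst (asm) Limsup_add_ereal_right) auto
  qed
  then have 2: "Limsup \<Phi> (\<lambda>x. ereal (f x)) \<le> Limsup \<Phi> (\<lambda>x. ereal (g x))" by (rule ereal_le_epsilon2)
  show ?thesis
  proof (rule Liminf_Limsup_bounded_real[OF assms(1) f], rule Liminf_Limsup_bounded_real[OF assms(1) g])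
    fix l u l' u'
    assume "Liminf \<Phi> (\<lambda>x. ereal (f x)) = ereal l" "Limsup \<Phi> (\<lambda>x. ereal (f x)) = ereal u"
      "Liminf \<Phi> (\<lambda>x. ereal (g x)) = ereal l'" "Limsup \<Phi> (\<lambda>x. ereal (g x)) = ereal u'"
    with 1 2 show ?thesis by (simp add: average_limit_def)
  qed
qed

text \<open>
  A decreasing affine map exchanges the lower and the upper limit; their average does not notice.
\<close>

lemma average_limit_affine:
  assumes "\<Phi> \<noteq> bot" and f: "eventually (\<lambda>x. a \<le> f x \<and> f x \<le> b) \<Phi>" and "k \<ge> 0"
  shows "average_limit \<Phi> (\<lambda>x. c - k * f x) = c - k * average_limit \<Phi> f"
proof (rule Liminf_Limsup_bounded_real[OF assms(1) f])
  fix l u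
  assume l: "Liminf \<Phi> (\<lambda>x. ereal (f x)) = ereal l" and u: "Limsup \<Phi> (\<lambda>x. ereal (f x)) = ereal u"
  have eq: "(\<lambda>x. ereal (c - k * f x)) = (\<lambda>x. ereal c + - (ereal k * ereal (f x)))" by simp
  have "Liminf \<Phi> (\<lambda>x. ereal (c - k * f x)) = ereal (c - k * u)"
    unfolding eq using assms(1,3)
    by (simp add: Liminf_add_ereal_left ereal_Liminf_uminus Limsup_ereal_mult_left u del: times_ereal.simps uminus_ereal.simps) simp
  moreover have "Limsup \<Phi> (\<lambda>x. ereal (c - k * f x)) = ereal (c - k * l)"
    unfolding eq using assms(1,3)
    by (simp add: Limsup_add_ereal_left ereal_Limsup_uminus Liminf_ereal_mult_left l del: times_ereal.simps uminus_ereal.simps) simp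
  ultimately show ?thesis
    using l u by (simp add: average_limit_def algebra_simps)
qed

text \<open>
  This is how the averaged probability that \<open>j\<close> leads is computed from the one that \<open>i\<close> leads: at a
  fixed intensity of \<open>j\<close> the former is an affine function of the latter.
\<close>

lemma average_limit_asymptotically_affine:
  assumes \<Phi>: "\<Phi> \<noteq> bot" and f: "eventually (\<lambda>x. 0 \<le> f x \<and> f x \<le> 1) \<Phi>"
    and g: "eventually (\<lambda>x. 0 \<le> g x \<and> g x \<le> 1) \<Phi>" and k: "k \<ge> 0"
    and lim: "((\<lambda>x. g x - (1 - k * f x)) \<longlongrightarrow> 0) \<Phi>"
  shows "average_limit \<Phi> g = 1 - k * average_limit \<Phi> f"
proof -
  have h: "eventually (\<lambda>x. 1 - k \<le> 1 - k * f x \<and> 1 - k * f x \<le> 1) \<Phi>"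
    using f k by (auto elim!: eventually_mono intro: mult_left_le)
  have ev: "eventually (\<lambda>x. \<bar>g x - (1 - k * f x)\<bar> < e) \<Phi>" if "e > 0" for e
    using tendstoD[OF lim that] by (simp add: dist_real_def)
  have "average_limit \<Phi> g \<le> average_limit \<Phi> (\<lambda>x. 1 - k * f x)"
    by (rule average_limit_mono[OF \<Phi> g h]) (auto elim!: eventually_mono dest!: ev)
  moreover have "average_limit \<Phi> (\<lambda>x. 1 - k * f x) \<le> average_limit \<Phi> g"
    by (rule average_limit_mono[OF \<Phi> h g]) (auto elim!: eventually_mono dest!: ev)
  moreover have "average_limit \<Phi> (\<lambda>x. 1 - k * f x) = 1 - k * average_limit \<Phi> f"
    by (rule average_limit_affine[OF \<Phi> f k])
  ultimately show ?thesis by simp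
qed

lemma average_limit_sum_le_1:
  assumes \<Phi>: "\<Phi> \<noteq> bot" and f: "eventually (\<lambda>x. 0 \<le> f x \<and> f x \<le> 1) \<Phi>"
    and g: "eventually (\<lambda>x. 0 \<le> g x \<and> g x \<le> 1) \<Phi>" and le: "eventually (\<lambda>x. f x + g x \<le> 1) \<Phi>"
  shows "average_limit \<Phi> f + average_limit \<Phi> g \<le> 1"
proof -
  have h: "eventually (\<lambda>x. 0 \<le> 1 - 1 * f x \<and> 1 - 1 * f x \<le> 1) \<Phi>"
    using f by (auto elim!: eventually_mono)
  have "average_limit \<Phi> g \<le> average_limit \<Phi> (\<lambda>x. 1 - 1 * f x)"
    by (rule average_limit_mono[OF \<Phi> g h]) (use le in \<open>auto elim!: eventually_mono\<close>)
  also have "\<dots> = 1 - average_limit \<Phi> f"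
    using average_limit_affine[OF \<Phi> f, of 1 1] by simp
  finally show ?thesis by simp
qed

section \<open>Outcome probabilities\<close>

lemma mu_denominator_pos:
  fixes x y :: real
  assumes "x \<in> {0..1}" "y \<in> {0..1}" "x + y > 0"
  shows "x + y - x * y > 0"
proof -
  have eq: "x + y - x * y = x * (1 - y) + y" by (simp add: algebra_simps)
  show ?thesis
  proof (cases "y = 0")
    case False
    then have "x * (1 - y) \<ge> 0" "y > 0" using assms by auto
    then show ?thesis unfolding eq by (rule add_nonneg_pos)
  qed (use assms in simp)
qed

lemma mu_L_nonneg: "x \<in> {0..1} \<Longrightarrow> y \<in> {0..1} \<Longrightarrow> 0 \<le> mu_L x y"
proof (cases "x + y > 0")
  case True
  assume "x \<in> {0..1}" "y \<in> {0..1}"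
  then show ?thesis using mu_denominator_pos[of x y] True by (simp add: mu_L_def)
next
  case False
  assume "x \<in> {0..1}" "y \<in> {0..1}"
  with False have "x = 0" "y = 0" by auto
  then show ?thesis by (simp add: mu_L_def)
qed

text \<open>
  Repeated independent attempts with success probabilities \<open>x\<close> and \<open>y\<close>, one of them positive, end almost surely:
  the first player leads, the second one leads, or both stop together.
\<close>

lemma mu_sum_eq_1:
  assumes "x \<in> {0..1}" "y \<in> {0..1}" "x + y > 0"
  shows "mu_L x y + mu_L y x + mu_M x y = 1"
proof -
  have "mu_L y x = y * (1 - x) / (x + y - x * y)"
    by (simp add: mu_L_def add.commute mult.commute)
  then have "mu_L x y + mu_L y x + mu_M x y = (x * (1 - y) + y * (1 - x) + x * y) / (x + y - x * y)"
    by (simp add: mu_L_def mu_M_def add_divide_distrib)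
  also have "\<dots> = 1" using mu_denominator_pos[OF assms] by (simp add: algebra_simps)
  finally show ?thesis .
qed

lemma mu_M_nonneg: "x \<in> {0..1} \<Longrightarrow> y \<in> {0..1} \<Longrightarrow> 0 \<le> mu_M x y"
proof (cases "x + y > 0")
  case True
  assume "x \<in> {0..1}" "y \<in> {0..1}"
  then show ?thesis using mu_denominator_pos[of x y] True by (simp add: mu_M_def)
next
  case False
  assume "x \<in> {0..1}" "y \<in> {0..1}"
  with False have "x = 0" "y = 0" by auto
  then show ?thesis by (simp add: mu_M_def)
qed

lemma mu_L_sum_le_1:
  assumes "x \<in> {0..1}" "y \<in> {0..1}"
  shows "mu_L x y + mu_L y x \<le> 1"
proof (cases "x + y > 0")
  case True
  then show ?thesis using mu_sum_eq_1[OF assms True] mu_M_nonneg[OF assms] by simp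
next
  case False
  then have "x = 0" "y = 0" using assms by auto
  then show ?thesis by (simp add: mu_L_def)
qed

lemma mu_L_le_1: "x \<in> {0..1} \<Longrightarrow> y \<in> {0..1} \<Longrightarrow> mu_L x y \<le> 1"
  using mu_L_sum_le_1[of x y] mu_L_nonneg[of y x] by simp

lemma mu_M_le: "x \<in> {0..1} \<Longrightarrow> y \<in> {0..1} \<Longrightarrow> mu_M x y \<le> x"
proof (cases "x + y > 0")
  case True
  assume xy: "x \<in> {0..1}" "y \<in> {0..1}"
  have "y \<le> x + y - x * y" using xy by (simp add: mult_left_le)
  then have "x * y \<le> x * (x + y - x * y)" using xy by (intro mult_left_mono) auto
  then show ?thesis using mu_denominator_pos[OF xy True] by (simp add: mu_M_def divide_le_eq)
next
  case False
  assume "x \<in> {0..1}" "y \<in> {0..1}"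
  with False have "x = 0" "y = 0" by auto
  then show ?thesis by (simp add: mu_M_def)
qed

text \<open>
  The filter along which the definition of \<^const>\<open>mu_L_limit\<close> takes its limits.
\<close>

definition active_right :: "ennreal \<Rightarrow> (ennreal \<Rightarrow> real) \<Rightarrow> (ennreal \<Rightarrow> real) \<Rightarrow> ennreal filter" where
  "active_right t a b = at t within {s. t < s \<and> a s + b s > 0}"

lemma active_right_commute: "active_right t a b = active_right t b a"
  by (simp add: active_right_def add.commute)

lemma mu_L_limit_eq: "mu_L_limit t a b = average_limit (active_right t a b) (\<lambda>s. mu_L (a s) (b s))"
  by (simp add: mu_L_limit_def average_limit_def active_right_def Let_def)

lemma active_right_le_at_right: "active_right t a b \<le> at_right t"
  unfolding active_right_def by (rule at_le) auto

lemma eventually_active: "eventually (\<lambda>s. a s + b s > 0) (active_right t a b)"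
  by (simp add: active_right_def eventually_at_filter)

text \<open>
  For intensities that are not active right after \<open>t\<close> the filter is trivial; the lower and the upper limit are
  then infinite, their real parts are \<open>0\<close> by convention, and the bounds still hold.
\<close>

lemma mu_L_limit_bounds:
  assumes a: "\<And>s. a s \<in> {0..1}" and b: "\<And>s. b s \<in> {0..1}"
  shows "0 \<le> mu_L_limit t a b" and "mu_L_limit t a b + mu_L_limit t b a \<le> 1"
proof -
  let ?\<Phi> = "active_right t a b"
  have ev: "eventually (\<lambda>s. 0 \<le> mu_L (a s) (b s) \<and> mu_L (a s) (b s) \<le> 1) ?\<Phi>"
    "eventually (\<lambda>s. 0 \<le> mu_L (b s) (a s) \<and> mu_L (b s) (a s) \<le> 1) ?\<Phi>"
    "eventually (\<lambda>s. mu_L (a s) (b s) + mu_L (b s) (a s) \<le> 1) ?\<Phi>"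
    using a b by (simp_all add: mu_L_nonneg mu_L_le_1 mu_L_sum_le_1)
  have triv: "average_limit bot f = 0" for f :: "ennreal \<Rightarrow> real"
    by (simp add: average_limit_def top_ereal_def bot_ereal_def)
  show "0 \<le> mu_L_limit t a b"
    using average_limit_bounds(1)[OF _ ev(1)] triv by (cases "?\<Phi> = bot") (simp_all add: mu_L_limit_eq)
  show "mu_L_limit t a b + mu_L_limit t b a \<le> 1"
    using average_limit_sum_le_1[OF _ ev] triv
    by (cases "?\<Phi> = bot") (simp_all add: mu_L_limit_eq active_right_commute[of t b a])
qed

section \<open>Paths of strategies\<close>

text \<open>
  What almost every path of an extended mixed strategy satisfies.
\<close>

definition strategy_path :: "ennreal \<Rightarrow> (ennreal \<Rightarrow> real) \<Rightarrow> (ennreal \<Rightarrow> real) \<Rightarrow> bool" where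
  "strategy_path v g a \<longleftrightarrow> (\<forall>t. g t \<in> {0..1} \<and> a t \<in> {0..1}) \<and> (\<forall>t<\<infinity>. right_cont_at g t) \<and>
     mono_on {..<\<infinity>} g \<and> (\<forall>s<v. g s = 0) \<and> (\<forall>t<\<infinity>. a t \<in> {0<..<1} \<longrightarrow> right_cont_at a t) \<and>
     (\<forall>t<\<infinity>. a t > 0 \<longrightarrow> g t = 1) \<and> g \<infinity> = 1 \<and> a \<infinity> = 1"

lemma strategy_pathD:
  assumes "strategy_path v g a"
  shows "g t \<in> {0..1}" and "a t \<in> {0..1}" and "t < \<infinity> \<Longrightarrow> right_cont_at g t"
    and "s \<le> t \<Longrightarrow> t < \<infinity> \<Longrightarrow> g s \<le> g t" and "s < v \<Longrightarrow> g s = 0"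
    and "t < \<infinity> \<Longrightarrow> a t \<in> {0<..<1} \<Longrightarrow> right_cont_at a t"
    and "a t > 0 \<Longrightarrow> g t = 1" and "g \<infinity> = 1" and "a \<infinity> = 1"
proof -
  show "a t > 0 \<Longrightarrow> g t = 1"
    using assms by (cases "t = \<infinity>") (auto simp: strategy_path_def less_top)
  show "s \<le> t \<Longrightarrow> t < \<infinity> \<Longrightarrow> g s \<le> g t"
    using assms by (auto simp: strategy_path_def mono_on_def)
qed (use assms in \<open>auto simp: strategy_path_def\<close>)

lemma left_limit_zero:
  assumes "\<And>s. s < t \<Longrightarrow> g s = 0"
  shows "left_limit g t = 0"
proof (cases "t = 0")
  case False
  then have t: "0 < t" by (simp add: zero_less_iff_neq_zero)
  then have "at_left t \<noteq> bot"
    unfolding trivial_limit_def eventually_at_left[OF t] using dense by blast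
  moreover have "(g \<longlongrightarrow> 0) (at_left t)"
    by (rule tendsto_eventually) (auto simp: eventually_at_left[OF t] assms intro: t)
  ultimately show ?thesis using False by (simp add: left_limit_def tendsto_Lim)
qed (simp add: left_limit_def)

text \<open>
  The path vanishes before the start \<open>v\<close>, so \<open>[0,v)\<close> carries no mass; monotonicity and right-continuity are
  needed on the whole line for the Stieltjes measure to be given by increments.
\<close>

lemma stieltjes_integral_before_start:
  assumes g: "strategy_path v g a"
  shows "stieltjes_integral v f g = 0"
proof -
  let ?h = "\<lambda>x::real. if x < 0 then 0 else g (ennreal x)"
  note D = strategy_pathD[OF g]
  have mono: "?h x \<le> ?h y" if "x \<le> y" for x y
    using that D(1)[of "ennreal y"] D(4)[of "ennreal x" "ennreal y"] by (auto intro: ennreal_leI)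
  have cont: "continuous (at_right x) ?h" for x
  proof (cases "x < 0")
    case True
    then have "eventually (\<lambda>y. ?h y = ?h x) (at_right x)"
      by (auto simp: eventually_at_right_field intro!: exI[of _ 0])
    then show ?thesis by (simp add: continuous_within tendsto_eventually)
  next
    case False
    then have "filterlim ennreal (at_right (ennreal x)) (at_right x)"
      unfolding filterlim_at
      by (auto simp: eventually_at_filter ennreal_less_iff intro!: tendsto_intros)
    then have "((\<lambda>y. g (ennreal y)) \<longlongrightarrow> g (ennreal x)) (at_right x)"
      using D(3)[of "ennreal x"] unfolding right_cont_at_def by (auto intro: filterlim_compose)
    moreover have "eventually (\<lambda>y. g (ennreal y) = ?h y) (at_right x)"
      using False by (auto simp: eventually_at_filter)
    ultimately have "(?h \<longlongrightarrow> g (ennreal x)) (at_right x)"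
      by (rule Lim_transform_eventually)
    then show ?thesis using False by (simp add: continuous_within)
  qed
  \<comment> \<open>The lower end \<open>-1\<close> lies in the region where the path is extended by \<open>0\<close>, so that an atom at \<open>0\<close> would be counted.\<close>
  let ?N = "\<Union>q\<in>{q::rat. 0 \<le> q \<and> ennreal (real_of_rat q) < v}. {-1<..real_of_rat q}"
  have null: "?N \<in> null_sets (interval_measure ?h)"
  proof (rule null_sets_UN')
    fix q :: rat assume q: "q \<in> {q. 0 \<le> q \<and> ennreal (real_of_rat q) < v}"
    then have "-1 \<le> real_of_rat q" by (simp add: order_trans[of "-1" 0])
    then have "emeasure (interval_measure ?h) {-1<..real_of_rat q} = ?h (real_of_rat q) - ?h (-1)"
      by (rule emeasure_interval_measure_Ioc[OF _ mono cont])
    also have "\<dots> = 0" using q D(5) by simp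
    finally show "{-1<..real_of_rat q} \<in> null_sets (interval_measure ?h)" by (simp add: null_sets_def)
  qed simp
  have cover: "x \<in> ?N" if x: "0 \<le> x" "ennreal x < v" for x
  proof -
    obtain q where q: "ennreal x < real_of_rat q" "ennreal (real_of_rat q) < v"
      using ennreal_rat_dense[OF x(2)] by blast
    then have "x < real_of_rat q" using x(1) by (simp add: ennreal_less_iff)
    moreover then have "0 \<le> q" using x(1) by (metis le_less_trans less_imp_le zero_less_of_rat_iff)
    ultimately show ?thesis using q x(1) by (intro UN_I[of q]) auto
  qed
  have "AE x in stieltjes_measure g. indicator {x. 0 \<le> x \<and> ennreal x < v} x *\<^sub>R f (ennreal x) = 0"
    unfolding stieltjes_measure_def
    by (rule AE_I'[OF null]) (use cover in \<open>auto split: split_indicator_asm simp: indicator_def\<close>)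
  then show ?thesis
    unfolding stieltjes_integral_def set_lebesgue_integral_def by (rule integral_eq_zero_AE)
qed

section \<open>Payoffs when the opponent starts preempting at once\<close>

text \<open>
  The probability that the player with strategy path \<open>(g, a)\<close> leads against an opponent who starts at \<open>v\<close> with
  full mass and whose intensity \<open>b\<close> is first positive at \<open>v\<close>.
\<close>

definition lead_weight :: "ennreal \<Rightarrow> (ennreal \<Rightarrow> real) \<Rightarrow> (ennreal \<Rightarrow> real) \<Rightarrow> (ennreal \<Rightarrow> real) \<Rightarrow> real" where
  "lead_weight v g a b =
     (if v < first_pos v a then (1 - b v) * g v
      else if max (a v) (b v) = 1 \<or> min (a v) (b v) > 0 then mu_L (a v) (b v)
      else (1 - b v) * (a v + (1 - a v) * mu_L_limit v a b))"

text \<open>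
  Likewise, the probability that the opponent leads.
\<close>

definition follow_weight :: "ennreal \<Rightarrow> (ennreal \<Rightarrow> real) \<Rightarrow> (ennreal \<Rightarrow> real) \<Rightarrow> (ennreal \<Rightarrow> real) \<Rightarrow> real" where
  "follow_weight v g a b =
     (if v < first_pos v a then 1 - g v
      else if max (a v) (b v) = 1 \<or> min (a v) (b v) > 0 then mu_L (b v) (a v)
      else (1 - a v) * (b v + (1 - b v) * mu_L_limit v b a))"

lemma first_pos_ge: "v \<le> first_pos v a"
  by (auto simp: first_pos_def intro: Inf_greatest)

text \<open>
  A deviation cannot delay the end of the game beyond the first positive intensity of the opponent.
\<close>

lemma tau_hat_eq_start:
  assumes a: "\<And>t. 0 \<le> a t" and b: "first_pos v b = v"
  shows "tau_hat v a b = v" and "tau_hat v b a = v"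
proof -
  have "first_pos v (\<lambda>t. a t + b t) \<le> first_pos v b"
    unfolding first_pos_def by (rule Inf_superset_mono) (auto intro: add_nonneg_pos a)
  then show "tau_hat v a b = v"
    using b first_pos_ge[of v "\<lambda>t. a t + b t"] by (simp add: tau_hat_def)
  then show "tau_hat v b a = v" by (simp add: tau_hat_def add.commute)
qed

text \<open>
  All mass is used up at \<open>v\<close>: nothing happens before, so the integrals and the sum vanish and the left limits are
  \<open>0\<close>.  What is left are the outcome probabilities at \<open>v\<close>.
\<close>

lemma path_payoff_eq_weights:
  assumes i: "strategy_path v gi ai" and j: "strategy_path v gj aj"
    and start: "first_pos v aj = v" and full: "gj v = 1"
  shows "path_payoff v l f m gi ai gj aj =
    lead_weight v gi ai aj * l v + follow_weight v gi ai aj * f v +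
    (1 - lead_weight v gi ai aj - follow_weight v gi ai aj) * m v"
proof -
  note Di = strategy_pathD[OF i] and Dj = strategy_pathD[OF j]
  have tau: "tau_hat v ai aj = v" "tau_hat v aj ai = v"
    using Di(2) start by (auto intro: tau_hat_eq_start)
  have ll: "left_limit gi t = 0" "left_limit gj t = 0" if "t \<le> v" for t
    using that Di(5) Dj(5) by (auto intro!: left_limit_zero)
  have sum: "(\<Sum>\<^sub>\<infinity>s\<in>{..<v}. jump gi s * jump gj s * m s) = 0"
    by (rule infsum_0) (use ll Di(5) in \<open>auto simp: jump_def\<close>)
  have L: "lambda_L v gi ai gj aj = lead_weight v gi ai aj"
    by (simp add: lambda_L_def lead_weight_def tau start ll jump_def)
  have F: "lambda_L v gj aj gi ai = follow_weight v gi ai aj"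
    by (simp add: lambda_L_def follow_weight_def tau start ll max.commute min.commute)
  have mu: "mu_M (ai v) (aj v) = 1 - mu_L (ai v) (aj v) - mu_L (aj v) (ai v)"
    if "max (ai v) (aj v) = 1 \<or> min (ai v) (aj v) > 0"
  proof -
    have "ai v + aj v > 0"
      using that Di(2)[of v] Dj(2)[of v] by (auto simp: max_def min_def split: if_splits)
    from mu_sum_eq_1[OF Di(2) Dj(2) this] show ?thesis by simp
  qed
  have M: "lambda_M v gi ai gj aj = 1 - lead_weight v gi ai aj - follow_weight v gi ai aj"
  proof (cases "v < first_pos v ai")
    case True
    then show ?thesis
      by (simp add: lambda_M_def lead_weight_def follow_weight_def tau start ll jump_def algebra_simps)
  next
    case False
    then show ?thesis
      by (simp add: lambda_M_def tau start ll L F) (auto simp: lead_weight_def follow_weight_def mu)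
  qed
  show ?thesis
    by (simp add: path_payoff_def tau stieltjes_integral_before_start[OF i]
        stieltjes_integral_before_start[OF j] sum L F M)
qed

lemma outcome_weights_convex:
  assumes g: "g v \<in> {0..1}" and a: "\<And>t. a t \<in> {0..1}" and b: "\<And>t. b t \<in> {0..1}"
  shows "0 \<le> lead_weight v g a b" and "0 \<le> follow_weight v g a b"
    and "lead_weight v g a b + follow_weight v g a b \<le> 1"
proof -
  note ab = mu_L_limit_bounds[of a b v, OF a b] and ba = mu_L_limit_bounds[of b a v, OF b a]
  show "0 \<le> lead_weight v g a b" "0 \<le> follow_weight v g a b"
    using g a[of v] b[of v] ab ba
    by (auto simp: lead_weight_def follow_weight_def intro!: mu_L_nonneg mult_nonneg_nonneg add_nonneg_nonneg)
  consider "v < first_pos v a" | "\<not> v < first_pos v a" "max (a v) (b v) = 1 \<or> min (a v) (b v) > 0"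
    | "\<not> v < first_pos v a" "\<not> (max (a v) (b v) = 1 \<or> min (a v) (b v) > 0)" by blast
  then show "lead_weight v g a b + follow_weight v g a b \<le> 1"
  proof cases
    case 1
    have "(1 - b v) * g v \<le> g v" using g b[of v] by (intro mult_left_le_one_le) auto
    then show ?thesis using 1 by (simp add: lead_weight_def follow_weight_def)
  next
    case 2
    then show ?thesis using mu_L_sum_le_1[OF a b] by (simp add: lead_weight_def follow_weight_def)
  next
    case 3
    then consider "a v = 0" | "b v = 0" using a[of v] b[of v] by (force simp: min_def split: if_splits)
    then show ?thesis
    proof cases
      case 1
      have "(1 - b v) * (mu_L_limit v a b + mu_L_limit v b a) \<le> (1 - b v) * 1"
        using ab b[of v] by (intro mult_left_mono) auto
      then show ?thesis using 3 1 by (simp add: lead_weight_def follow_weight_def algebra_simps)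
    next
      case 2
      have "(1 - a v) * (mu_L_limit v a b + mu_L_limit v b a) \<le> (1 - a v) * 1"
        using ab a[of v] by (intro mult_left_mono) auto
      then show ?thesis using 3 2 by (simp add: lead_weight_def follow_weight_def algebra_simps)
    qed
  qed
qed

lemma convex_combination_le:
  fixes w w' x y z u :: real
  assumes "0 \<le> w" "0 \<le> w'" "w + w' \<le> 1" and "x \<le> u" "y \<le> u" "z \<le> u"
  shows "w * x + w' * y + (1 - w - w') * z \<le> u"
proof -
  have "w * x + w' * y + (1 - w - w') * z \<le> w * u + w' * u + (1 - w - w') * u"
    using assms by (intro add_mono mult_left_mono) auto
  then show ?thesis by (simp add: algebra_simps)
qed

lemma abs_convex_combination_le:
  fixes w w' x y z :: real
  assumes "0 \<le> w" "0 \<le> w'" "w + w' \<le> 1"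
  shows "\<bar>w * x + w' * y + (1 - w - w') * z\<bar> \<le> \<bar>x\<bar> + \<bar>y\<bar> + \<bar>z\<bar>"
proof (rule abs_leI)
  show "w * x + w' * y + (1 - w - w') * z \<le> \<bar>x\<bar> + \<bar>y\<bar> + \<bar>z\<bar>"
    by (rule convex_combination_le[OF assms]) auto
  have "w * - x + w' * - y + (1 - w - w') * - z \<le> \<bar>x\<bar> + \<bar>y\<bar> + \<bar>z\<bar>"
    by (rule convex_combination_le[OF assms]) auto
  then show "- (w * x + w' * y + (1 - w - w') * z) \<le> \<bar>x\<bar> + \<bar>y\<bar> + \<bar>z\<bar>"
    by (simp add: algebra_simps)
qed

lemma active_right_nontrivial:
  assumes "\<exists>\<^sub>F s in at_right t. a s + b s > 0"
  shows "active_right t a b \<noteq> bot"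
proof
  assume "active_right t a b = bot"
  then have "eventually (\<lambda>s. False) (active_right t a b)" by simp
  then have "eventually (\<lambda>s. \<not> a s + b s > 0) (at_right t)"
    by (auto simp: active_right_def eventually_at_filter elim: eventually_mono)
  then show False using assms by (simp add: frequently_def)
qed

text \<open>
  Let the opponent's intensity be fixed at \<open>y < 1\<close>.  When the player's own attempt succeeds, the game ends with
  leading if the opponent fails and with simultaneous stopping if the opponent succeeds, so \<open>\<mu>\<^sub>M = y / (1 - y) * \<mu>\<^sub>L\<close> and the
  opponent leads with probability \<open>1 - \<mu>\<^sub>L / (1 - y)\<close>.  By right-continuity this holds in the limit.
\<close>

lemma mu_L_limit_right_continuous:
  assumes t: "t < \<infinity>" and a: "\<And>s. a s \<in> {0..1}" and b: "\<And>s. b s \<in> {0..1}"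
    and bt: "b t \<in> {0<..<1}" and cont: "right_cont_at b t"
  shows "mu_L_limit t b a = 1 - 1 / (1 - b t) * mu_L_limit t a b"
proof -
  let ?\<Phi> = "active_right t a b" and ?k = "1 / (1 - b t)"
  have lim: "(b \<longlongrightarrow> b t) (at_right t)" using cont by (simp add: right_cont_at_def)
  have "eventually (\<lambda>s. b s > 0) (at_right t)"
    using order_tendstoD(1)[OF lim, of 0] bt by simp
  then have "eventually (\<lambda>s. a s + b s > 0) (at_right t)"
    by eventually_elim (use a in \<open>auto intro: add_nonneg_pos\<close>)
  then have \<Phi>: "?\<Phi> \<noteq> bot"
    by (intro active_right_nontrivial eventually_frequently at_right_ennreal_nontrivial t)
  have lim\<Phi>: "(b \<longlongrightarrow> b t) ?\<Phi>"
    using lim active_right_le_at_right by (rule tendsto_mono[rotated])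
  have "((\<lambda>s. ?k - 1 / (1 - b s)) \<longlongrightarrow> ?k - ?k) ?\<Phi>"
    using bt by (intro tendsto_intros lim\<Phi>) auto
  then have lim0: "((\<lambda>s. ?k - 1 / (1 - b s)) \<longlongrightarrow> 0) ?\<Phi>" by simp
  have lt1: "eventually (\<lambda>s. b s < 1) ?\<Phi>"
    using order_tendstoD(2)[OF lim\<Phi>, of 1] bt by simp
  have "eventually (\<lambda>s. norm (mu_L (b s) (a s) - (1 - ?k * mu_L (a s) (b s))) \<le> norm (?k - 1 / (1 - b s))) ?\<Phi>"
    using lt1 eventually_active[of a b t]
  proof eventually_elim
    case (elim s)
    have D: "a s + b s - a s * b s > 0" using mu_denominator_pos[OF a b] elim by simp
    have mu: "mu_L (a s) (b s) = a s * (1 - b s) / (a s + b s - a s * b s)"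
      by (simp add: mu_L_def)
    have "mu_L (a s) (b s) + mu_L (b s) (a s) + mu_M (a s) (b s) = 1"
      using elim by (intro mu_sum_eq_1 a b) simp
    moreover have "mu_L (a s) (b s) + mu_M (a s) (b s) = mu_L (a s) (b s) * (1 / (1 - b s))"
      using elim D by (simp add: mu mu_M_def flip: add_divide_distrib) (simp add: algebra_simps)
    ultimately have "mu_L (b s) (a s) = 1 - mu_L (a s) (b s) * (1 / (1 - b s))" by linarith
    then have "mu_L (b s) (a s) - (1 - ?k * mu_L (a s) (b s)) = mu_L (a s) (b s) * (?k - 1 / (1 - b s))"
      by (simp add: algebra_simps)
    then show ?case
      using mu_L_nonneg[OF a b, of s s] mu_L_le_1[OF a b, of s s]
      by (simp add: abs_mult mult_left_le_one_le)
  qed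
  from Lim_null_comparison[OF this] have
    "((\<lambda>s. mu_L (b s) (a s) - (1 - ?k * mu_L (a s) (b s))) \<longlongrightarrow> 0) ?\<Phi>"
    using tendsto_norm_zero[OF lim0] by simp
  then have "average_limit ?\<Phi> (\<lambda>s. mu_L (b s) (a s)) = 1 - ?k * average_limit ?\<Phi> (\<lambda>s. mu_L (a s) (b s))"
    by (intro average_limit_asymptotically_affine \<Phi>)
       (use bt in \<open>auto simp: mu_L_nonneg[OF a b] mu_L_le_1[OF a b] mu_L_nonneg[OF b a] mu_L_le_1[OF b a]\<close>)
  then show ?thesis by (simp add: mu_L_limit_eq active_right_commute[of t b a])
qed

text \<open>
  If simultaneous stopping becomes impossible in the limit, lower and upper limits of the two leading
  probabilities are complementary.
\<close>

lemma mu_L_limit_no_coordination_failure: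
  assumes a: "\<And>s. a s \<in> {0..1}" and b: "\<And>s. b s \<in> {0..1}"
    and act: "\<exists>\<^sub>F s in at_right t. a s + b s > 0"
    and lim: "((\<lambda>s. mu_M (a s) (b s)) \<longlongrightarrow> 0) (at_right t)"
  shows "mu_L_limit t a b + mu_L_limit t b a = 1"
proof -
  let ?\<Phi> = "active_right t a b"
  have \<Phi>: "?\<Phi> \<noteq> bot" using act by (rule active_right_nontrivial)
  have "((\<lambda>s. - mu_M (a s) (b s)) \<longlongrightarrow> - 0) ?\<Phi>"
    using lim active_right_le_at_right by (intro tendsto_minus) (rule tendsto_mono)
  moreover have "eventually (\<lambda>s. - mu_M (a s) (b s) = mu_L (b s) (a s) - (1 - 1 * mu_L (a s) (b s))) ?\<Phi>"
    using eventually_active[of a b t]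
  proof eventually_elim
    case (elim s)
    then show ?case using mu_sum_eq_1[OF a b elim] by simp
  qed
  ultimately have "((\<lambda>s. mu_L (b s) (a s) - (1 - 1 * mu_L (a s) (b s))) \<longlongrightarrow> 0) ?\<Phi>"
    by (auto dest: Lim_transform_eventually)
  then have "average_limit ?\<Phi> (\<lambda>s. mu_L (b s) (a s)) = 1 - 1 * average_limit ?\<Phi> (\<lambda>s. mu_L (a s) (b s))"
    by (intro average_limit_asymptotically_affine \<Phi>)
       (auto simp: mu_L_nonneg[OF a b] mu_L_le_1[OF a b] mu_L_nonneg[OF b a] mu_L_le_1[OF b a])
  then show ?thesis by (simp add: mu_L_limit_eq active_right_commute[of t b a])
qed

section \<open>Paths of the preemption equilibrium\<close>

lemma opponent_involution: "opponent (opponent i) = i"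
  by (cases i) simp_all

lemma opponent_unique: "i \<noteq> j \<Longrightarrow> j = opponent i"
  by (cases i; cases j) simp_all

lemma all_players_iff: "(\<forall>k. Q k) \<longleftrightarrow> Q i \<and> Q (opponent i)"
proof -
  have "(\<forall>k. Q k) \<longleftrightarrow> Q Player1 \<and> Q Player2" by (metis player.exhaust)
  then show ?thesis by (cases i) auto
qed

text \<open>
  The claimed equilibrium payoff.
\<close>

definition preemption_value ::
    "(player \<Rightarrow> 'a process) \<Rightarrow> (player \<Rightarrow> 'a process) \<Rightarrow> ('a \<Rightarrow> ennreal) \<Rightarrow> player \<Rightarrow> 'a \<Rightarrow> real" where
  "preemption_value L F \<theta> i \<omega> =
     F i (\<theta> \<omega>) \<omega> * of_bool (L (opponent i) (\<theta> \<omega>) \<omega> > F (opponent i) (\<theta> \<omega>) \<omega>) +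
     L i (\<theta> \<omega>) \<omega> * of_bool (L (opponent i) (\<theta> \<omega>) \<omega> = F (opponent i) (\<theta> \<omega>) \<omega>)"

text \<open>
  A sample point at which the almost sure properties of the game and of \<open>\<theta>\<close> hold simultaneously at all times.
\<close>

locale preemption_path =
  fixes L F M :: "player \<Rightarrow> 'a process" and \<theta> :: "'a \<Rightarrow> ennreal" and \<omega> :: 'a
  assumes L_cont: "\<And>i t. t < \<infinity> \<Longrightarrow> right_cont_at (\<lambda>s. L i s \<omega>) t"
    and F_cont: "\<And>i t. t < \<infinity> \<Longrightarrow> right_cont_at (\<lambda>s. F i s \<omega>) t"
    and M_cont: "\<And>i t. t < \<infinity> \<Longrightarrow> right_cont_at (\<lambda>s. M i s \<omega>) t"
    and M_le_F: "\<And>i t. t < \<infinity> \<Longrightarrow> M i t \<omega> \<le> F i t \<omega>"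
    and L_inf: "\<And>i. L i \<infinity> \<omega> = M i \<infinity> \<omega>"
    and F_inf: "\<And>i. F i \<infinity> \<omega> = M i \<infinity> \<omega>"
    and preempt_start: "\<theta> \<omega> = preemption_time L F \<theta> \<omega>"
begin

definition preempts :: "ennreal \<Rightarrow> bool" where
  "preempts t \<longleftrightarrow> (\<forall>i. F i t \<omega> < L i t \<omega>)"

abbreviation attack :: "player \<Rightarrow> ennreal \<Rightarrow> real" where
  "attack i t \<equiv> preemption_alpha L F M \<theta> i t \<omega>"

lemma preempts_iff: "preempts t \<longleftrightarrow> F i t \<omega> < L i t \<omega> \<and> F (opponent i) t \<omega> < L (opponent i) t \<omega>"
  unfolding preempts_def by (rule all_players_iff)

lemma min_pos_iff_preempts:
  "min (L Player1 t \<omega> - F Player1 t \<omega>) (L Player2 t \<omega> - F Player2 t \<omega>) > 0 \<longleftrightarrow> preempts t"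
  using preempts_iff[of t Player1] by simp

lemma preemption_time_eq: "preemption_time L F \<tau> \<omega> = Inf {u. \<tau> \<omega> \<le> u \<and> preempts u}"
  unfolding preemption_time_def min_pos_iff_preempts ..

lemma start_eq_Inf: "\<theta> \<omega> = Inf {u. \<theta> \<omega> \<le> u \<and> preempts u}"
  using preempt_start by (simp add: preemption_time_eq)

lemma start_is_preemption_time: "\<theta> \<omega> = preemption_time L F (\<lambda>_. \<theta> \<omega>) \<omega>"
  using start_eq_Inf by (simp add: preemption_time_eq)

lemma attack_infinity: "attack i \<infinity> = 1"
  by (simp add: preemption_alpha_def Let_def)

lemma attack_before_start: "t < \<theta> \<omega> \<Longrightarrow> attack i t = 0"
  by (auto simp: preemption_alpha_def Let_def)

text \<open>
  The intensity of \<open>i\<close> at which the opponent is indifferent between attempting to stop and following.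
\<close>

definition ratio :: "player \<Rightarrow> ennreal \<Rightarrow> real" where
  "ratio i t = (L (opponent i) t \<omega> - F (opponent i) t \<omega>) / (L (opponent i) t \<omega> - M (opponent i) t \<omega>)"

lemma attack_preempting:
  assumes "\<theta> \<omega> \<le> t" "t < \<infinity>" "preempts t"
  shows "attack i t = ratio i t"
  using assms preempts_iff[of t i] preempts_iff[of t Player1]
  by (auto simp: preemption_alpha_def Let_def ratio_def)

lemma attack_not_preempting:
  assumes "\<theta> \<omega> \<le> t" "t < \<infinity>" "\<not> preempts t"
  shows "attack i t = of_bool (t = preemption_time L F (\<lambda>_. t) \<omega> \<and>
    L (opponent i) t \<omega> = F (opponent i) t \<omega> \<and> (L i t \<omega> > F i t \<omega> \<or> F (opponent i) t \<omega> = M (opponent i) t \<omega>))"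
  using assms preempts_iff[of t Player1]
  by (auto simp: preemption_alpha_def Let_def)

lemma ratio_range:
  assumes "t < \<infinity>" "preempts t"
  shows "0 < ratio i t" and "ratio i t \<le> 1"
  using assms preempts_iff[of t i] M_le_F[of t "opponent i"] by (auto simp: ratio_def)

lemma attack_range: "attack i t \<in> {0..1}"
proof -
  consider "t = \<infinity>" | "t < \<theta> \<omega>" | "\<theta> \<omega> \<le> t" "t < \<infinity>" "preempts t" | "\<theta> \<omega> \<le> t" "t < \<infinity>" "\<not> preempts t"
    using less_top[of t] by (fastforce simp: not_less)
  then show ?thesis
    by cases (use ratio_range[of t i] in \<open>auto simp: attack_infinity[unfolded infinity_ennreal_def] attack_before_start
      attack_preempting attack_not_preempting less_imp_le\<close>)
qed

lemma attack_pos: "\<theta> \<omega> \<le> t \<Longrightarrow> t < \<infinity> \<Longrightarrow> preempts t \<Longrightarrow> 0 < attack i t"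
  by (simp add: attack_preempting ratio_range)

text \<open>
  The intensities are positive in the whole preemption region, whose infimum is \<open>\<theta>\<close>.
\<close>

lemma first_pos_attack: "first_pos (\<theta> \<omega>) (attack i) = \<theta> \<omega>"
proof (rule antisym)
  have "preempts u \<Longrightarrow> u \<noteq> \<infinity>" for u
    using preempts_iff[of u i] L_inf[of i] F_inf[of i] by auto
  then have "{u. \<theta> \<omega> \<le> u \<and> preempts u} \<subseteq> {t. \<theta> \<omega> \<le> t \<and> 0 < attack i t}"
    by (auto intro!: attack_pos simp: less_top[symmetric])
  then have "first_pos (\<theta> \<omega>) (attack i) \<le> Inf {u. \<theta> \<omega> \<le> u \<and> preempts u}"
    unfolding first_pos_def by (rule Inf_superset_mono)
  then show "first_pos (\<theta> \<omega>) (attack i) \<le> \<theta> \<omega>" using start_eq_Inf by simp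
qed (rule first_pos_ge)

lemma frequently_preempts:
  assumes "\<theta> \<omega> < \<infinity>" "\<not> preempts (\<theta> \<omega>)"
  shows "\<exists>\<^sub>F s in at_right (\<theta> \<omega>). preempts s"
  unfolding frequently_def eventually_at_right_ennreal[OF assms(1)]
proof (clarsimp)
  fix b assume b: "\<theta> \<omega> < b"
  then have "Inf {u. \<theta> \<omega> \<le> u \<and> preempts u} < b" using start_eq_Inf by simp
  then obtain u where "\<theta> \<omega> \<le> u" "preempts u" "u < b" by (auto simp: Inf_less_iff)
  moreover then have "u \<noteq> \<theta> \<omega>" using assms by auto
  ultimately show "\<exists>y>\<theta> \<omega>. y < b \<and> preempts y" by (intro exI[of _ u]) auto
qed

text \<open>
  If following were strictly better for some player at \<open>\<theta>\<close>, it would remain so for a while by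
  right-continuity, and preemption could not start at \<open>\<theta>\<close>.
\<close>

lemma F_le_L_at_start:
  assumes "\<theta> \<omega> < \<infinity>"
  shows "F i (\<theta> \<omega>) \<omega> \<le> L i (\<theta> \<omega>) \<omega>"
proof (rule ccontr)
  assume "\<not> ?thesis"
  then have lt: "L i (\<theta> \<omega>) \<omega> - F i (\<theta> \<omega>) \<omega> < 0" by simp
  have "((\<lambda>s. L i s \<omega> - F i s \<omega>) \<longlongrightarrow> L i (\<theta> \<omega>) \<omega> - F i (\<theta> \<omega>) \<omega>) (at_right (\<theta> \<omega>))"
    using L_cont[OF assms] F_cont[OF assms] unfolding right_cont_at_def by (intro tendsto_diff)
  from order_tendstoD(2)[OF this lt] have "eventually (\<lambda>s. \<not> preempts s) (at_right (\<theta> \<omega>))"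
    by (auto elim!: eventually_mono simp: preempts_iff[of _ i])
  moreover have "\<not> preempts (\<theta> \<omega>)" using lt by (auto simp: preempts_iff[of _ i])
  ultimately show False using frequently_preempts[OF assms] by (auto simp: frequently_def)
qed

lemma right_cont_ratio:
  assumes "t < \<infinity>" and "L (opponent i) t \<omega> \<noteq> M (opponent i) t \<omega>"
  shows "(ratio i \<longlongrightarrow> ratio i t) (at_right t)"
  unfolding ratio_def[abs_def]
  using L_cont[OF assms(1)] F_cont[OF assms(1)] M_cont[OF assms(1)] assms(2)
  unfolding right_cont_at_def by (intro tendsto_intros) auto

lemma eventually_after: "\<theta> \<omega> \<le> t \<Longrightarrow> t < \<infinity> \<Longrightarrow> eventually (\<lambda>s. \<theta> \<omega> \<le> s \<and> s < \<infinity>) (at_right t)"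
  using eventually_at_right_less_ennreal[of t \<infinity>] by (auto elim!: eventually_mono)

lemma eventually_preempts:
  assumes "t < \<infinity>" "preempts t"
  shows "eventually preempts (at_right t)"
proof -
  have "eventually (\<lambda>s. F i s \<omega> < L i s \<omega>) (at_right t)" for i
  proof -
    have "((\<lambda>s. L i s \<omega> - F i s \<omega>) \<longlongrightarrow> L i t \<omega> - F i t \<omega>) (at_right t)"
      using L_cont[OF assms(1)] F_cont[OF assms(1)] unfolding right_cont_at_def by (intro tendsto_diff)
    from order_tendstoD(1)[OF this, of 0] show ?thesis
      using assms(2) by (simp add: preempts_def)
  qed
  from eventually_conj[OF this[of Player1] this[of "opponent Player1"]] show ?thesis
    unfolding preempts_iff[of _ Player1, abs_def] .
qed

text \<open>
  An intensity strictly between \<open>0\<close> and \<open>1\<close> occurs in the preemption region only.  The path stays there for a while,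
  where the intensity is the continuous expression \<^const>\<open>ratio\<close>.
\<close>

lemma attack_right_cont:
  assumes t: "t < \<infinity>" and a: "attack i t \<in> {0<..<1}"
  shows "right_cont_at (attack i) t"
proof -
  have after: "\<theta> \<omega> \<le> t" using a attack_before_start[of t i] by (cases "t < \<theta> \<omega>") auto
  have p: "preempts t"
    using a attack_not_preempting[OF after t, of i] by (cases "preempts t") (simp_all add: of_bool_def split: if_splits)
  have "eventually (\<lambda>s. ratio i s = attack i s) (at_right t)"
    using eventually_after[OF after t] eventually_preempts[OF t p]
    by eventually_elim (simp add: attack_preempting)
  moreover have "(ratio i \<longlongrightarrow> ratio i t) (at_right t)"
    using p M_le_F[OF t, of "opponent i"] by (intro right_cont_ratio t) (auto simp: preempts_iff[of _ i])
  ultimately have "(attack i \<longlongrightarrow> ratio i t) (at_right t)" by (rule Lim_transform_eventually[rotated])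
  then show ?thesis unfolding right_cont_at_def attack_preempting[OF after t p] .
qed

lemma preemption_strategy_path:
  "strategy_path (\<theta> \<omega>) (\<lambda>t. preemption_G \<theta> i t \<omega>) (attack i)"
  unfolding strategy_path_def
proof (intro conjI allI impI)
  show "right_cont_at (\<lambda>t. preemption_G \<theta> i t \<omega>) t" if t: "t < \<infinity>" for t
  proof (cases "\<theta> \<omega> \<le> t")
    case True
    have "eventually (\<lambda>s. preemption_G \<theta> i s \<omega> = preemption_G \<theta> i t \<omega>) (at_right t)"
      using eventually_at_right_less_ennreal[of t \<infinity>] t True
      by (auto elim!: eventually_mono simp: preemption_G_def)
    then show ?thesis unfolding right_cont_at_def by (rule tendsto_eventually)
  next
    case False
    then have "t < \<theta> \<omega>" by simp
    then have "eventually (\<lambda>s. preemption_G \<theta> i s \<omega> = preemption_G \<theta> i t \<omega>) (at_right t)"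
      using eventually_at_right_less_ennreal[OF \<open>t < \<theta> \<omega>\<close>]
      by (auto elim!: eventually_mono simp: preemption_G_def)
    then show ?thesis unfolding right_cont_at_def by (rule tendsto_eventually)
  qed
  show "preemption_G \<theta> i t \<omega> = 1" if "0 < attack i t" for t
    using that attack_before_start[of t i] by (cases "t < \<theta> \<omega>") (auto simp: preemption_G_def)
qed (use attack_range attack_right_cont in \<open>auto simp: preemption_G_def mono_on_def attack_infinity[unfolded infinity_ennreal_def]\<close>)

text \<open>
  The payoff of \<open>i\<close> from the strategy path \<open>(g, a)\<close> against the prescribed strategy of the opponent.
\<close>

definition weighted_payoff :: "player \<Rightarrow> (ennreal \<Rightarrow> real) \<Rightarrow> (ennreal \<Rightarrow> real) \<Rightarrow> real" where
  "weighted_payoff i g a =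
    (let w = lead_weight (\<theta> \<omega>) g a (attack (opponent i)); w' = follow_weight (\<theta> \<omega>) g a (attack (opponent i))
     in w * L i (\<theta> \<omega>) \<omega> + w' * F i (\<theta> \<omega>) \<omega> + (1 - w - w') * M i (\<theta> \<omega>) \<omega>)"

lemma weighted_payoff_le:
  assumes "strategy_path (\<theta> \<omega>) g a"
    and "L i (\<theta> \<omega>) \<omega> \<le> u" "F i (\<theta> \<omega>) \<omega> \<le> u" "M i (\<theta> \<omega>) \<omega> \<le> u"
  shows "weighted_payoff i g a \<le> u"
  unfolding weighted_payoff_def Let_def
  by (intro convex_combination_le outcome_weights_convex assms strategy_pathD[OF assms(1)] attack_range)

lemma weighted_payoff_infinity:
  assumes "strategy_path (\<theta> \<omega>) g a" "\<theta> \<omega> = \<infinity>"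
  shows "weighted_payoff i g a = preemption_value L F \<theta> i \<omega>"
  unfolding weighted_payoff_def preemption_value_def Let_def assms(2) L_inf F_inf by (simp add: algebra_simps)

text \<open>
  In the preemption region the opponent's intensity makes \<open>i\<close> indifferent.  In each form that the
  outcome probabilities can take, the payoff regroups into a combination of \<open>F\<close> and of the value
  \<open>(1 - \<alpha>) L + \<alpha> M\<close> of one attempt, which equals \<open>F\<close>.
\<close>

lemma weighted_payoff_preempting:
  assumes sp: "strategy_path (\<theta> \<omega>) g a" and fin: "\<theta> \<omega> < \<infinity>" and p: "preempts (\<theta> \<omega>)"
  shows "weighted_payoff i g a = F i (\<theta> \<omega>) \<omega>"
proof -
  define v b l f m where "v = \<theta> \<omega>" and "b = attack (opponent i)"
    and "l = L i (\<theta> \<omega>) \<omega>" and "f = F i (\<theta> \<omega>) \<omega>" and "m = M i (\<theta> \<omega>) \<omega>"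
  note defs = v_def b_def l_def f_def m_def
  have order: "f < l" "m \<le> f"
    using p M_le_F[OF fin, of i] by (auto simp: defs preempts_iff[of _ i])
  have b: "b v = (l - f) / (l - m)"
    using attack_preempting[OF _ fin p] by (simp add: defs ratio_def opponent_involution)
  then have b_pos: "0 < b v" using order by simp
  have "b v * (l - m) = l - f" using b order by simp
  then have mix: "(1 - b v) * l + b v * m = f" by (simp add: algebra_simps)
  note D = strategy_pathD[OF sp, folded v_def]
  have brange: "b t \<in> {0..1}" for t using attack_range by (simp add: b_def)
  define w where "w = lead_weight v g a b"
  define w' where "w' = follow_weight v g a b"
  have "w * l + w' * f + (1 - w - w') * m = f"
  proof -
    consider "v < first_pos v a" | "\<not> v < first_pos v a" "max (a v) (b v) = 1 \<or> min (a v) (b v) > 0"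
      | "\<not> v < first_pos v a" "\<not> (max (a v) (b v) = 1 \<or> min (a v) (b v) > 0)" by blast
    then show ?thesis
    proof cases
      case 1
      then have w: "w = (1 - b v) * g v" and w': "w' = 1 - g v"
        by (simp_all add: w_def w'_def lead_weight_def follow_weight_def)
      have "w * l + w' * f + (1 - w - w') * m = g v * ((1 - b v) * l + b v * m) + (1 - g v) * f"
        unfolding w w' by (simp add: algebra_simps)
      then show ?thesis unfolding mix by (simp add: algebra_simps)
    next
      case 2
      let ?D = "a v + b v - a v * b v"
      have D_pos: "?D > 0" using mu_denominator_pos[OF D(2) brange] b_pos D(2)[of v] by simp
      have ww: "w * ?D = a v * (1 - b v)" "w' * ?D = b v * (1 - a v)"
        using 2 D_pos by (simp_all add: w_def w'_def lead_weight_def follow_weight_def mu_L_def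
            add.commute[of "b v"] mult.commute[of "b v" "a v"])
      have "(w * l + w' * f + (1 - w - w') * m) * ?D = (w * ?D) * l + (w' * ?D) * f + (?D - w * ?D - w' * ?D) * m"
        by (simp add: algebra_simps)
      also have "\<dots> = a v * ((1 - b v) * l + b v * m) + b v * (1 - a v) * f"
        unfolding ww by (simp add: algebra_simps)
      also have "\<dots> = f * ?D" unfolding mix by (simp add: algebra_simps)
      finally show ?thesis using D_pos by simp
    next
      case 3
      \<comment> \<open>The deviation has intensity \<open>0\<close> at \<open>v\<close>, while its limits from the right are arbitrary;
        the two averaged limits are linked by the right-continuity of the opponent's intensity.\<close>
      then have a0: "a v = 0" and b1: "b v < 1"
        using b_pos D(2)[of v] brange[of v] by (auto simp: min_def max_def split: if_splits)
      then have bt: "b v \<in> {0<..<1}" using b_pos by simp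
      have "right_cont_at b v" using attack_right_cont[OF fin, of "opponent i"] bt by (simp add: defs)
      then have mu: "mu_L_limit v b a = 1 - 1 / (1 - b v) * mu_L_limit v a b"
        using fin bt by (intro mu_L_limit_right_continuous D brange) (simp add: v_def)
      define k where "k = mu_L_limit v a b"
      have w: "w = (1 - b v) * k"
        using 3 a0 by (simp add: w_def lead_weight_def k_def)
      have "w' = b v + (1 - b v) * (1 - 1 / (1 - b v) * k)"
        using 3 a0 by (simp add: w'_def follow_weight_def mu k_def)
      moreover have "(1 - b v) * (1 - 1 / (1 - b v) * k) = (1 - b v) - k"
        using b1 by (simp add: right_diff_distrib)
      ultimately have w': "w' = 1 - k" by simp
      have "w * l + w' * f + (1 - w - w') * m = k * ((1 - b v) * l + b v * m) + (1 - k) * f"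
        unfolding w w' by (simp add: algebra_simps)
      then show ?thesis unfolding mix by (simp add: algebra_simps)
    qed
  qed
  then show ?thesis by (simp add: weighted_payoff_def Let_def w_def w'_def defs)
qed

lemma deviation_payoff_le:
  assumes sp: "strategy_path (\<theta> \<omega>) g a"
  shows "weighted_payoff i g a \<le> preemption_value L F \<theta> i \<omega>"
proof (cases "\<theta> \<omega> = \<infinity>")
  case True
  then show ?thesis using weighted_payoff_infinity[OF sp] by simp
next
  case False
  then have fin: "\<theta> \<omega> < \<infinity>" by (simp add: less_top)
  let ?j = "opponent i"
  note order = F_le_L_at_start[OF fin] M_le_F[OF fin]
  consider "L ?j (\<theta> \<omega>) \<omega> = F ?j (\<theta> \<omega>) \<omega>" | "preempts (\<theta> \<omega>)"
    | "L ?j (\<theta> \<omega>) \<omega> > F ?j (\<theta> \<omega>) \<omega>" "L i (\<theta> \<omega>) \<omega> = F i (\<theta> \<omega>) \<omega>"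
    using order(1)[of i] order(1)[of ?j] preempts_iff[of _ i] by fastforce
  then show ?thesis
  proof cases
    case 1
    then have "preemption_value L F \<theta> i \<omega> = L i (\<theta> \<omega>) \<omega>" by (simp add: preemption_value_def)
    moreover have "weighted_payoff i g a \<le> L i (\<theta> \<omega>) \<omega>"
      using order(1)[of i] order(2)[of i] by (intro weighted_payoff_le sp) auto
    ultimately show ?thesis by simp
  next
    case 2
    then have "preemption_value L F \<theta> i \<omega> = F i (\<theta> \<omega>) \<omega>"
      by (auto simp: preemption_value_def preempts_iff[of _ i])
    then show ?thesis using weighted_payoff_preempting[OF sp fin 2] by simp
  next
    case 3
    have "preemption_value L F \<theta> i \<omega> = F i (\<theta> \<omega>) \<omega>" using 3 by (simp add: preemption_value_def)
    moreover have "weighted_payoff i g a \<le> F i (\<theta> \<omega>) \<omega>"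
      using 3 order(2)[of i] by (intro weighted_payoff_le sp) auto
    ultimately show ?thesis by simp
  qed
qed

text \<open>
  Right after \<open>\<theta>\<close>, two positive intensities occur together only in the preemption region: outside of it, this would
  require \<open>L = F = M\<close> for both players.  Within the region the intensities
  tend to \<open>0\<close>, and \<open>\<mu>\<^sub>M\<close> is at most either of them.
\<close>

lemma eventually_no_simultaneous_attack:
  assumes fin: "\<theta> \<omega> < \<infinity>" and LF: "\<And>k. L k (\<theta> \<omega>) \<omega> = F k (\<theta> \<omega>) \<omega>"
    and FM: "\<And>k. M k (\<theta> \<omega>) \<omega> < F k (\<theta> \<omega>) \<omega>"
  shows "((\<lambda>s. mu_M (attack i s) (attack (opponent i) s)) \<longlongrightarrow> 0) (at_right (\<theta> \<omega>))"
proof -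
  let ?j = "opponent i"
  have "L k (\<theta> \<omega>) \<omega> \<noteq> M k (\<theta> \<omega>) \<omega>" for k using LF FM by (metis less_irrefl)
  then have "(ratio i \<longlongrightarrow> ratio i (\<theta> \<omega>)) (at_right (\<theta> \<omega>))"
    by (intro right_cont_ratio fin)
  then have lim: "(ratio i \<longlongrightarrow> 0) (at_right (\<theta> \<omega>))" using LF by (simp add: ratio_def)
  have gap: "eventually (\<lambda>s. M k s \<omega> < F k s \<omega>) (at_right (\<theta> \<omega>))" for k
  proof -
    have "((\<lambda>s. F k s \<omega> - M k s \<omega>) \<longlongrightarrow> F k (\<theta> \<omega>) \<omega> - M k (\<theta> \<omega>) \<omega>) (at_right (\<theta> \<omega>))"
      using F_cont[OF fin] M_cont[OF fin] unfolding right_cont_at_def by (intro tendsto_diff)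
    from order_tendstoD(1)[OF this, of 0] show ?thesis using FM[of k] by simp
  qed
  have "eventually (\<lambda>s. norm (mu_M (attack i s) (attack ?j s)) \<le> norm (ratio i s)) (at_right (\<theta> \<omega>))"
    using gap[of i] gap[of ?j] eventually_after[OF order_refl fin]
  proof eventually_elim
    case (elim s)
    show ?case
    proof (cases "preempts s")
      case True
      then show ?thesis
        using elim mu_M_le[OF attack_range attack_range, of i s ?j s]
          mu_M_nonneg[OF attack_range attack_range, of i s ?j s] by (simp add: attack_preempting)
    next
      case False
      then have "attack i s = 0 \<or> attack ?j s = 0"
        using elim attack_not_preempting[of s i] attack_not_preempting[of s ?j]
        by (auto simp: opponent_involution)
      then show ?thesis by (auto simp: mu_M_def)
    qed
  qed
  from Lim_null_comparison[OF this] show ?thesis using tendsto_norm_zero[OF lim] by simp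
qed

text \<open>
  Outside the preemption region at least one player is indifferent at \<open>\<theta>\<close>.  If one of the intensities is \<open>1\<close>, the
  outcome is deterministic and gives the stated value.  If both vanish, \<open>L = F > M\<close> for both players, and
  it matters that simultaneous stopping has probability \<open>0\<close> in the limit.
\<close>

lemma equilibrium_payoff_eq:
  "weighted_payoff i (\<lambda>t. preemption_G \<theta> i t \<omega>) (attack i) = preemption_value L F \<theta> i \<omega>"
proof (cases "\<theta> \<omega> = \<infinity>")
  case True
  then show ?thesis using weighted_payoff_infinity[OF preemption_strategy_path] by simp
next
  case False
  then have fin: "\<theta> \<omega> < \<infinity>" by (simp add: less_top)
  let ?j = "opponent i"
  let ?x = "attack i (\<theta> \<omega>)" and ?y = "attack ?j (\<theta> \<omega>)"
  note order = F_le_L_at_start[OF fin] M_le_F[OF fin]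
  note sp = preemption_strategy_path[of i]
  show ?thesis
  proof (cases "preempts (\<theta> \<omega>)")
    case True
    then show ?thesis
      using weighted_payoff_preempting[OF sp fin] by (auto simp: preemption_value_def preempts_iff[of _ i])
  next
    case False
    note x = attack_not_preempting[OF order_refl fin False, of i, folded start_is_preemption_time]
    note y = attack_not_preempting[OF order_refl fin False, of ?j, folded start_is_preemption_time]
    have max1: "weighted_payoff i (\<lambda>t. preemption_G \<theta> i t \<omega>) (attack i) =
        mu_L ?x ?y * L i (\<theta> \<omega>) \<omega> + mu_L ?y ?x * F i (\<theta> \<omega>) \<omega> +
        (1 - mu_L ?x ?y - mu_L ?y ?x) * M i (\<theta> \<omega>) \<omega>"
      if "max ?x ?y = 1"
      using that by (simp add: weighted_payoff_def Let_def lead_weight_def follow_weight_def first_pos_attack)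
    consider "?x = 1" | "?y = 1" | "?x = 0" "?y = 0" using x y by (auto split: if_splits)
    then show ?thesis
    proof cases
      case 3
      have LF: "L k (\<theta> \<omega>) \<omega> = F k (\<theta> \<omega>) \<omega>" and FM: "M k (\<theta> \<omega>) \<omega> < F k (\<theta> \<omega>) \<omega>" for k
      proof -
        have "L i (\<theta> \<omega>) \<omega> = F i (\<theta> \<omega>) \<omega> \<and> L ?j (\<theta> \<omega>) \<omega> = F ?j (\<theta> \<omega>) \<omega> \<and>
            M i (\<theta> \<omega>) \<omega> < F i (\<theta> \<omega>) \<omega> \<and> M ?j (\<theta> \<omega>) \<omega> < F ?j (\<theta> \<omega>) \<omega>"
          using 3 x y False order(1)[of i] order(1)[of ?j] order(2)[of i] order(2)[of ?j]
          by (auto simp: preempts_iff[of _ i] opponent_involution order.strict_iff_order)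
        then show "L k (\<theta> \<omega>) \<omega> = F k (\<theta> \<omega>) \<omega>" "M k (\<theta> \<omega>) \<omega> < F k (\<theta> \<omega>) \<omega>"
          using opponent_unique[of i k] by (cases "i = k", auto)+
      qed
      have "\<exists>\<^sub>F s in at_right (\<theta> \<omega>). attack i s + attack ?j s > 0"
        using frequently_preempts[OF fin False]
      proof (rule frequently_rev_mp)
        show "\<forall>\<^sub>F s in at_right (\<theta> \<omega>). preempts s \<longrightarrow> attack i s + attack ?j s > 0"
          using eventually_after[OF order_refl fin] by eventually_elim (blast intro: add_pos_pos attack_pos)
      qed
      then have "mu_L_limit (\<theta> \<omega>) (attack i) (attack ?j) + mu_L_limit (\<theta> \<omega>) (attack ?j) (attack i) = 1"
        using eventually_no_simultaneous_attack[OF fin LF FM]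
        by (intro mu_L_limit_no_coordination_failure attack_range)
      then have mu: "mu_L_limit (\<theta> \<omega>) (attack ?j) (attack i) = 1 - mu_L_limit (\<theta> \<omega>) (attack i) (attack ?j)"
        by simp
      have "weighted_payoff i (\<lambda>t. preemption_G \<theta> i t \<omega>) (attack i) = F i (\<theta> \<omega>) \<omega>"
        using 3
        by (simp add: weighted_payoff_def Let_def lead_weight_def follow_weight_def first_pos_attack mu LF)
           (simp add: algebra_simps)
      then show ?thesis using LF by (simp add: preemption_value_def)
    next
      case 1
      then show ?thesis using max1 x y False order(1)[of i] order(1)[of ?j] attack_range[of ?j "\<theta> \<omega>"]
        by (auto simp: mu_L_def preemption_value_def opponent_involution preempts_iff[of _ i] max_def split: if_splits)
    next
      case 2
      then show ?thesis using max1 x y False order(1)[of i] order(1)[of ?j] attack_range[of i "\<theta> \<omega>"]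
        by (auto simp: mu_L_def preemption_value_def opponent_involution preempts_iff[of _ i] max_def split: if_splits)
    qed
  qed
qed

lemma path_payoff_eq:
  assumes "strategy_path (\<theta> \<omega>) g a"
  shows "path_payoff (\<theta> \<omega>) (\<lambda>t. L i t \<omega>) (\<lambda>t. F i t \<omega>) (\<lambda>t. M i t \<omega>) g a
      (\<lambda>t. preemption_G \<theta> (opponent i) t \<omega>) (attack (opponent i)) = weighted_payoff i g a"
  unfolding weighted_payoff_def Let_def
  by (rule path_payoff_eq_weights[OF assms preemption_strategy_path first_pos_attack]) (simp add: preemption_G_def)

end

section \<open>Progressive measurability\<close>

text \<open>
  The grid is shifted by one step so that rounding a time down to a multiple of \<open>1/(n + 1)\<close> and then moving on
  lands strictly after that time.
\<close>

definition right_grid :: "nat \<Rightarrow> int \<Rightarrow> ennreal" where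
  "right_grid n k = ennreal ((real_of_int k + 1) / real (Suc n))"

definition round_up :: "nat \<Rightarrow> ennreal \<Rightarrow> ennreal" where
  "round_up n s = right_grid n \<lfloor>real (Suc n) * enn2real s\<rfloor>"

lemma round_up_gt:
  assumes "s < \<infinity>"
  shows "s < round_up n s"
proof -
  obtain x where x: "s = ennreal x" "0 \<le> x" using assms by (cases s) auto
  have "real (Suc n) * x < real_of_int \<lfloor>real (Suc n) * x\<rfloor> + 1" by linarith
  then have "x < (real_of_int \<lfloor>real (Suc n) * x\<rfloor> + 1) / real (Suc n)"
    by (simp add: pos_less_divide_eq mult.commute del: of_nat_Suc)
  then show ?thesis
    using x by (simp add: round_up_def right_grid_def ennreal_less_iff del: of_nat_Suc)
qed

lemma round_up_tendsto:
  assumes "s < \<infinity>"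
  shows "(\<lambda>n. round_up n s) \<longlonglongrightarrow> s"
proof -
  obtain x where x: "s = ennreal x" "0 \<le> x" using assms by (cases s) auto
  let ?y = "\<lambda>n. (real_of_int \<lfloor>real (Suc n) * x\<rfloor> + 1) / real (Suc n)"
  have "?y \<longlonglongrightarrow> x"
  proof (rule tendsto_sandwich[where f = "\<lambda>_. x" and h = "\<lambda>n. x + inverse (real (Suc n))"])
    have "x \<le> ?y n \<and> ?y n \<le> x + inverse (real (Suc n))" for n
    proof
      have "real (Suc n) * x \<le> real_of_int \<lfloor>real (Suc n) * x\<rfloor> + 1" by linarith
      then show "x \<le> ?y n"
        by (simp add: pos_le_divide_eq mult.commute del: of_nat_Suc)
      have "real_of_int \<lfloor>real (Suc n) * x\<rfloor> + 1 \<le> real (Suc n) * x + 1" by linarith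
      then have "?y n \<le> (real (Suc n) * x + 1) / real (Suc n)"
        by (intro divide_right_mono) auto
      also have "\<dots> = x + inverse (real (Suc n))"
        by (simp add: add_divide_distrib inverse_eq_divide del: of_nat_Suc)
      finally show "?y n \<le> x + inverse (real (Suc n))" .
    qed
    then show "eventually (\<lambda>n. x \<le> ?y n) sequentially"
      "eventually (\<lambda>n. ?y n \<le> x + inverse (real (Suc n))) sequentially" by simp_all
    show "(\<lambda>n. x + inverse (real (Suc n))) \<longlonglongrightarrow> x"
      using tendsto_add[OF tendsto_const LIMSEQ_inverse_real_of_nat, of x] by simp
  qed simp
  then have "(\<lambda>n. ennreal (?y n)) \<longlonglongrightarrow> ennreal x" by (rule tendsto_ennrealI)
  then show ?thesis
    using x by (simp add: round_up_def right_grid_def del: of_nat_Suc)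
qed

context usual_filtration
begin

lemma sets_F_sub_P: "sets (\<F> t) \<subseteq> sets P"
  using sets_F_mono[of t \<infinity>] sub_P by auto

lemma measurable_F_P: "X \<in> \<F> t \<rightarrow>\<^sub>M N \<Longrightarrow> X \<in> P \<rightarrow>\<^sub>M N"
  by (rule measurable_from_subalg[of P "\<F> t"]) (simp_all add: subalgebra_def space_F sets_F_sub_P)

lemma measurable_F_mono: "X \<in> \<F> s \<rightarrow>\<^sub>M N \<Longrightarrow> s \<le> t \<Longrightarrow> X \<in> \<F> t \<rightarrow>\<^sub>M N"
  by (rule measurable_from_subalg[of "\<F> t" "\<F> s"]) (simp_all add: subalgebra_def space_F sets_F_mono)

lemma subset_null_set_F:
  assumes "N \<in> null_sets P" "A \<subseteq> N"
  shows "A \<in> sets (\<F> t)"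
proof -
  have "A \<in> sets (\<F> 0)" using complete2[OF assms(2,1)] null_sets by blast
  then show ?thesis using sets_F_mono[of 0 t] by auto
qed

text \<open>
  Every subset of a null set belongs to every \<open>\<sigma>\<close>-algebra of the filtration, so changing an event on a null set
  does not affect when it is known.
\<close>

lemma sets_F_modification:
  assumes "N \<in> null_sets P" "A \<in> sets (\<F> t)" "B \<subseteq> space P" "\<And>\<omega>. \<omega> \<in> space P - N \<Longrightarrow> \<omega> \<in> A \<longleftrightarrow> \<omega> \<in> B"
  shows "B \<in> sets (\<F> t)"
proof -
  have "A \<subseteq> space P" using assms(2) sets.sets_into_space space_F by metis
  then have B: "B = (A - N) \<union> (B \<inter> N)" using assms(3,4) by blast
  have "A - N \<in> sets (\<F> t)" "B \<inter> N \<in> sets (\<F> t)"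
    using assms(2) subset_null_set_F[OF assms(1)] by auto
  then show ?thesis by (subst B) (rule sets.Un)
qed

definition progressive_algebra :: "ennreal \<Rightarrow> (ennreal \<times> 'a) measure" where
  "progressive_algebra t = restrict_space borel {..t} \<Otimes>\<^sub>M \<F> t"

lemma space_progressive_algebra: "space (progressive_algebra t) = {..t} \<times> space P"
  by (simp add: progressive_algebra_def space_pair_measure space_restrict_space space_F)

lemma progressively_measurable_iff:
  "progressively_measurable \<F> X \<longleftrightarrow> (\<forall>t<\<infinity>. (\<lambda>x. X (fst x) (snd x)) \<in> borel_measurable (progressive_algebra t))"
  by (simp add: progressively_measurable_def progressive_algebra_def split_beta')

lemma measurable_fst_progressive [measurable]: "fst \<in> progressive_algebra t \<rightarrow>\<^sub>M borel"
proof -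
  have "(\<lambda>x. x) \<in> restrict_space borel {..t} \<rightarrow>\<^sub>M (borel :: ennreal measure)"
    by (rule measurable_restrict_space1) simp
  from measurable_compose[OF measurable_fst this] show ?thesis by (simp add: progressive_algebra_def)
qed

lemma measurable_snd_progressive: "f \<in> \<F> t \<rightarrow>\<^sub>M N \<Longrightarrow> (\<lambda>x. f (snd x)) \<in> progressive_algebra t \<rightarrow>\<^sub>M N"
  unfolding progressive_algebra_def by (rule measurable_compose[OF measurable_snd])

text \<open>
  Sampling the process slightly later, on a countable grid and never after \<open>t\<close>, gives measurable
  approximations; they converge by right-continuity.
\<close>

lemma progressive_modification:
  assumes adapted: "adapted \<F> X" and N: "N \<in> null_sets P"
    and cont: "\<And>\<omega> s. \<omega> \<in> space P - N \<Longrightarrow> s < \<infinity> \<Longrightarrow> right_cont_at (\<lambda>s. X s \<omega>) s" and t: "t < \<infinity>"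
  shows "(\<lambda>x. if snd x \<in> N then 0 else X (fst x) (snd x)) \<in> borel_measurable (progressive_algebra t)"
proof (rule borel_measurable_LIMSEQ_real)
  let ?Y = "\<lambda>n x. if snd x \<in> N then 0 else X (min t (round_up n (fst x))) (snd x)"
  have [measurable]: "Measurable.pred (progressive_algebra t) (\<lambda>x. snd x \<in> N)"
    by (rule measurable_snd_progressive) (use subset_null_set_F[OF N subset_refl, of t] in simp)
  have "(\<lambda>x. X (min t (round_up n (fst x))) (snd x)) \<in> borel_measurable (progressive_algebra t)" for n
    unfolding round_up_def
  proof (rule measurable_compose_countable'[where I = UNIV and f = "\<lambda>k x. X (min t (right_grid n k)) (snd x)"])
    show "(\<lambda>x. X (min t (right_grid n k)) (snd x)) \<in> borel_measurable (progressive_algebra t)" for k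
    proof (rule measurable_snd_progressive, rule measurable_F_mono)
      show "X (min t (right_grid n k)) \<in> borel_measurable (\<F> (min t (right_grid n k)))"
        using adapted by (simp add: adapted_def)
    qed simp
    show "(\<lambda>x. \<lfloor>real (Suc n) * enn2real (fst x)\<rfloor>) \<in> progressive_algebra t \<rightarrow>\<^sub>M count_space UNIV"
      by measurable
  qed simp
  then show "?Y n \<in> borel_measurable (progressive_algebra t)" for n by measurable
  show "(\<lambda>n. ?Y n x) \<longlonglongrightarrow> (if snd x \<in> N then 0 else X (fst x) (snd x))" if "x \<in> space (progressive_algebra t)" for x
  proof -
    obtain s \<omega> where x: "x = (s, \<omega>)" "s \<le> t" "\<omega> \<in> space P" using \<open>x \<in> space (progressive_algebra t)\<close>
      by (auto simp: space_progressive_algebra)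
    have s: "s < \<infinity>" using x t by (auto intro: order_le_less_trans)
    have "(\<lambda>n. X (min t (round_up n s)) \<omega>) \<longlonglongrightarrow> X s \<omega>" if "\<omega> \<notin> N"
    proof (cases "s = t")
      case True
      have "min t (round_up n s) = s" for n using round_up_gt[OF s, of n] True by simp
      then show ?thesis by simp
    next
      case False
      then have "s < t" using x by simp
      have "(\<lambda>n. min t (round_up n s)) \<longlonglongrightarrow> min t s"
        by (intro tendsto_min tendsto_const round_up_tendsto s)
      moreover have "min t (round_up n s) \<in> {s<..} \<and> min t (round_up n s) \<noteq> s" for n
      proof -
        have "s < min t (round_up n s)" using round_up_gt[OF s] \<open>s < t\<close> by simp
        then show ?thesis by (metis greaterThan_iff less_irrefl)
      qed
      ultimately have "filterlim (\<lambda>n. min t (round_up n s)) (at_right s) sequentially"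
        using x by (simp add: filterlim_at min_absorb2)
      with cont[of \<omega> s] show ?thesis
        using s that x by (auto simp: right_cont_at_def intro: filterlim_compose)
    qed
    then show ?thesis by (simp add: x)
  qed
qed

text \<open>
  On the null set where paths fail to be right-continuous, sampling gives no information.  There joint
  measurability with respect to \<open>P\<close> takes over: all subsets of the null set are in \<open>\<F> t\<close>, so the map \<open>\<psi>\<close> that
  collapses the complement of the null set to a point is measurable from \<open>\<F> t\<close> to \<open>P\<close>.
\<close>

lemma progressively_measurable_right_continuous:
  assumes adapted: "adapted \<F> X" and "AE_right_continuous P X" and meas: "measurable_process P X"
  shows "progressively_measurable \<F> X"
  unfolding progressively_measurable_iff
proof (intro allI impI)
  fix t :: ennreal assume t: "t < \<infinity>"
  obtain N where N: "N \<in> null_sets P"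
    "\<And>\<omega> s. \<omega> \<in> space P - N \<Longrightarrow> s < \<infinity> \<Longrightarrow> right_cont_at (\<lambda>s. X s \<omega>) s"
    using AE_E3[OF assms(2)[unfolded AE_right_continuous_def]] by metis
  obtain \<omega>0 where "\<omega>0 \<in> space P" using not_empty by auto
  define \<psi> where "\<psi> \<omega> = (if \<omega> \<in> N then \<omega> else \<omega>0)" for \<omega>
  have \<psi>: "\<psi> \<in> \<F> t \<rightarrow>\<^sub>M P"
  proof (rule measurableI)
    show "\<psi> \<omega> \<in> space P" if "\<omega> \<in> space (\<F> t)" for \<omega>
      using that \<open>\<omega>0 \<in> space P\<close> by (simp add: \<psi>_def space_F)
    fix A
    have "\<psi> -` A \<inter> space (\<F> t) = (A \<inter> N) \<union> (if \<omega>0 \<in> A then space (\<F> t) - N else {})"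
      using sets.sets_into_space[OF null_setsD2[OF N(1)]] by (auto simp: \<psi>_def space_F split: if_splits)
    then show "\<psi> -` A \<inter> space (\<F> t) \<in> sets (\<F> t)"
      using subset_null_set_F[OF N(1)] by (auto intro!: sets.Diff)
  qed
  have meas': "(\<lambda>x. X (fst x) (snd x)) \<in> borel_measurable (restrict_space borel {..<\<infinity>} \<Otimes>\<^sub>M P)"
    using meas by (simp add: measurable_process_def split_beta')
  have "(\<lambda>x. (fst x, \<psi> (snd x))) \<in> progressive_algebra t \<rightarrow>\<^sub>M restrict_space borel {..<\<infinity>} \<Otimes>\<^sub>M P"
    using t by (intro measurable_Pair measurable_snd_progressive \<psi> measurable_restrict_space2 measurable_fst_progressive)
      (auto simp: space_progressive_algebra intro: order_le_less_trans)
  from measurable_compose[OF this meas']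
  have "(\<lambda>x. X (fst x) (\<psi> (snd x))) \<in> borel_measurable (progressive_algebra t)" by simp
  moreover have "Measurable.pred (progressive_algebra t) (\<lambda>x. snd x \<in> N)"
    by (rule measurable_snd_progressive) (use subset_null_set_F[OF N(1) subset_refl, of t] in simp)
  moreover have "(\<lambda>x. if snd x \<in> N then 0 else X (fst x) (snd x)) \<in> borel_measurable (progressive_algebra t)"
    by (rule progressive_modification[OF adapted N(1) _ t]) (rule N(2))
  ultimately have "(\<lambda>x. if snd x \<in> N then X (fst x) (\<psi> (snd x)) else
      (if snd x \<in> N then 0 else X (fst x) (snd x))) \<in> borel_measurable (progressive_algebra t)"
    by - (rule measurable_If, assumption, assumption, simp only: pred_def)
  also have "(\<lambda>x. if snd x \<in> N then X (fst x) (\<psi> (snd x)) else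
      (if snd x \<in> N then 0 else X (fst x) (snd x))) = (\<lambda>x. X (fst x) (snd x))"
    by (auto simp: \<psi>_def fun_eq_iff)
  finally show "(\<lambda>x. X (fst x) (snd x)) \<in> borel_measurable (progressive_algebra t)" .
qed

text \<open>
  A property that persists to the right and holds at some time in an open interval holds at a time from a
  countable dense set; the exceptional null set is harmless by completeness.
\<close>

lemma sets_exists_between:
  assumes B: "\<And>t. Measurable.pred (\<F> t) (B t)" and N: "N \<in> null_sets P"
    and open_right: "\<And>t \<omega>. \<omega> \<in> space P - N \<Longrightarrow> t < \<infinity> \<Longrightarrow> B t \<omega> \<Longrightarrow> eventually (\<lambda>s. B s \<omega>) (at_right t)"
  shows "{\<omega> \<in> space P. \<exists>u. p < u \<and> u < r \<and> B u \<omega>} \<in> sets (\<F> r)"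
proof -
  obtain D :: "ennreal set" where D: "countable D" "\<And>X. open X \<Longrightarrow> X \<noteq> {} \<Longrightarrow> \<exists>d\<in>D. d \<in> X"
    using countable_dense_setE by auto
  let ?A = "\<Union>d\<in>D \<inter> {p<..<r}. {\<omega> \<in> space (\<F> r). B d \<omega>}"
  show ?thesis
  proof (rule sets_F_modification[OF N])
    have "{\<omega> \<in> space (\<F> r). B d \<omega>} \<in> sets (\<F> r)" if "d < r" for d
      using measurable_F_mono[OF B, of d r] that by (auto simp: pred_def)
    then show "?A \<in> sets (\<F> r)"
      using D(1) by (intro sets.countable_UN'') auto
    show "\<omega> \<in> ?A \<longleftrightarrow> \<omega> \<in> {\<omega> \<in> space P. \<exists>u. p < u \<and> u < r \<and> B u \<omega>}" if \<omega>: "\<omega> \<in> space P - N" for \<omega>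
    proof
      assume "\<omega> \<in> {\<omega> \<in> space P. \<exists>u. p < u \<and> u < r \<and> B u \<omega>}"
      then obtain u where u: "p < u" "u < r" "B u \<omega>" by auto
      then have "u < \<infinity>" by (metis order_less_le_trans top_greatest infinity_ennreal_def)
      from open_right[OF \<omega> this u(3)] obtain b where b: "u < b" "\<And>y. u < y \<Longrightarrow> y < b \<Longrightarrow> B y \<omega>"
        unfolding eventually_at_right_ennreal[OF \<open>u < \<infinity>\<close>] by blast
      have "u < min b r" using b u by simp
      then have "{u<..<min b r} \<noteq> {}" using dense by (metis empty_iff greaterThanLessThan_iff)
      then obtain d where "d \<in> D" "d \<in> {u<..<min b r}" using D(2)[of "{u<..<min b r}"] by auto
      then show "\<omega> \<in> ?A" using \<omega> b(2)[of d] u by (auto simp: space_F)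
    qed (auto simp: space_F)
  qed auto
qed

text \<open>
  Recurrence immediately after \<open>s < t\<close> is visible before \<open>t\<close>.  At \<open>s = t\<close> it is known at every later time,
  hence already at \<open>t\<close> because the filtration is right-continuous.
\<close>

lemma progressive_frequently_right:
  assumes B: "\<And>t. Measurable.pred (\<F> t) (B t)" and N: "N \<in> null_sets P"
    and open_right: "\<And>t \<omega>. \<omega> \<in> space P - N \<Longrightarrow> t < \<infinity> \<Longrightarrow> B t \<omega> \<Longrightarrow> eventually (\<lambda>s. B s \<omega>) (at_right t)"
    and t: "t < \<infinity>"
  shows "Measurable.pred (progressive_algebra t) (\<lambda>x. \<exists>\<^sub>F u in at_right (fst x). B u (snd x))"
proof -
  obtain D :: "ennreal set" where D: "countable D" "\<And>X. open X \<Longrightarrow> X \<noteq> {} \<Longrightarrow> \<exists>d\<in>D. d \<in> X"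
    using countable_dense_setE by auto
  have dense_D: "\<exists>d\<in>D. a < d \<and> d < b" if "a < b" for a b
  proof -
    have "{a<..<b} \<noteq> {}" using dense[OF that] by auto
    then show ?thesis using D(2)[of "{a<..<b}"] by auto
  qed
  define E where "E p r = (\<lambda>\<omega>. \<exists>u. p < u \<and> u < r \<and> B u \<omega>)" for p r
  have E: "Measurable.pred (\<F> t) (E p r)" if "r \<le> t" for p r t
    using sets_exists_between[OF B N open_right, of p r] sets_F_mono[OF that] by (auto simp: pred_def space_F E_def)
  have iff: "(\<exists>\<^sub>F u in at_right s. B u \<omega>) \<longleftrightarrow>
      (\<forall>r\<in>D. s < r \<and> r < t' \<longrightarrow> (\<exists>p\<in>D. s < p \<and> p < r \<and> E p r \<omega>))" if "s < t'" for s t' \<omega>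
  proof -
    have s: "s < \<infinity>" using that by (metis order_less_le_trans top_greatest infinity_ennreal_def)
    have "(\<exists>\<^sub>F u in at_right s. B u \<omega>) \<longleftrightarrow> (\<forall>b>s. \<exists>u>s. u < b \<and> B u \<omega>)"
      unfolding frequently_def eventually_at_right_ennreal[OF s] by auto
    also have "\<dots> \<longleftrightarrow> (\<forall>r\<in>D. s < r \<and> r < t' \<longrightarrow> (\<exists>p\<in>D. s < p \<and> p < r \<and> E p r \<omega>))"
    proof safe
      fix r assume all: "\<forall>b>s. \<exists>u>s. u < b \<and> B u \<omega>" and r: "r \<in> D" "s < r" "r < t'"
      then obtain u where u: "s < u" "u < r" "B u \<omega>" by blast
      obtain p where p: "p \<in> D" "s < p" "p < u" using dense_D[OF u(1)] by blast
      then have "E p r \<omega>" unfolding E_def using u by blast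
      moreover have "p < r" using p u by (blast intro: less_trans)
      ultimately show "\<exists>p\<in>D. s < p \<and> p < r \<and> E p r \<omega>" using p by blast
    next
      fix b assume all: "\<forall>r\<in>D. s < r \<and> r < t' \<longrightarrow> (\<exists>p\<in>D. s < p \<and> p < r \<and> E p r \<omega>)" and b: "s < b"
      obtain r where r: "r \<in> D" "s < r" "r < min b t'" using dense_D[of s "min b t'"] b \<open>s < t'\<close> by auto
      then obtain p where "s < p" "E p r \<omega>" using all by auto
      then show "\<exists>u>s. u < b \<and> B u \<omega>" using r unfolding E_def by (auto intro: less_trans)
    qed
    finally show ?thesis .
  qed
  have pred_before: "Measurable.pred (progressive_algebra t) (\<lambda>x. \<forall>r\<in>D. fst x < r \<and> r < t \<longrightarrow>
      (\<exists>p\<in>D. fst x < p \<and> p < r \<and> E p r (snd x)))"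
  proof (intro measurable_pred_countable D)
    fix r assume "r \<in> D"
    show "Measurable.pred (progressive_algebra t) (\<lambda>x. fst x < r \<and> r < t \<longrightarrow>
      (\<exists>p\<in>D. fst x < p \<and> p < r \<and> E p r (snd x)))"
    proof (cases "r < t")
      case True
      have [measurable]: "Measurable.pred (progressive_algebra t) (\<lambda>x. E p r (snd x))" for p
        using True by (intro measurable_snd_progressive E) simp
      show ?thesis using D(1) by measurable
    qed simp
  qed
  have pred_now: "Measurable.pred (\<F> t) (\<lambda>\<omega>. \<exists>\<^sub>F u in at_right t. B u \<omega>)"
  proof -
    have "{\<omega> \<in> space P. \<exists>\<^sub>F u in at_right t. B u \<omega>} \<in> sets (\<F> t')" if "t < t'" for t'
    proof -
      have "Measurable.pred (\<F> t') (\<lambda>\<omega>. \<forall>r\<in>D. t < r \<and> r < t' \<longrightarrow>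
          (\<exists>p\<in>D. t < p \<and> p < r \<and> E p r \<omega>))"
      proof (intro measurable_pred_countable D)
        fix r assume "r \<in> D"
        show "Measurable.pred (\<F> t') (\<lambda>\<omega>. t < r \<and> r < t' \<longrightarrow> (\<exists>p\<in>D. t < p \<and> p < r \<and> E p r \<omega>))"
        proof (cases "r < t'")
          case True
          then have [measurable]: "Measurable.pred (\<F> t') (E p r)" for p by (intro E) simp
          show ?thesis using D(1) by measurable
        qed simp
      qed
      then show ?thesis unfolding iff[OF that] by (simp add: pred_def space_F)
    qed
    then show ?thesis using right_continuous[OF t] by (simp add: pred_def space_F)
  qed
  have "Measurable.pred (progressive_algebra t) (\<lambda>x. if fst x < t
      then \<forall>r\<in>D. fst x < r \<and> r < t \<longrightarrow> (\<exists>p\<in>D. fst x < p \<and> p < r \<and> E p r (snd x))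
      else \<exists>\<^sub>F u in at_right t. B u (snd x))"
    using pred_before measurable_snd_progressive[OF pred_now] by measurable
  then show ?thesis
    by (rule measurable_cong[THEN iffD1, rotated]) (auto simp: space_progressive_algebra iff)
qed

lemma measurable_min_stopping_time:
  assumes \<theta>: "stopping_time \<F> \<theta>"
  shows "(\<lambda>\<omega>. min (\<theta> \<omega>) t) \<in> \<F> t \<rightarrow>\<^sub>M borel"
proof (rule borel_measurableI_le)
  fix y
  have "Measurable.pred (\<F> t) (\<lambda>\<omega>. \<theta> \<omega> \<le> y)" if "y < t"
    using stopping_time_le_const[OF \<theta>, of y t] that by simp
  then show "{\<omega> \<in> space (\<F> t). min (\<theta> \<omega>) t \<le> y} \<in> sets (\<F> t)"
    by (cases "y < t") (auto simp: min_le_iff_disj pred_def not_less)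
qed

text \<open>
  On \<open>[0,t]\<close> only the truncation of \<open>\<theta>\<close> at \<open>t\<close> is known at \<open>t\<close>, and the event \<open>t < \<theta>\<close> has to be added at the right
  end point.
\<close>

lemma progressive_before_stopping_time:
  assumes \<theta>: "stopping_time \<F> \<theta>"
  shows "Measurable.pred (progressive_algebra t) (\<lambda>x. fst x < \<theta> (snd x))"
proof -
  note [measurable] = measurable_snd_progressive[OF measurable_min_stopping_time[OF \<theta>, of t]]
    measurable_snd_progressive[OF stopping_timeD2[OF \<theta>, of t]]
  have "Measurable.pred (progressive_algebra t)
      (\<lambda>x. fst x < min (\<theta> (snd x)) t \<or> fst x = t \<and> t < \<theta> (snd x))"
    by measurable
  then show ?thesis
    by (rule measurable_cong[THEN iffD1, rotated]) (auto simp: space_progressive_algebra)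
qed

text \<open>
  For finite \<open>t\<close> and on \<open>\<theta> \<le> t\<close> the value at \<open>\<theta>\<close> is the value at the truncation of \<open>\<theta>\<close>, which is known at \<open>t\<close>.
  The end point \<open>t = \<infinity>\<close> follows by exhausting \<open>\<theta> < \<infinity>\<close>.
\<close>

lemma stopped_progressive_measurable:
  assumes \<theta>: "stopping_time \<F> \<theta>" and X: "progressively_measurable \<F> X" and X_inf: "X \<infinity> \<in> borel_measurable (\<F> \<infinity>)"
  shows "(\<lambda>\<omega>. X (\<theta> \<omega>) \<omega>) \<in> borel_measurable (pre_sigma \<theta>)"
proof (rule measurableI)
  fix A :: "real set" assume A: "A \<in> sets borel"
  have fin: "{\<omega> \<in> space P. X (\<theta> \<omega>) \<omega> \<in> A \<and> \<theta> \<omega> \<le> t} \<in> sets (\<F> t)" if t: "t < \<infinity>" for t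
  proof -
    have "(\<lambda>\<omega>. (min (\<theta> \<omega>) t, \<omega>)) \<in> \<F> t \<rightarrow>\<^sub>M progressive_algebra t"
      unfolding progressive_algebra_def
      by (intro measurable_Pair measurable_restrict_space2 measurable_min_stopping_time \<theta>) auto
    from measurable_compose[OF this, of "\<lambda>x. X (fst x) (snd x)"]
    have "(\<lambda>\<omega>. X (min (\<theta> \<omega>) t) \<omega>) \<in> borel_measurable (\<F> t)"
      using X t by (simp add: progressively_measurable_iff)
    from measurable_sets[OF this A] stopping_timeD[OF \<theta>, of t]
    have "((\<lambda>\<omega>. X (min (\<theta> \<omega>) t) \<omega>) -` A \<inter> space (\<F> t)) \<inter> {\<omega> \<in> space (\<F> t). \<theta> \<omega> \<le> t} \<in> sets (\<F> t)"
      by (simp add: pred_def)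
    also have "((\<lambda>\<omega>. X (min (\<theta> \<omega>) t) \<omega>) -` A \<inter> space (\<F> t)) \<inter> {\<omega> \<in> space (\<F> t). \<theta> \<omega> \<le> t}
        = {\<omega> \<in> space P. X (\<theta> \<omega>) \<omega> \<in> A \<and> \<theta> \<omega> \<le> t}"
      by (auto simp: space_F min_absorb1)
    finally show ?thesis .
  qed
  have "{\<omega> \<in> space P. X (\<theta> \<omega>) \<omega> \<in> A} =
      (\<Union>n. {\<omega> \<in> space P. X (\<theta> \<omega>) \<omega> \<in> A \<and> \<theta> \<omega> \<le> of_nat n}) \<union>
      ((X \<infinity> -` A \<inter> space (\<F> \<infinity>)) \<inter> {\<omega> \<in> space (\<F> \<infinity>). \<theta> \<omega> = \<infinity>})" (is "_ = ?R")
  proof (intro set_eqI iffI)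
    fix \<omega> assume \<omega>: "\<omega> \<in> {\<omega> \<in> space P. X (\<theta> \<omega>) \<omega> \<in> A}"
    show "\<omega> \<in> ?R"
    proof (cases "\<theta> \<omega> = \<infinity>")
      case True
      then show ?thesis using \<omega> by (auto simp: space_F)
    next
      case False
      then obtain n where "\<theta> \<omega> < of_nat n" using ennreal_Ex_less_of_nat[of "\<theta> \<omega>"] by (auto simp: less_top)
      then show ?thesis using \<omega> by (auto intro!: exI[of _ n])
    qed
  qed (auto simp: space_F)
  also have "?R \<in> sets (\<F> \<infinity>)"
  proof (rule sets.Un[OF sets.countable_UN sets.Int[OF measurable_sets[OF X_inf A]]])
    show "range (\<lambda>n. {\<omega> \<in> space P. X (\<theta> \<omega>) \<omega> \<in> A \<and> \<theta> \<omega> \<le> of_nat n}) \<subseteq> sets (\<F> \<infinity>)"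
      using fin sets_F_mono[of _ \<infinity>] of_nat_less_top by fastforce
    show "{\<omega> \<in> space (\<F> \<infinity>). \<theta> \<omega> = \<infinity>} \<in> sets (\<F> \<infinity>)"
      using stopping_time_eq_const[OF \<theta>, of \<infinity>] by (simp add: pred_def)
  qed
  finally have inf: "{\<omega> \<in> space P. X (\<theta> \<omega>) \<omega> \<in> A} \<in> sets (\<F> \<infinity>)" .
  show "(\<lambda>\<omega>. X (\<theta> \<omega>) \<omega>) -` A \<inter> space (pre_sigma \<theta>) \<in> sets (pre_sigma \<theta>)"
  proof (rule sets_pre_sigmaI[OF \<theta>])
    fix t
    have "{\<omega> \<in> (\<lambda>\<omega>. X (\<theta> \<omega>) \<omega>) -` A \<inter> space (pre_sigma \<theta>). \<theta> \<omega> \<le> t} =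
        {\<omega> \<in> space P. X (\<theta> \<omega>) \<omega> \<in> A \<and> \<theta> \<omega> \<le> t}"
      by (auto simp: space_pre_sigma)
    also have "\<dots> \<in> sets (\<F> t)"
    proof (cases "t < \<infinity>")
      case False
      then have "t = \<infinity>" using less_top[of t] by auto
      then show ?thesis using inf by simp
    qed (rule fin)
    finally show "{\<omega> \<in> (\<lambda>\<omega>. X (\<theta> \<omega>) \<omega>) -` A \<inter> space (pre_sigma \<theta>). \<theta> \<omega> \<le> t} \<in> sets (\<F> t)" .
  qed
qed simp

lemma subalgebra_pre_sigma:
  assumes \<theta>: "stopping_time \<F> \<theta>"
  shows "subalgebra P (pre_sigma \<theta>)"
  unfolding subalgebra_def
proof
  show "sets (pre_sigma \<theta>) \<subseteq> sets P"
  proof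
    fix A assume "A \<in> sets (pre_sigma \<theta>)"
    from sets_pre_sigmaD[OF \<theta> this, of \<infinity>] show "A \<in> sets P" using sub_P by auto
  qed
qed (rule space_pre_sigma)

text \<open>
  Progressive measurability concerns bounded time intervals; the process stopped at \<open>n\<close> converges to the process at
  finite times.
\<close>

lemma jointly_measurable:
  assumes X: "progressively_measurable \<F> X" and X_inf: "X \<infinity> \<in> borel_measurable P"
  shows "(\<lambda>x. X (fst x) (snd x)) \<in> borel_measurable (borel \<Otimes>\<^sub>M P)"
proof (rule borel_measurable_LIMSEQ_real)
  let ?Y = "\<lambda>n x. if fst x = \<infinity> then X \<infinity> (snd x) else X (min (fst x) (of_nat n)) (snd x)"
  have "(\<lambda>x. X (min (fst x) (of_nat n)) (snd x)) \<in> borel_measurable (borel \<Otimes>\<^sub>M P)" for n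
  proof -
    have "(\<lambda>x. x) \<in> P \<rightarrow>\<^sub>M \<F> (of_nat n)" by (rule measurable_F_P[of _ "of_nat n"]) simp
    then have "(\<lambda>x. (min (fst x) (of_nat n), snd x)) \<in> borel \<Otimes>\<^sub>M P \<rightarrow>\<^sub>M progressive_algebra (of_nat n)"
      unfolding progressive_algebra_def
      by (intro measurable_Pair measurable_restrict_space2 measurable_compose[OF measurable_snd]) auto
    from measurable_compose[OF this, of "\<lambda>x. X (fst x) (snd x)"] show ?thesis
      using X of_nat_less_top by (simp add: progressively_measurable_iff)
  qed
  note [measurable] = this measurable_compose[OF measurable_snd X_inf]
  show "?Y n \<in> borel_measurable (borel \<Otimes>\<^sub>M P)" for n by measurable
  show "(\<lambda>n. ?Y n x) \<longlonglongrightarrow> X (fst x) (snd x)" for x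
  proof (cases "fst x = \<infinity>")
    case False
    then obtain k where k: "fst x < of_nat k" using ennreal_Ex_less_of_nat[of "fst x"] by (auto simp: less_top)
    have "X (min (fst x) (of_nat n)) (snd x) = X (fst x) (snd x)" if "n \<ge> k" for n
    proof -
      have "fst x \<le> of_nat n" using k that by (meson less_imp_le of_nat_mono order_trans)
      then show ?thesis by (simp add: min_absorb1)
    qed
    then have "eventually (\<lambda>n. ?Y n x = X (fst x) (snd x)) sequentially"
      using False by (auto simp: eventually_sequentially)
    then show ?thesis by (rule tendsto_eventually)
  qed simp
qed

text \<open>
  Class (D) speaks of almost surely finite stopping times.  It bounds the expectations over
  \<open>\<theta> \<le> n\<close> uniformly in \<open>n\<close>, by comparison with the truncation of \<open>\<theta>\<close> at \<open>n\<close>; the event \<open>\<theta> = \<infinity>\<close> contributes the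
  integrable terminal value.
\<close>

lemma stopped_class_D_integrable:
  assumes \<theta>: "stopping_time \<F> \<theta>" and D: "class_D P \<F> X" and X_inf: "integrable P (X \<infinity>)"
    and meas: "(\<lambda>\<omega>. X (\<theta> \<omega>) \<omega>) \<in> borel_measurable P"
  shows "integrable P (\<lambda>\<omega>. X (\<theta> \<omega>) \<omega>)"
proof -
  define S where "S = {\<lambda>\<omega>. X (\<tau> \<omega>) \<omega> | \<tau>. stopping_time \<F> \<tau> \<and> (AE \<omega> in P. \<tau> \<omega> < \<infinity>)}"
  have ui: "uniformly_integrable P S" using D by (simp add: class_D_def S_def)
  have "\<exists>c. \<forall>f\<in>S. (\<integral>\<^sup>+\<omega>. ennreal \<bar>f \<omega>\<bar> * indicator {\<omega>. c < \<bar>f \<omega>\<bar>} \<omega> \<partial>P) \<le> ennreal 1"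
    by (rule conjunct2[OF ui[unfolded uniformly_integrable_def], rule_format, OF zero_less_one])
  then obtain c where c: "\<forall>f\<in>S. (\<integral>\<^sup>+\<omega>. ennreal \<bar>f \<omega>\<bar> * indicator {\<omega>. c < \<bar>f \<omega>\<bar>} \<omega> \<partial>P) \<le> ennreal 1" ..
  have bound: "(\<integral>\<^sup>+\<omega>. ennreal \<bar>X (\<theta> \<omega>) \<omega>\<bar> * indicator {\<omega>. \<theta> \<omega> \<le> of_nat n} \<omega> \<partial>P) \<le> ennreal \<bar>c\<bar> + 1" for n
  proof -
    define f where "f = (\<lambda>\<omega>. X (min (\<theta> \<omega>) (of_nat n)) \<omega>)"
    have f: "f \<in> S"
    proof -
      have "stopping_time \<F> (\<lambda>\<omega>. min (\<theta> \<omega>) (of_nat n))"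
        by (intro stopping_time_min \<theta> stopping_time_const)
      moreover have "AE \<omega> in P. min (\<theta> \<omega>) (of_nat n) < \<infinity>"
        using of_nat_less_top by (intro AE_I2) (simp add: min_less_iff_disj)
      ultimately show ?thesis unfolding f_def S_def by (intro CollectI exI[of _ "\<lambda>\<omega>. min (\<theta> \<omega>) (of_nat n)"] conjI refl)
    qed
    then have [measurable]: "f \<in> borel_measurable P" using ui by (auto simp: uniformly_integrable_def)
    have "(\<integral>\<^sup>+\<omega>. ennreal \<bar>X (\<theta> \<omega>) \<omega>\<bar> * indicator {\<omega>. \<theta> \<omega> \<le> of_nat n} \<omega> \<partial>P)
        \<le> (\<integral>\<^sup>+\<omega>. ennreal \<bar>c\<bar> + ennreal \<bar>f \<omega>\<bar> * indicator {\<omega>. c < \<bar>f \<omega>\<bar>} \<omega> \<partial>P)"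
    proof (rule nn_integral_mono)
      fix \<omega>
      have "ennreal \<bar>f \<omega>\<bar> \<le> ennreal \<bar>c\<bar> + ennreal \<bar>f \<omega>\<bar> * indicator {\<omega>. c < \<bar>f \<omega>\<bar>} \<omega>"
        by (cases "c < \<bar>f \<omega>\<bar>") (auto simp: add_increasing intro!: ennreal_leI)
      then show "ennreal \<bar>X (\<theta> \<omega>) \<omega>\<bar> * indicator {\<omega>. \<theta> \<omega> \<le> of_nat n} \<omega>
          \<le> ennreal \<bar>c\<bar> + ennreal \<bar>f \<omega>\<bar> * indicator {\<omega>. c < \<bar>f \<omega>\<bar>} \<omega>"
        by (cases "\<theta> \<omega> \<le> of_nat n") (simp_all add: f_def min_absorb1)
    qed
    also have "\<dots> = ennreal \<bar>c\<bar> + (\<integral>\<^sup>+\<omega>. ennreal \<bar>f \<omega>\<bar> * indicator {\<omega>. c < \<bar>f \<omega>\<bar>} \<omega> \<partial>P)"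
      by (subst nn_integral_add) (auto simp: emeasure_space_1)
    also have "\<dots> \<le> ennreal \<bar>c\<bar> + 1" using c[rule_format, OF f] by (intro add_left_mono) simp
    finally show ?thesis .
  qed
  have \<theta>_meas [measurable]: "\<theta> \<in> borel_measurable P"
    using measurable_stopping_time[OF \<theta>] sets_F_sub_P space_F by blast
  note [measurable] = meas borel_measurable_integrable[OF X_inf]
  have "(\<integral>\<^sup>+\<omega>. ennreal \<bar>X (\<theta> \<omega>) \<omega>\<bar> \<partial>P) \<le>
      (\<integral>\<^sup>+\<omega>. (SUP n. ennreal \<bar>X (\<theta> \<omega>) \<omega>\<bar> * indicator {\<omega>. \<theta> \<omega> \<le> of_nat n} \<omega>) + ennreal \<bar>X \<infinity> \<omega>\<bar> \<partial>P)"
  proof (rule nn_integral_mono)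
    fix \<omega>
    show "ennreal \<bar>X (\<theta> \<omega>) \<omega>\<bar> \<le>
      (SUP n. ennreal \<bar>X (\<theta> \<omega>) \<omega>\<bar> * indicator {\<omega>. \<theta> \<omega> \<le> of_nat n} \<omega>) + ennreal \<bar>X \<infinity> \<omega>\<bar>"
    proof (cases "\<theta> \<omega> = \<infinity>")
      case False
      then obtain k where "\<theta> \<omega> < of_nat k" using ennreal_Ex_less_of_nat[of "\<theta> \<omega>"] by (auto simp: less_top)
      then have "ennreal \<bar>X (\<theta> \<omega>) \<omega>\<bar> \<le> (SUP n. ennreal \<bar>X (\<theta> \<omega>) \<omega>\<bar> * indicator {\<omega>. \<theta> \<omega> \<le> of_nat n} \<omega>)"
        by (intro SUP_upper2[of k]) auto
      then show ?thesis by (rule add_increasing2[rotated]) simp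
    qed (simp add: add_increasing)
  qed
  also have "\<dots> = (\<integral>\<^sup>+\<omega>. (SUP n. ennreal \<bar>X (\<theta> \<omega>) \<omega>\<bar> * indicator {\<omega>. \<theta> \<omega> \<le> of_nat n} \<omega>) \<partial>P) +
      (\<integral>\<^sup>+\<omega>. ennreal \<bar>X \<infinity> \<omega>\<bar> \<partial>P)"
    by (rule nn_integral_add) measurable
  also have "(\<integral>\<^sup>+\<omega>. (SUP n. ennreal \<bar>X (\<theta> \<omega>) \<omega>\<bar> * indicator {\<omega>. \<theta> \<omega> \<le> of_nat n} \<omega>) \<partial>P) =
      (SUP n. \<integral>\<^sup>+\<omega>. ennreal \<bar>X (\<theta> \<omega>) \<omega>\<bar> * indicator {\<omega>. \<theta> \<omega> \<le> of_nat n} \<omega> \<partial>P)"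
  proof (rule nn_integral_monotone_convergence_SUP)
    show "incseq (\<lambda>n \<omega>. ennreal \<bar>X (\<theta> \<omega>) \<omega>\<bar> * indicator {\<omega>. \<theta> \<omega> \<le> of_nat n} \<omega>)"
    proof (rule incseq_SucI, rule le_funI)
      fix n \<omega>
      have le: "(of_nat n :: ennreal) \<le> of_nat (Suc n)" by (simp del: of_nat_Suc)
      then show "ennreal \<bar>X (\<theta> \<omega>) \<omega>\<bar> * indicator {\<omega>. \<theta> \<omega> \<le> of_nat n} \<omega>
          \<le> ennreal \<bar>X (\<theta> \<omega>) \<omega>\<bar> * indicator {\<omega>. \<theta> \<omega> \<le> of_nat (Suc n)} \<omega>"
        by (auto simp: indicator_def simp del: of_nat_Suc dest: order_trans[OF _ le])
    qed
  qed measurable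
  also have "\<dots> \<le> ennreal \<bar>c\<bar> + 1" using bound by (rule SUP_least)
  finally have "(\<integral>\<^sup>+\<omega>. ennreal \<bar>X (\<theta> \<omega>) \<omega>\<bar> \<partial>P) \<le> ennreal \<bar>c\<bar> + 1 + (\<integral>\<^sup>+\<omega>. ennreal \<bar>X \<infinity> \<omega>\<bar> \<partial>P)"
    by (simp add: add_right_mono)
  also have "\<dots> < \<infinity>"
    using X_inf by (simp add: integrable_iff_bounded)
  finally show ?thesis using meas by (simp add: integrable_iff_bounded)
qed

end

section \<open>Measurability of path functionals\<close>

context usual_filtration
begin

lemma borel_measurable_AE_eq:
  fixes f g :: "'a \<Rightarrow> real"
  assumes g: "g \<in> borel_measurable P" and eq: "AE \<omega> in P. f \<omega> = g \<omega>"
  shows "f \<in> borel_measurable P"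
proof (rule measurableI)
  fix A :: "real set" assume A: "A \<in> sets borel"
  show "f -` A \<inter> space P \<in> sets P"
  proof (rule in_sets_AE)
    show "g -` A \<inter> space P \<in> sets P" using g A by (rule measurable_sets)
    show "AE \<omega> in P. (\<omega> \<in> g -` A \<inter> space P) = (\<omega> \<in> f -` A \<inter> space P)"
      using eq by eventually_elim simp
  qed simp
qed simp

text \<open>
  The form in which the projection theorem is applied.
\<close>

lemma measurable_exists_time:
  assumes "Measurable.pred (borel \<Otimes>\<^sub>M P) (\<lambda>x. Q (fst x) (snd x))"
  shows "Measurable.pred P (\<lambda>\<omega>. \<exists>t::ennreal. Q t \<omega>)"
proof -
  have "{x \<in> space (borel \<Otimes>\<^sub>M P). Q (fst x) (snd x)} \<in> sets (borel \<Otimes>\<^sub>M P)"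
    using assms by (simp add: pred_def)
  from measurable_projection[OF finite_measure_axioms complete_measure_axioms this]
  have "snd ` {x \<in> space (borel \<Otimes>\<^sub>M P). Q (fst x) (snd x)} \<in> sets P" .
  also have "snd ` {x \<in> space (borel \<Otimes>\<^sub>M P). Q (fst x) (snd x)} = {\<omega> \<in> space P. \<exists>t. Q t \<omega>}"
    by (force simp: space_pair_measure)
  finally show ?thesis by (simp add: pred_def)
qed

text \<open>
  The debut of a measurable set of times is below \<open>c\<close> if and only if the set contains a time below \<open>c\<close>, which is a projection.
\<close>

lemma measurable_first_pos:
  assumes \<theta>: "\<theta> \<in> borel_measurable P"
    and a: "(\<lambda>x. a (fst x) (snd x)) \<in> borel_measurable (borel \<Otimes>\<^sub>M P)"
  shows "(\<lambda>\<omega>. first_pos (\<theta> \<omega>) (\<lambda>t. a t \<omega>)) \<in> borel_measurable P"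
proof (rule borel_measurableI_less)
  fix c
  note [measurable] = a measurable_compose[OF measurable_snd \<theta>]
  have "Measurable.pred P (\<lambda>\<omega>. \<exists>t. \<theta> \<omega> \<le> t \<and> 0 < a t \<omega> \<and> t < c)"
    by (rule measurable_exists_time) measurable
  then show "{\<omega> \<in> space P. first_pos (\<theta> \<omega>) (\<lambda>t. a t \<omega>) < c} \<in> sets P"
    by (simp add: pred_def first_pos_def Inf_less_iff conj_assoc)
qed

text \<open>
  The length of the interval on which \<open>Q\<close> is required can be taken from a countable set; failure
  of \<open>Q\<close> somewhere on it is a projection.
\<close>

lemma measurable_eventually_at_right:
  fixes \<theta> :: "'a \<Rightarrow> ennreal"
  assumes \<theta>: "\<theta> \<in> borel_measurable P"
    and Q: "Measurable.pred (borel \<Otimes>\<^sub>M P) (\<lambda>x. Q (fst x) (snd x))"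
  shows "Measurable.pred P (\<lambda>\<omega>. eventually (\<lambda>s. Q s \<omega>) (at_right (\<theta> \<omega>)))"
proof -
  obtain D :: "ennreal set" where D: "countable D" "\<And>X. open X \<Longrightarrow> X \<noteq> {} \<Longrightarrow> \<exists>d\<in>D. d \<in> X"
    using countable_dense_setE by auto
  note [measurable] = Q \<theta> measurable_compose[OF measurable_snd \<theta>]
  have [measurable]: "Measurable.pred P (\<lambda>\<omega>. \<exists>t. \<theta> \<omega> < t \<and> t < d \<and> \<not> Q t \<omega>)" for d
    by (rule measurable_exists_time) measurable
  have "Measurable.pred P (\<lambda>\<omega>. \<theta> \<omega> = \<infinity> \<or> (\<exists>d\<in>D. \<theta> \<omega> < d \<and> \<not> (\<exists>t. \<theta> \<omega> < t \<and> t < d \<and> \<not> Q t \<omega>)))"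
    using D(1) by measurable
  also have "(\<lambda>\<omega>. \<theta> \<omega> = \<infinity> \<or> (\<exists>d\<in>D. \<theta> \<omega> < d \<and> \<not> (\<exists>t. \<theta> \<omega> < t \<and> t < d \<and> \<not> Q t \<omega>))) =
      (\<lambda>\<omega>. eventually (\<lambda>s. Q s \<omega>) (at_right (\<theta> \<omega>)))"
  proof
    fix \<omega>
    show "(\<theta> \<omega> = \<infinity> \<or> (\<exists>d\<in>D. \<theta> \<omega> < d \<and> \<not> (\<exists>t. \<theta> \<omega> < t \<and> t < d \<and> \<not> Q t \<omega>))) =
        eventually (\<lambda>s. Q s \<omega>) (at_right (\<theta> \<omega>))"
    proof (cases "\<theta> \<omega> = \<infinity>")
      case True
      then show ?thesis by (simp add: trivial_limit_at_right_top)
    next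
      case False
      then have fin: "\<theta> \<omega> < \<infinity>" using less_top[of "\<theta> \<omega>"] by simp
      show ?thesis
        unfolding eventually_at_right_ennreal[OF fin]
      proof
        assume "\<exists>b>\<theta> \<omega>. \<forall>y>\<theta> \<omega>. y < b \<longrightarrow> Q y \<omega>"
        then obtain b where b: "\<theta> \<omega> < b" "\<forall>y>\<theta> \<omega>. y < b \<longrightarrow> Q y \<omega>" by blast
        have "{\<theta> \<omega><..<b} \<noteq> {}" using dense[OF b(1)] by auto
        then obtain d where "d \<in> D" "\<theta> \<omega> < d" "d < b" using D(2)[of "{\<theta> \<omega><..<b}"] by auto
        then show "\<theta> \<omega> = \<infinity> \<or> (\<exists>d\<in>D. \<theta> \<omega> < d \<and> \<not> (\<exists>t. \<theta> \<omega> < t \<and> t < d \<and> \<not> Q t \<omega>))"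
          using b by (meson less_trans)
      qed (use False in blast)
    qed
  qed
  finally show ?thesis .
qed

lemma measurable_Liminf_at_right:
  fixes f :: "ennreal \<Rightarrow> 'a \<Rightarrow> ereal"
  assumes \<theta>: "\<theta> \<in> borel_measurable P"
    and f: "(\<lambda>x. f (fst x) (snd x)) \<in> borel_measurable (borel \<Otimes>\<^sub>M P)"
    and S: "Measurable.pred (borel \<Otimes>\<^sub>M P) (\<lambda>x. S (fst x) (snd x))"
  shows "(\<lambda>\<omega>. Liminf (at (\<theta> \<omega>) within {s. \<theta> \<omega> < s \<and> S s \<omega>}) (\<lambda>s. f s \<omega>)) \<in> borel_measurable P"
proof (rule borel_measurableI_ge)
  fix c :: ereal
  obtain D :: "ereal set" where D: "countable D" "\<And>X. open X \<Longrightarrow> X \<noteq> {} \<Longrightarrow> \<exists>d\<in>D. d \<in> X"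
    using countable_dense_setE by auto
  note [measurable] = f S
  have ev: "eventually (\<lambda>s. y < f s \<omega>) (at (\<theta> \<omega>) within {s. \<theta> \<omega> < s \<and> S s \<omega>}) \<longleftrightarrow>
      eventually (\<lambda>s. S s \<omega> \<longrightarrow> y < f s \<omega>) (at_right (\<theta> \<omega>))" for y \<omega>
    unfolding eventually_at_filter by (rule arg_cong2[where f = eventually]) auto
  have [measurable]: "Measurable.pred P (\<lambda>\<omega>. eventually (\<lambda>s. S s \<omega> \<longrightarrow> y < f s \<omega>) (at_right (\<theta> \<omega>)))" for y
    by (rule measurable_eventually_at_right[OF \<theta>]) measurable
  have "Measurable.pred P (\<lambda>\<omega>. \<forall>y\<in>D. y < c \<longrightarrow> eventually (\<lambda>s. S s \<omega> \<longrightarrow> y < f s \<omega>) (at_right (\<theta> \<omega>)))"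
    using D(1) by measurable
  also have "(\<lambda>\<omega>. \<forall>y\<in>D. y < c \<longrightarrow> eventually (\<lambda>s. S s \<omega> \<longrightarrow> y < f s \<omega>) (at_right (\<theta> \<omega>))) =
      (\<lambda>\<omega>. c \<le> Liminf (at (\<theta> \<omega>) within {s. \<theta> \<omega> < s \<and> S s \<omega>}) (\<lambda>s. f s \<omega>))"
  proof
    fix \<omega>
    show "(\<forall>y\<in>D. y < c \<longrightarrow> eventually (\<lambda>s. S s \<omega> \<longrightarrow> y < f s \<omega>) (at_right (\<theta> \<omega>))) =
        (c \<le> Liminf (at (\<theta> \<omega>) within {s. \<theta> \<omega> < s \<and> S s \<omega>}) (\<lambda>s. f s \<omega>))"
      unfolding le_Liminf_iff ev
    proof safe
      fix y assume all: "\<forall>y\<in>D. y < c \<longrightarrow> eventually (\<lambda>s. S s \<omega> \<longrightarrow> y < f s \<omega>) (at_right (\<theta> \<omega>))" and y: "y < c"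
      have "{y<..<c} \<noteq> {}" using dense[OF y] by auto
      then obtain d where d: "d \<in> D" "y < d" "d < c" using D(2)[of "{y<..<c}"] by auto
      then have "eventually (\<lambda>s. S s \<omega> \<longrightarrow> d < f s \<omega>) (at_right (\<theta> \<omega>))" using all by blast
      then show "eventually (\<lambda>s. S s \<omega> \<longrightarrow> y < f s \<omega>) (at_right (\<theta> \<omega>))"
        by eventually_elim (use d in \<open>auto intro: less_trans\<close>)
    qed blast
  qed
  finally show "{\<omega> \<in> space P. c \<le> Liminf (at (\<theta> \<omega>) within {s. \<theta> \<omega> < s \<and> S s \<omega>}) (\<lambda>s. f s \<omega>)} \<in> sets P"
    by (simp add: pred_def)
qed

lemma measurable_mu_L_limit:
  assumes \<theta>: "\<theta> \<in> borel_measurable P"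
    and a: "(\<lambda>x. a (fst x) (snd x)) \<in> borel_measurable (borel \<Otimes>\<^sub>M P)"
    and b: "(\<lambda>x. b (fst x) (snd x)) \<in> borel_measurable (borel \<Otimes>\<^sub>M P)"
  shows "(\<lambda>\<omega>. mu_L_limit (\<theta> \<omega>) (\<lambda>t. a t \<omega>) (\<lambda>t. b t \<omega>)) \<in> borel_measurable P"
proof -
  note [measurable] = a b
  let ?S = "\<lambda>s \<omega>. a s \<omega> + b s \<omega> > 0" and ?m = "\<lambda>s \<omega>. ereal (mu_L (a s \<omega>) (b s \<omega>))"
  have S: "Measurable.pred (borel \<Otimes>\<^sub>M P) (\<lambda>x. ?S (fst x) (snd x))" by measurable
  have m: "(\<lambda>x. ?m (fst x) (snd x)) \<in> borel_measurable (borel \<Otimes>\<^sub>M P)" unfolding mu_L_def by measurable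
  then have m': "(\<lambda>x. - ?m (fst x) (snd x)) \<in> borel_measurable (borel \<Otimes>\<^sub>M P)" by measurable
  note [measurable] = measurable_Liminf_at_right[OF \<theta> m S] measurable_Liminf_at_right[OF \<theta> m' S]
  have Limsup: "Limsup \<Phi> f = - Liminf \<Phi> (\<lambda>x. - f x)" for \<Phi> and f :: "ennreal \<Rightarrow> ereal"
    by (simp add: ereal_Liminf_uminus)
  show ?thesis unfolding mu_L_limit_def Let_def Limsup by measurable
qed

lemma measurable_at_stopping_time:
  assumes \<theta>: "\<theta> \<in> borel_measurable P"
    and a: "(\<lambda>x. a (fst x) (snd x)) \<in> borel_measurable (borel \<Otimes>\<^sub>M P)"
  shows "(\<lambda>\<omega>. a (\<theta> \<omega>) \<omega>) \<in> borel_measurable P"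
proof -
  have "(\<lambda>\<omega>. (\<theta> \<omega>, \<omega>)) \<in> P \<rightarrow>\<^sub>M borel \<Otimes>\<^sub>M P" using \<theta> by measurable
  from measurable_compose[OF this a] show ?thesis by simp
qed

lemma measurable_outcome_weights:
  assumes \<theta>: "\<theta> \<in> borel_measurable P"
    and g: "(\<lambda>\<omega>. g (\<theta> \<omega>) \<omega>) \<in> borel_measurable P"
    and a: "(\<lambda>x. a (fst x) (snd x)) \<in> borel_measurable (borel \<Otimes>\<^sub>M P)"
    and b: "(\<lambda>x. b (fst x) (snd x)) \<in> borel_measurable (borel \<Otimes>\<^sub>M P)"
  shows "(\<lambda>\<omega>. lead_weight (\<theta> \<omega>) (\<lambda>t. g t \<omega>) (\<lambda>t. a t \<omega>) (\<lambda>t. b t \<omega>)) \<in> borel_measurable P"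
    and "(\<lambda>\<omega>. follow_weight (\<theta> \<omega>) (\<lambda>t. g t \<omega>) (\<lambda>t. a t \<omega>) (\<lambda>t. b t \<omega>)) \<in> borel_measurable P"
proof -
  note [measurable] = \<theta> g measurable_at_stopping_time[OF \<theta> a] measurable_at_stopping_time[OF \<theta> b]
    measurable_first_pos[OF \<theta> a] measurable_mu_L_limit[OF \<theta> a b] measurable_mu_L_limit[OF \<theta> b a]
  show "(\<lambda>\<omega>. lead_weight (\<theta> \<omega>) (\<lambda>t. g t \<omega>) (\<lambda>t. a t \<omega>) (\<lambda>t. b t \<omega>)) \<in> borel_measurable P"
    unfolding lead_weight_def mu_L_def by measurable
  show "(\<lambda>\<omega>. follow_weight (\<theta> \<omega>) (\<lambda>t. g t \<omega>) (\<lambda>t. a t \<omega>) (\<lambda>t. b t \<omega>)) \<in> borel_measurable P"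
    unfolding follow_weight_def mu_L_def by measurable
qed

text \<open>
  The mass process of a deviation is adapted and almost surely right-continuous but need not be jointly
  measurable on the exceptional null set, so it is replaced by a modification that vanishes there.
\<close>

lemma stopped_right_continuous_measurable:
  assumes \<theta>: "\<theta> \<in> borel_measurable P" and X: "adapted \<F> X" "AE_right_continuous P X"
  shows "(\<lambda>\<omega>. X (\<theta> \<omega>) \<omega>) \<in> borel_measurable P"
proof -
  obtain N where N: "N \<in> null_sets P"
    "\<And>\<omega> s. \<omega> \<in> space P - N \<Longrightarrow> s < \<infinity> \<Longrightarrow> right_cont_at (\<lambda>s. X s \<omega>) s"
    using AE_E3[OF X(2)[unfolded AE_right_continuous_def]] by metis
  define Y where "Y t \<omega> = (if \<omega> \<in> N then 0 else X t \<omega>)" for t \<omega>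
  have prog: "progressively_measurable \<F> Y"
    unfolding progressively_measurable_iff Y_def
    by (intro allI impI progressive_modification[OF X(1) N(1)] N(2))
  have inf: "Y \<infinity> \<in> borel_measurable P"
  proof (rule borel_measurable_AE_eq)
    show "X \<infinity> \<in> borel_measurable P" using X(1) by (intro measurable_F_P[of _ \<infinity>]) (simp add: adapted_def)
    show "AE \<omega> in P. Y \<infinity> \<omega> = X \<infinity> \<omega>" using AE_not_in[OF N(1)] by eventually_elim (simp add: Y_def)
  qed
  have "(\<lambda>\<omega>. Y (\<theta> \<omega>) \<omega>) \<in> borel_measurable P"
    by (rule measurable_at_stopping_time[OF \<theta> jointly_measurable[OF prog inf]])
  moreover have "AE \<omega> in P. X (\<theta> \<omega>) \<omega> = Y (\<theta> \<omega>) \<omega>"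
    using AE_not_in[OF N(1)] by eventually_elim (simp add: Y_def)
  ultimately show ?thesis by (rule borel_measurable_AE_eq)
qed

lemma AE_strategy_path:
  assumes "ext_mixed_strategy P \<F> \<theta> G \<alpha>"
  shows "AE \<omega> in P. strategy_path (\<theta> \<omega>) (\<lambda>t. G t \<omega>) (\<lambda>t. \<alpha> t \<omega>)"
proof -
  have "AE \<omega> in P. \<forall>t. G t \<omega> \<in> {0..1} \<and> \<alpha> t \<omega> \<in> {0..1}"
    "AE \<omega> in P. \<forall>t<\<infinity>. right_cont_at (\<lambda>s. G s \<omega>) t"
    "AE \<omega> in P. mono_on {..<\<infinity>} (\<lambda>t. G t \<omega>) \<and> (\<forall>s<\<theta> \<omega>. G s \<omega> = 0)"
    "AE \<omega> in P. \<forall>t<\<infinity>. \<alpha> t \<omega> \<in> {0<..<1} \<longrightarrow> right_cont_at (\<lambda>s. \<alpha> s \<omega>) t"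
    "AE \<omega> in P. \<forall>t<\<infinity>. \<alpha> t \<omega> > 0 \<longrightarrow> G t \<omega> = 1"
    "AE \<omega> in P. G \<infinity> \<omega> = 1 \<and> \<alpha> \<infinity> \<omega> = 1"
    using assms by (auto simp: ext_mixed_strategy_def AE_right_continuous_def)
  then show ?thesis by eventually_elim (unfold strategy_path_def, blast)
qed

end

section \<open>The preemption strategies\<close>

lemma (in prob_space) AE_all_players:
  assumes "\<And>i::player. AE \<omega> in M. Q i \<omega>"
  shows "AE \<omega> in M. \<forall>i. Q i \<omega>"
  using assms[of Player1] assms[of Player2]
  by eventually_elim (metis player.exhaust)

context timing_game
begin

lemma AE_right_cont_at:
  "AE \<omega> in P. \<forall>i. \<forall>t<\<infinity>. right_cont_at (\<lambda>s. L i s \<omega>) t \<and> right_cont_at (\<lambda>s. F i s \<omega>) t \<and>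
     right_cont_at (\<lambda>s. M i s \<omega>) t"
proof (rule AE_all_players)
  fix i
  show "AE \<omega> in P. \<forall>t<\<infinity>. right_cont_at (\<lambda>s. L i s \<omega>) t \<and> right_cont_at (\<lambda>s. F i s \<omega>) t \<and>
     right_cont_at (\<lambda>s. M i s \<omega>) t"
    using right_cont[of i, unfolded AE_right_continuous_def] by eventually_elim blast
qed

text \<open>
  The order is assumed at each fixed time; right-continuity carries it from a countable dense set to all times.
\<close>

lemma AE_M_le_F: "AE \<omega> in P. \<forall>t<\<infinity>. M i t \<omega> \<le> F i t \<omega>"
proof -
  obtain D :: "ennreal set" where D: "countable D" "\<And>X. open X \<Longrightarrow> X \<noteq> {} \<Longrightarrow> \<exists>d\<in>D. d \<in> X"
    using countable_dense_setE by auto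
  have "AE \<omega> in P. \<forall>d\<in>D \<inter> {..<\<infinity>}. M i d \<omega> \<le> F i d \<omega>"
    using D(1) F_ge_M by (intro AE_ball_countable') auto
  then show ?thesis using AE_right_cont_at
  proof eventually_elim
    case (elim \<omega>)
    show ?case
    proof (intro allI impI, rule ccontr)
      fix t :: ennreal assume t: "t < \<infinity>" and "\<not> M i t \<omega> \<le> F i t \<omega>"
      then have lt: "F i t \<omega> - M i t \<omega> < 0" by simp
      have "((\<lambda>s. F i s \<omega> - M i s \<omega>) \<longlongrightarrow> F i t \<omega> - M i t \<omega>) (at_right t)"
        using elim t unfolding right_cont_at_def by (intro tendsto_diff) auto
      from order_tendstoD(2)[OF this lt]
      obtain b where b: "t < b" "\<forall>y>t. y < b \<longrightarrow> F i y \<omega> - M i y \<omega> < 0"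
        unfolding eventually_at_right_ennreal[OF t] by blast
      have "{t<..<b} \<noteq> {}" using dense[OF b(1)] by auto
      then obtain d where d: "d \<in> D" "t < d" "d < b" using D(2)[of "{t<..<b}"] by auto
      then have "d \<in> D \<inter> {..<\<infinity>}" using order_less_le_trans[OF d(3) top_greatest] by simp
      then have "M i d \<omega> \<le> F i d \<omega>" using elim by blast
      then show False using b d by force
    qed
  qed
qed

lemma AE_preemption_path:
  assumes "AE \<omega> in P. \<theta> \<omega> = preemption_time L F \<theta> \<omega>"
  shows "AE \<omega> in P. preemption_path L F M \<theta> \<omega>"
proof -
  have "AE \<omega> in P. \<forall>i. \<forall>t<\<infinity>. M i t \<omega> \<le> F i t \<omega>"
    by (rule AE_all_players) (rule AE_M_le_F)
  with AE_right_cont_at assms show ?thesis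
  proof eventually_elim
    case (elim \<omega>)
    then show ?case by unfold_locales (use L_infinity F_infinity in auto)
  qed
qed

lemma progressive_payoffs:
  "progressively_measurable \<F> (L i)" "progressively_measurable \<F> (F i)" "progressively_measurable \<F> (M i)"
  using adapted[of i] right_cont[of i] class_D[of i]
  by (auto simp: class_D_def intro: progressively_measurable_right_continuous)

definition preempting :: "ennreal \<Rightarrow> 'a \<Rightarrow> bool" where
  "preempting t \<omega> \<longleftrightarrow> min (L Player1 t \<omega> - F Player1 t \<omega>) (L Player2 t \<omega> - F Player2 t \<omega>) > 0"

lemma progressive_accumulation:
  assumes t: "t < \<infinity>"
  shows "Measurable.pred (progressive_algebra t) (\<lambda>x. \<exists>\<^sub>F u in at_right (fst x). preempting u (snd x))"
proof -
  obtain N where N: "N \<in> null_sets P"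
    "\<And>\<omega>. \<omega> \<in> space P - N \<Longrightarrow> \<forall>i. \<forall>t<\<infinity>. right_cont_at (\<lambda>s. L i s \<omega>) t \<and> right_cont_at (\<lambda>s. F i s \<omega>) t \<and>
     right_cont_at (\<lambda>s. M i s \<omega>) t"
    using AE_E3[OF AE_right_cont_at] by blast
  show ?thesis
  proof (rule progressive_frequently_right[OF _ N(1) _ t])
    show "Measurable.pred (\<F> t) (preempting t)" for t
    proof -
      have [measurable]: "L i t \<in> borel_measurable (\<F> t)" "F i t \<in> borel_measurable (\<F> t)" for i
        using adapted[of i] by (simp_all add: adapted_def)
      show ?thesis unfolding preempting_def[abs_def] by measurable
    qed
    fix t :: ennreal and \<omega> assume \<omega>: "\<omega> \<in> space P - N" and t: "t < \<infinity>" and pre: "preempting t \<omega>"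
    have "((\<lambda>s. min (L Player1 s \<omega> - F Player1 s \<omega>) (L Player2 s \<omega> - F Player2 s \<omega>)) \<longlongrightarrow>
        min (L Player1 t \<omega> - F Player1 t \<omega>) (L Player2 t \<omega> - F Player2 t \<omega>)) (at_right t)"
      using N(2)[OF \<omega>] t unfolding right_cont_at_def by (intro tendsto_min tendsto_diff) auto
    from order_tendstoD(1)[OF this, of 0] pre show "eventually (\<lambda>s. preempting s \<omega>) (at_right t)"
      by (simp add: preempting_def)
  qed
qed

text \<open>
  The definition involves the preemption time from \<open>t\<close> on only through the question whether it equals \<open>t\<close>, and
  this concerns preemption at \<open>t\<close> and immediately afterwards.
\<close>

lemma progressive_preemption_alpha:
  assumes \<theta>: "stopping_time \<F> \<theta>"
  shows "progressively_measurable \<F> (preemption_alpha L F M \<theta> i)"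
  unfolding progressively_measurable_iff
proof (intro allI impI)
  fix t :: ennreal assume t: "t < \<infinity>"
  let ?j = "opponent i"
  have [measurable]: "(\<lambda>x. L k (fst x) (snd x)) \<in> borel_measurable (progressive_algebra t)"
    "(\<lambda>x. F k (fst x) (snd x)) \<in> borel_measurable (progressive_algebra t)"
    "(\<lambda>x. M k (fst x) (snd x)) \<in> borel_measurable (progressive_algebra t)" for k
    using progressive_payoffs[of k] t by (simp_all add: progressively_measurable_iff)
  note [measurable] = progressive_before_stopping_time[OF \<theta>, of t] progressive_accumulation[OF t]
  have [measurable]: "Measurable.pred (progressive_algebra t) (\<lambda>x. preempting (fst x) (snd x))"
    unfolding preempting_def by measurable
  have "(\<lambda>x. if fst x < \<theta> (snd x) then 0 else
      if (preempting (fst x) (snd x) \<or> (\<exists>\<^sub>F u in at_right (fst x). preempting u (snd x))) \<and>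
         L ?j (fst x) (snd x) = F ?j (fst x) (snd x) \<and>
         (L i (fst x) (snd x) > F i (fst x) (snd x) \<or> F ?j (fst x) (snd x) = M ?j (fst x) (snd x)) then 1
      else (if L Player1 (fst x) (snd x) > F Player1 (fst x) (snd x) then 1 else 0) *
        (if L Player2 (fst x) (snd x) > F Player2 (fst x) (snd x) then 1 else 0) *
        ((L ?j (fst x) (snd x) - F ?j (fst x) (snd x)) / (L ?j (fst x) (snd x) - M ?j (fst x) (snd x))))
    \<in> borel_measurable (progressive_algebra t)" (is "?f \<in> _")
    by measurable
  also have "?f \<in> borel_measurable (progressive_algebra t) \<longleftrightarrow>
      (\<lambda>x. preemption_alpha L F M \<theta> i (fst x) (snd x)) \<in> borel_measurable (progressive_algebra t)"
  proof (rule measurable_cong)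
    fix x assume "x \<in> space (progressive_algebra t)"
    then have fin: "fst x < \<infinity>" using t by (auto simp: space_progressive_algebra intro: order_le_less_trans)
    have "fst x = preemption_time L F (\<lambda>_. fst x) (snd x) \<longleftrightarrow>
        preempting (fst x) (snd x) \<or> (\<exists>\<^sub>F u in at_right (fst x). preempting u (snd x))"
      using Inf_from_eq_iff[OF fin, of "\<lambda>u. preempting u (snd x)"]
      by (simp add: preemption_time_def preempting_def)
    moreover have "fst x \<noteq> top" using fin by auto
    ultimately show "?f x = preemption_alpha L F M \<theta> i (fst x) (snd x)"
      by (simp add: preemption_alpha_def Let_def of_bool_def) auto
  qed
  finally show "(\<lambda>x. preemption_alpha L F M \<theta> i (fst x) (snd x)) \<in> borel_measurable (progressive_algebra t)" .
qed

lemma preemption_ext_mixed_strategy: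
  assumes \<theta>: "stopping_time \<F> \<theta>" and start: "AE \<omega> in P. \<theta> \<omega> = preemption_time L F \<theta> \<omega>"
  shows "ext_mixed_strategy P \<F> \<theta> (preemption_G \<theta> i) (preemption_alpha L F M \<theta> i)"
proof -
  have sp: "AE \<omega> in P. strategy_path (\<theta> \<omega>) (\<lambda>t. preemption_G \<theta> i t \<omega>) (\<lambda>t. preemption_alpha L F M \<theta> i t \<omega>)"
    using AE_preemption_path[OF start] by eventually_elim (rule preemption_path.preemption_strategy_path)
  have "preemption_G \<theta> i t \<in> borel_measurable (\<F> t)" for t
  proof -
    note [measurable] = stopping_timeD[OF \<theta>, of t]
    show ?thesis unfolding preemption_G_def[abs_def] of_bool_def by measurable
  qed
  then have G: "adapted \<F> (preemption_G \<theta> i)" by (simp add: adapted_def)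
  show ?thesis
    unfolding ext_mixed_strategy_def AE_right_continuous_def
  proof (intro conjI G progressive_preemption_alpha[OF \<theta>])
    show "\<forall>\<omega>\<in>space P. preemption_G \<theta> i \<infinity> \<omega> = 1 \<and> preemption_alpha L F M \<theta> i \<infinity> \<omega> = 1"
      by (simp add: preemption_G_def preemption_alpha_def Let_def)
  qed (use sp in \<open>eventually_elim, unfold strategy_path_def, blast\<close>)+
qed

end

section \<open>The equilibrium\<close>

context timing_game
begin

lemma stopped_payoff_measurable_integrable:
  assumes \<theta>: "stopping_time \<F> \<theta>" and X: "X = L i \<or> X = F i \<or> X = M i"
  shows "(\<lambda>\<omega>. X (\<theta> \<omega>) \<omega>) \<in> borel_measurable (pre_sigma \<theta>)" and "integrable P (\<lambda>\<omega>. X (\<theta> \<omega>) \<omega>)"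
proof -
  have prog: "progressively_measurable \<F> X" and D: "class_D P \<F> X"
    and X_inf: "X \<infinity> \<in> borel_measurable (\<F> \<infinity>)" and int: "integrable P (X \<infinity>)"
    using X progressive_payoffs[of i] class_D[of i] adapted[of i] M_infinity[of i]
    by (auto simp: adapted_def L_infinity F_infinity simp del: infinity_ennreal_def)
  show 1: "(\<lambda>\<omega>. X (\<theta> \<omega>) \<omega>) \<in> borel_measurable (pre_sigma \<theta>)"
    by (rule stopped_progressive_measurable[OF \<theta> prog X_inf])
  show "integrable P (\<lambda>\<omega>. X (\<theta> \<omega>) \<omega>)"
    by (rule stopped_class_D_integrable[OF \<theta> D int measurable_from_subalg[OF subalgebra_pre_sigma[OF \<theta>] 1]])
qed

lemma stopped_integrable:
  assumes "stopping_time \<F> \<theta>"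
  shows "integrable P (\<lambda>\<omega>. L i (\<theta> \<omega>) \<omega>)" and "integrable P (\<lambda>\<omega>. F i (\<theta> \<omega>) \<omega>)"
    and "integrable P (\<lambda>\<omega>. M i (\<theta> \<omega>) \<omega>)"
  using stopped_payoff_measurable_integrable(2)[OF assms] by blast+

lemma preemption_value_measurable_integrable:
  assumes \<theta>: "stopping_time \<F> \<theta>"
  shows "preemption_value L F \<theta> i \<in> borel_measurable (pre_sigma \<theta>)" and "integrable P (preemption_value L F \<theta> i)"
proof -
  have [measurable]: "(\<lambda>\<omega>. L k (\<theta> \<omega>) \<omega>) \<in> borel_measurable (pre_sigma \<theta>)"
    "(\<lambda>\<omega>. F k (\<theta> \<omega>) \<omega>) \<in> borel_measurable (pre_sigma \<theta>)" for k
    by (auto intro: stopped_payoff_measurable_integrable(1)[OF \<theta>])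
  show 1: "preemption_value L F \<theta> i \<in> borel_measurable (pre_sigma \<theta>)"
    unfolding preemption_value_def[abs_def] of_bool_def by measurable
  show "integrable P (preemption_value L F \<theta> i)"
  proof (rule Bochner_Integration.integrable_bound)
    show "integrable P (\<lambda>\<omega>. \<bar>F i (\<theta> \<omega>) \<omega>\<bar> + \<bar>L i (\<theta> \<omega>) \<omega>\<bar>)"
      by (intro Bochner_Integration.integrable_add integrable_abs stopped_integrable \<theta>)
    show "preemption_value L F \<theta> i \<in> borel_measurable P"
      by (rule measurable_from_subalg[OF subalgebra_pre_sigma[OF \<theta>] 1])
  qed (simp add: preemption_value_def of_bool_def)
qed

text \<open>
  Against the prescribed strategy the payoff of any strategy is the conditional expectation of an integrable
  function.  Measurability of the latter is where the projection theorem enters; integrability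
  follows since it is a convex combination of the integrable payoffs at \<open>\<theta>\<close>.
\<close>

lemma payoff_against_preemption:
  fixes i :: player
  assumes \<theta>: "stopping_time \<F> \<theta>" and start: "AE \<omega> in P. \<theta> \<omega> = preemption_time L F \<theta> \<omega>"
    and ext: "ext_mixed_strategy P \<F> \<theta> Ga \<alpha>a"
  defines "W \<equiv> \<lambda>\<omega>. preemption_path.weighted_payoff L F M \<theta> \<omega> i (\<lambda>t. Ga t \<omega>) (\<lambda>t. \<alpha>a t \<omega>)"
  shows "integrable P W"
    and "AE \<omega> in P. payoff P \<F> L F M \<theta> i Ga \<alpha>a (preemption_G \<theta> (opponent i))
           (preemption_alpha L F M \<theta> (opponent i)) \<omega> = real_cond_exp P (pre_sigma \<theta>) W \<omega>"
proof -
  let ?j = "opponent i"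
  let ?b = "preemption_alpha L F M \<theta> ?j"
  note pp = AE_preemption_path[OF start] and sp = AE_strategy_path[OF ext]
  interpret finite_measure_subalgebra P "pre_sigma \<theta>"
    by unfold_locales (rule subalgebra_pre_sigma[OF \<theta>])
  have \<theta>_meas: "\<theta> \<in> borel_measurable P"
    using measurable_stopping_time[OF \<theta>] sets_F_sub_P space_F by blast
  have g: "(\<lambda>\<omega>. Ga (\<theta> \<omega>) \<omega>) \<in> borel_measurable P"
    using ext by (intro stopped_right_continuous_measurable \<theta>_meas) (auto simp: ext_mixed_strategy_def)
  have joint: "(\<lambda>x. \<alpha> (fst x) (snd x)) \<in> borel_measurable (borel \<Otimes>\<^sub>M P)"
    if "ext_mixed_strategy P \<F> \<theta> G \<alpha>" for G \<alpha>
  proof (rule jointly_measurable)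
    show "progressively_measurable \<F> \<alpha>" using that by (simp add: ext_mixed_strategy_def)
    have "\<alpha> \<infinity> \<omega> = 1" if "\<omega> \<in> space P" for \<omega>
      using \<open>ext_mixed_strategy P \<F> \<theta> G \<alpha>\<close> that by (simp add: ext_mixed_strategy_def)
    then show "\<alpha> \<infinity> \<in> borel_measurable P" by (simp cong: measurable_cong)
  qed
  define w where "w \<omega> = lead_weight (\<theta> \<omega>) (\<lambda>t. Ga t \<omega>) (\<lambda>t. \<alpha>a t \<omega>) (\<lambda>t. ?b t \<omega>)" for \<omega>
  define w' where "w' \<omega> = follow_weight (\<theta> \<omega>) (\<lambda>t. Ga t \<omega>) (\<lambda>t. \<alpha>a t \<omega>) (\<lambda>t. ?b t \<omega>)" for \<omega>
  define W' where "W' \<omega> = w \<omega> * L i (\<theta> \<omega>) \<omega> + w' \<omega> * F i (\<theta> \<omega>) \<omega> + (1 - w \<omega> - w' \<omega>) * M i (\<theta> \<omega>) \<omega>" for \<omega>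
  have W: "AE \<omega> in P. W \<omega> = W' \<omega>"
    using pp
  proof eventually_elim
    case (elim \<omega>)
    then show ?case
      by (simp add: W_def W'_def w_def w'_def preemption_path.weighted_payoff_def Let_def)
  qed
  note [measurable] = borel_measurable_integrable[OF stopped_integrable(1)[OF \<theta>, of i]]
    borel_measurable_integrable[OF stopped_integrable(2)[OF \<theta>, of i]]
    borel_measurable_integrable[OF stopped_integrable(3)[OF \<theta>, of i]]
  have [measurable]: "w \<in> borel_measurable P" "w' \<in> borel_measurable P"
    unfolding w_def w'_def
    by (intro measurable_outcome_weights \<theta>_meas g joint[OF ext] joint[OF preemption_ext_mixed_strategy[OF \<theta> start]])+
  have W'_meas: "W' \<in> borel_measurable P" unfolding W'_def by measurable
  have W_meas: "W \<in> borel_measurable P" by (rule borel_measurable_AE_eq[OF W'_meas W])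
  show "integrable P W"
  proof (rule Bochner_Integration.integrable_bound)
    show "integrable P (\<lambda>\<omega>. \<bar>L i (\<theta> \<omega>) \<omega>\<bar> + \<bar>F i (\<theta> \<omega>) \<omega>\<bar> + \<bar>M i (\<theta> \<omega>) \<omega>\<bar>)"
      by (intro Bochner_Integration.integrable_add integrable_abs stopped_integrable \<theta>)
    show "AE \<omega> in P. norm (W \<omega>) \<le> norm (\<bar>L i (\<theta> \<omega>) \<omega>\<bar> + \<bar>F i (\<theta> \<omega>) \<omega>\<bar> + \<bar>M i (\<theta> \<omega>) \<omega>\<bar>)"
      using pp sp W
    proof eventually_elim
      case (elim \<omega>)
      have "\<bar>W' \<omega>\<bar> \<le> \<bar>L i (\<theta> \<omega>) \<omega>\<bar> + \<bar>F i (\<theta> \<omega>) \<omega>\<bar> + \<bar>M i (\<theta> \<omega>) \<omega>\<bar>"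
        unfolding W'_def w_def w'_def
        by (intro abs_convex_combination_le outcome_weights_convex strategy_pathD[OF elim(2)]
            preemption_path.attack_range[OF elim(1)])
      then show ?case using elim(3) by simp
    qed
  qed (rule W_meas)
  have eq: "AE \<omega> in P. path_payoff (\<theta> \<omega>) (\<lambda>t. L i t \<omega>) (\<lambda>t. F i t \<omega>) (\<lambda>t. M i t \<omega>)
      (\<lambda>t. Ga t \<omega>) (\<lambda>t. \<alpha>a t \<omega>) (\<lambda>t. preemption_G \<theta> ?j t \<omega>) (\<lambda>t. ?b t \<omega>) = W \<omega>"
    using pp sp by eventually_elim (simp add: W_def preemption_path.path_payoff_eq)
  show "AE \<omega> in P. payoff P \<F> L F M \<theta> i Ga \<alpha>a (preemption_G \<theta> ?j) ?b \<omega> = real_cond_exp P (pre_sigma \<theta>) W \<omega>"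
    unfolding payoff_def
    by (rule real_cond_exp_cong[OF eq borel_measurable_AE_eq[OF W_meas eq] W_meas])
qed

text \<open>
  The pathwise payoff is known at \<open>\<theta>\<close>, so conditioning does not change it.
\<close>

lemma preemption_payoff:
  assumes \<theta>: "stopping_time \<F> \<theta>" and start: "AE \<omega> in P. \<theta> \<omega> = preemption_time L F \<theta> \<omega>"
  shows "AE \<omega> in P. payoff P \<F> L F M \<theta> i (preemption_G \<theta> i) (preemption_alpha L F M \<theta> i)
    (preemption_G \<theta> (opponent i)) (preemption_alpha L F M \<theta> (opponent i)) \<omega> = preemption_value L F \<theta> i \<omega>"
proof -
  interpret finite_measure_subalgebra P "pre_sigma \<theta>"
    by unfold_locales (rule subalgebra_pre_sigma[OF \<theta>])
  let ?W = "\<lambda>\<omega>. preemption_path.weighted_payoff L F M \<theta> \<omega> i (\<lambda>t. preemption_G \<theta> i t \<omega>)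
      (\<lambda>t. preemption_alpha L F M \<theta> i t \<omega>)"
  note W = payoff_against_preemption[OF \<theta> start preemption_ext_mixed_strategy[OF \<theta> start, of i], of i]
  note V = preemption_value_measurable_integrable[OF \<theta>, of i]
  have "AE \<omega> in P. ?W \<omega> = preemption_value L F \<theta> i \<omega>"
    using AE_preemption_path[OF start]
  proof eventually_elim
    case (elim \<omega>)
    then show ?case
      by (simp add: preemption_path.equilibrium_payoff_eq preemption_value_def)
  qed
  from real_cond_exp_cong[OF this borel_measurable_integrable[OF W(1)] borel_measurable_integrable[OF V(2)]]
    W(2) real_cond_exp_F_meas[OF V(2,1)]
  show ?thesis by eventually_elim simp
qed

lemma deviation_from_preemption:
  assumes \<theta>: "stopping_time \<F> \<theta>" and start: "AE \<omega> in P. \<theta> \<omega> = preemption_time L F \<theta> \<omega>"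
    and ext: "ext_mixed_strategy P \<F> \<theta> Ga \<alpha>a"
  shows "AE \<omega> in P. payoff P \<F> L F M \<theta> i Ga \<alpha>a
    (preemption_G \<theta> (opponent i)) (preemption_alpha L F M \<theta> (opponent i)) \<omega> \<le> preemption_value L F \<theta> i \<omega>"
proof -
  interpret finite_measure_subalgebra P "pre_sigma \<theta>"
    by unfold_locales (rule subalgebra_pre_sigma[OF \<theta>])
  let ?W = "\<lambda>\<omega>. preemption_path.weighted_payoff L F M \<theta> \<omega> i (\<lambda>t. Ga t \<omega>) (\<lambda>t. \<alpha>a t \<omega>)"
  note W = payoff_against_preemption[OF \<theta> start ext, of i]
  note V = preemption_value_measurable_integrable[OF \<theta>, of i]
  have "AE \<omega> in P. ?W \<omega> \<le> preemption_value L F \<theta> i \<omega>"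
    using AE_preemption_path[OF start] AE_strategy_path[OF ext]
  proof eventually_elim
    case (elim \<omega>)
    then show ?case
      using preemption_path.deviation_payoff_le[OF elim]
      by (simp add: preemption_value_def)
  qed
  from real_cond_exp_mono[OF this W(1) V(2)] W(2) real_cond_exp_F_meas[OF V(2,1)]
  show ?thesis by eventually_elim simp
qed

end

theorem proposition3p1:
  fixes P :: "'a measure" and \<F> :: "ennreal \<Rightarrow> 'a measure"
    and L F M :: "player \<Rightarrow> 'a process" and \<theta> :: "'a \<Rightarrow> ennreal"
    and G \<alpha> :: "player \<Rightarrow> 'a process"
  assumes "timing_game P \<F> L F M"
    and "stopping_time \<F> \<theta>"
    and "AE \<omega> in P. \<theta> \<omega> = preemption_time L F \<theta> \<omega>"
  defines "G \<equiv> preemption_G \<theta>"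
    and "\<alpha> \<equiv> preemption_alpha L F M \<theta>"
  shows "subgame_equilibrium P \<F> L F M \<theta> G \<alpha> \<and>
    (\<forall>i j. i \<noteq> j \<longrightarrow>
      (AE \<omega> in P. payoff P \<F> L F M \<theta> i (G i) (\<alpha> i) (G j) (\<alpha> j) \<omega> =
         F i (\<theta> \<omega>) \<omega> * of_bool (L j (\<theta> \<omega>) \<omega> > F j (\<theta> \<omega>) \<omega>) +
         L i (\<theta> \<omega>) \<omega> * of_bool (L j (\<theta> \<omega>) \<omega> = F j (\<theta> \<omega>) \<omega>)))"
proof -
  interpret timing_game P \<F> L F M by fact
  note \<theta> = assms(2) and start = assms(3)
  have eq: "AE \<omega> in P. payoff P \<F> L F M \<theta> i (G i) (\<alpha> i) (G j) (\<alpha> j) \<omega> = preemption_value L F \<theta> i \<omega>"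
    if "i \<noteq> j" for i j
    using preemption_payoff[OF \<theta> start, of i] opponent_unique[OF that] by (simp add: G_def \<alpha>_def)
  have "subgame_equilibrium P \<F> L F M \<theta> G \<alpha>"
    unfolding subgame_equilibrium_def
  proof (intro conjI allI impI)
    show "ext_mixed_strategy P \<F> \<theta> (G i) (\<alpha> i)" for i
      unfolding G_def \<alpha>_def by (rule preemption_ext_mixed_strategy[OF \<theta> start])
    show "AE \<omega> in P. payoff P \<F> L F M \<theta> i (G i) (\<alpha> i) (G j) (\<alpha> j) \<omega>
        \<ge> payoff P \<F> L F M \<theta> i Ga \<alpha>a (G j) (\<alpha> j) \<omega>"
      if "i \<noteq> j" and "ext_mixed_strategy P \<F> \<theta> Ga \<alpha>a" for i j Ga \<alpha>a
    proof -
      have "AE \<omega> in P. payoff P \<F> L F M \<theta> i Ga \<alpha>a (G j) (\<alpha> j) \<omega> \<le> preemption_value L F \<theta> i \<omega>"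
        using deviation_from_preemption[OF \<theta> start that(2), of i] opponent_unique[OF that(1)]
        by (simp add: G_def \<alpha>_def)
      with eq[OF that(1)] show ?thesis by eventually_elim simp
    qed
  qed
  moreover have "AE \<omega> in P. payoff P \<F> L F M \<theta> i (G i) (\<alpha> i) (G j) (\<alpha> j) \<omega> =
         F i (\<theta> \<omega>) \<omega> * of_bool (L j (\<theta> \<omega>) \<omega> > F j (\<theta> \<omega>) \<omega>) +
         L i (\<theta> \<omega>) \<omega> * of_bool (L j (\<theta> \<omega>) \<omega> = F j (\<theta> \<omega>) \<omega>)" if "i \<noteq> j" for i j
    using eq[OF that] opponent_unique[OF that] by (simp add: preemption_value_def)
  ultimately show ?thesis by blast
qed

end
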